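(* There is a randomized algorithm for Structural Partial Grundy Coloring running in time $\mathcal{O}\big((k(d+1))^{2k^2+k}\cdot 2^{\ell k}\cdot(m+n)\big)$, where $n=|V(G)|$ and $m=|E(G)|$, such that if the instance is a no-instance the algorithm outputs No with probability $1$, and if it is a yes-instance the algorithm outputs Yes with probability at least $2/3$.
   Context: Structural Partial Grundy Coloring: the input consists of positive integers $k,d,\ell$, a graph $G$, and $\ell$ subgraphs $A_1,\dots,A_\ell$ of $G$, each a biclique (bipartite with nonempty sides $L_t,R_t$ and all edges between them), such that $G-F$ is $d$-degenerate, where $F$ is the union of the edge sets of the $A_t$ and $G-F=(V(G),E(G)\setminus F)$. The question is whether $G$ admits a partial Grundy coloring using at least $k$ colors. A graph is $d$-degenerate if every subgraph has a vertex of degree at most $d$. A partial Grundy coloring of $G$ using $k'$ colors is a proper coloring $c:V(G)\to[k']$ such that for every $i\in[k']$ there is a vertex $v$ with $c(v)=i$ which, for every $j\in[i-1]$, has a neighbor $u$ with $c(u)=j$; "using at least $k$ colors" means for some $k'\ge k$. *)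

theory Defs
  imports "HOL-Probability.Probability"
begin

section \<open>Graphs, degeneracy, bicliques, partial Grundy colorings\<close>

definition simple_graph :: "'a set \<Rightarrow> 'a set set \<Rightarrow> bool" where
  "simple_graph V E \<longleftrightarrow> finite V \<and> (\<forall>e\<in>E. e \<subseteq> V \<and> card e = 2)"

definition subgraph :: "'a set \<Rightarrow> 'a set set \<Rightarrow> 'a set \<Rightarrow> 'a set set \<Rightarrow> bool" where
  "subgraph V' E' V E \<longleftrightarrow> simple_graph V' E' \<and> V' \<subseteq> V \<and> E' \<subseteq> E"

definition degree :: "'a set set \<Rightarrow> 'a \<Rightarrow> nat" where
  "degree E v = card {e \<in> E. v \<in> e}"

text \<open>The subgraph without vertices is excluded, as it has no vertex at all.\<close>

definition degenerate :: "nat \<Rightarrow> 'a set \<Rightarrow> 'a set set \<Rightarrow> bool" where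
  "degenerate d V E \<longleftrightarrow>
     (\<forall>V' E'. subgraph V' E' V E \<and> V' \<noteq> {} \<longrightarrow> (\<exists>v\<in>V'. degree E' v \<le> d))"

definition biclique_edges :: "'a set \<times> 'a set \<Rightarrow> 'a set set" where
  "biclique_edges A = {{u, v} |u v. u \<in> fst A \<and> v \<in> snd A}"

text \<open>A biclique is given by its two sides \<open>A = (L, R)\<close>; as a graph it has vertex set
  \<open>L \<union> R\<close> and edge set \<^term>\<open>biclique_edges A\<close>.\<close>

definition biclique_in :: "'a set \<times> 'a set \<Rightarrow> 'a set \<Rightarrow> 'a set set \<Rightarrow> bool" where
  "biclique_in A V E \<longleftrightarrow>
     fst A \<noteq> {} \<and> snd A \<noteq> {} \<and> fst A \<inter> snd A = {} \<and>
     subgraph (fst A \<union> snd A) (biclique_edges A) V E"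

definition partial_grundy_coloring ::
    "'a set \<Rightarrow> 'a set set \<Rightarrow> nat \<Rightarrow> ('a \<Rightarrow> nat) \<Rightarrow> bool" where
  "partial_grundy_coloring V E k c \<longleftrightarrow>
     (\<forall>v\<in>V. c v \<in> {1..k}) \<and>
     (\<forall>u\<in>V. \<forall>v\<in>V. {u, v} \<in> E \<longrightarrow> c u \<noteq> c v) \<and>
     (\<forall>i\<in>{1..k}. \<exists>v\<in>V. c v = i \<and>
        (\<forall>j\<in>{1..<i}. \<exists>u\<in>V. {u, v} \<in> E \<and> c u = j))"

section \<open>The problem Structural Partial Grundy Coloring\<close>

text \<open>The list \<open>As\<close> holds the bicliques, so the number of bicliques is \<^term>\<open>length As\<close>.\<close>

definition spgc_instance ::
    "nat \<Rightarrow> nat \<Rightarrow> 'a set \<Rightarrow> 'a set set \<Rightarrow> ('a set \<times> 'a set) list \<Rightarrow> bool" where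
  "spgc_instance k d V E As \<longleftrightarrow>
     k \<ge> 1 \<and> d \<ge> 1 \<and> length As \<ge> 1 \<and>
     simple_graph V E \<and>
     (\<forall>A\<in>set As. biclique_in A V E) \<and>
     degenerate d V (E - (\<Union>A\<in>set As. biclique_edges A))"

definition spgc_yes :: "nat \<Rightarrow> 'a set \<Rightarrow> 'a set set \<Rightarrow> bool" where
  "spgc_yes k V E \<longleftrightarrow> (\<exists>k'\<ge>k. \<exists>c. partial_grundy_coloring V E k' c)"

text \<open>
  An instance is written as a sequence of numbers: \<open>k\<close>, \<open>d\<close>, the number of bicliques, \<open>n\<close>, \<open>m\<close>,
  then the two end points of each edge, then for each biclique the two sides, each preceded by its
  size. Vertices are written as their positions in some enumeration \<open>vs\<close> of the vertex set. The
  enumeration, the order of the edges, the order of the end points of an edge and the order within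
  the sides are arbitrary, so an instance has many encodings.
\<close>

definition encodes ::
    "nat list \<Rightarrow> nat \<Rightarrow> nat \<Rightarrow> 'a set \<Rightarrow> 'a set set \<Rightarrow> ('a set \<times> 'a set) list \<Rightarrow> bool" where
  "encodes xs k d V E As \<longleftrightarrow>
     (\<exists>(vs :: 'a list) (es :: (nat \<times> nat) list) (bs :: (nat list \<times> nat list) list).
        distinct vs \<and> set vs = V \<and>
        (\<forall>(i, j)\<in>set es. i < length vs \<and> j < length vs) \<and>
        distinct (map (\<lambda>(i, j). {vs ! i, vs ! j}) es) \<and>
        set (map (\<lambda>(i, j). {vs ! i, vs ! j}) es) = E \<and>
        (\<forall>(ls, rs)\<in>set bs. distinct ls \<and> distinct rs \<and>
           set ls \<subseteq> {..<length vs} \<and> set rs \<subseteq> {..<length vs}) \<and>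
        map (\<lambda>(ls, rs). ((!) vs ` set ls, (!) vs ` set rs)) bs = As \<and>
        xs = [k, d, length As, card V, card E]
             @ concat (map (\<lambda>(i, j). [i, j]) es)
             @ concat (map (\<lambda>(ls, rs). length ls # ls @ length rs # rs) bs))"

section \<open>Randomized random access machines\<close>

text \<open>
  Programs for a unit-cost RAM in structured form. The memory consists of registers and of arrays
  of unbounded length; a register or an array is named by a constant in the program text, so each
  program uses finitely many of both. Memory cells hold natural numbers; the only arithmetic
  operations are addition and (truncated) subtraction.
\<close>

datatype com =
    Const nat nat
  | Add nat nat nat
  | Sub nat nat nat
  | Load nat nat nat
  | Store nat nat nat
  | Rand nat nat
  | Seq com com
  | Cond nat com com
  | While nat com

type_synonym state = "(nat \<Rightarrow> nat) \<times> (nat \<Rightarrow> nat \<Rightarrow> nat)"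

text \<open>A configuration consists of the stack of commands still to be executed and the memory
  (register contents and array contents).\<close>

type_synonym config = "com list \<times> state"

text \<open>Each step has cost one. The command \<open>Rand x y\<close> draws a number uniformly from \<open>0, \<dots>, y\<close>
  (including the value of register \<open>y\<close>, so that the range is never empty).
  A configuration with empty stack has halted and is left unchanged.\<close>

fun step :: "config \<Rightarrow> config pmf" where
  "step ([], s) = return_pmf ([], s)"
| "step (Const x n # cs, (r, a)) = return_pmf (cs, (r(x := n), a))"
| "step (Add x y z # cs, (r, a)) = return_pmf (cs, (r(x := r y + r z), a))"
| "step (Sub x y z # cs, (r, a)) = return_pmf (cs, (r(x := r y - r z), a))"
| "step (Load x b y # cs, (r, a)) = return_pmf (cs, (r(x := a b (r y)), a))"
| "step (Store b x y # cs, (r, a)) = return_pmf (cs, (r, a(b := (a b)(r x := r y))))"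
| "step (Rand x y # cs, (r, a)) = map_pmf (\<lambda>n. (cs, (r(x := n), a))) (pmf_of_set {0..r y})"
| "step (Seq c1 c2 # cs, (r, a)) = return_pmf (c1 # c2 # cs, (r, a))"
| "step (Cond x c1 c2 # cs, (r, a)) = return_pmf ((if r x \<noteq> 0 then c1 else c2) # cs, (r, a))"
| "step (While x c # cs, (r, a)) =
     return_pmf (if r x \<noteq> 0 then c # While x c # cs else cs, (r, a))"

primrec run :: "nat \<Rightarrow> config \<Rightarrow> config pmf" where
  "run 0 cfg = return_pmf cfg"
| "run (Suc t) cfg = bind_pmf (step cfg) (run t)"

text \<open>Initially, array 0 holds the input and every other memory cell holds 0.\<close>

definition init :: "com \<Rightarrow> nat list \<Rightarrow> config" where
  "init P xs =
     ([P], (\<lambda>_. 0, \<lambda>b i. if b = 0 \<and> i < length xs then xs ! i else 0))"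

definition halted :: "config \<Rightarrow> bool" where
  "halted cfg \<longleftrightarrow> fst cfg = []"

text \<open>The running time is the worst case over all outcomes of the random choices.\<close>

definition halts_within :: "com \<Rightarrow> nat list \<Rightarrow> nat \<Rightarrow> bool" where
  "halts_within P xs t \<longleftrightarrow> (\<forall>cfg\<in>set_pmf (run t (init P xs)). halted cfg)"

text \<open>The output is read off register 0 of the halted configuration: nonzero for Yes, zero for
  No. A configuration that has not halted counts as neither. The probabilities below refer to the
  situation after \<open>t\<close> steps.\<close>

definition prob_yes :: "com \<Rightarrow> nat list \<Rightarrow> nat \<Rightarrow> real" where
  "prob_yes P xs t =
     measure_pmf.prob (run t (init P xs)) {cfg. halted cfg \<and> fst (snd cfg) 0 \<noteq> 0}"

definition prob_no :: "com \<Rightarrow> nat list \<Rightarrow> nat \<Rightarrow> real" where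
  "prob_no P xs t =
     measure_pmf.prob (run t (init P xs)) {cfg. halted cfg \<and> fst (snd cfg) 0 = 0}"

end

theory Submission
  imports Defs
begin

text \<open>
  A partial Grundy coloring with at least \<open>k\<close> colors exists iff some partial proper coloring has, for
  each of the colors \<open>1, \<dots>, k\<close>, a vertex that sees all smaller colors: the remaining vertices can be
  colored greedily. Such a witness needs at most \<open>k\<^sup>2\<close> vertices, and color \<open>k\<close> occurs only once, so only
  the first \<open>k - 1\<close> classes have to be made independent.

  One round of the algorithm guesses a color for every vertex, and for each biclique and each of the
  first \<open>k - 1\<close> colors a side that loses this color. Monochromatic edges now avoid the bicliques, so
  peeling off vertices of degree at most \<open>d\<close> orients them with out-degree at most \<open>d\<close>. Each vertex then
  keeps its color with probability \<open>1 / (d + 1)\<close>, and the tail of every remaining monochromatic edge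
  loses its color. The witness survives if its vertices got their colors, were kept, and their at most
  \<open>d k\<^sup>2\<close> out-neighbors were not kept, which has probability at least
  \<open>(k (d + 1))\<^bsup>-2k\<^sup>2\<^esup> 2\<^bsup>-l(k-1)\<^esup>\<close> for \<open>l\<close> bicliques. Sparing color \<open>k\<close> the biclique guesses leaves a
  factor \<open>2\<^sup>l \<ge> l\<close> in the time bound, which pays for reading the \<open>l\<close> bicliques in each round.
\<close>

section \<open>A program logic for randomized RAM programs\<close>

text \<open>Luck affects only the success probability. Whatever the biclique guesses are, no
  biclique edge stays monochromatic in the first \<open>k - 1\<close> classes, so the peeling always
  reaches every vertex, the time bound holds for every outcome, and an accepted coloring is a
  genuine certificate: the error is one-sided.

  The base of the bound arises as follows. A witness vertex gets its color with probability
  \<open>1 / k\<close> and keeps it with probability \<open>1 / (d + 1)\<close>; its at most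
  \<open>d\<close> out-neighbours are all dropped with probability at least
  \<open>(d / (d + 1)) ^ d >= 1 / 4\<close>. This \<open>1 / 4\<close> doubles the exponent: it is
  at least \<open>1 / (k * (d + 1))\<close> once \<open>k >= 2\<close>, and for \<open>k = 1\<close>
  no vertex has to be hit.

  The obstacle on the machine is that a round may cost only \<open>n + m\<close> times factors
  \<open>k\<close> and \<open>l\<close>. Hence the peeling by linked lists and a queue, and a
  domination test with one counter per vertex instead of a table of seen colors. Random draws occur
  only in three array fills; everything between them is deterministic and verified by ordinary
  triples with a time bound.\<close>

notation Seq (infixr ";;" 60)

type_synonym regs = "nat \<Rightarrow> nat"
type_synonym arrays = "nat \<Rightarrow> nat \<Rightarrow> nat"

text \<open>Halting within \<open>T\<close> steps is demanded for every random outcome, while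
  \<open>p\<close> is only a lower bound. Both can be weakened independently, so reasoning backwards
  along the command stack may round time and probability as it goes.\<close>

definition good :: "config set \<Rightarrow> nat \<Rightarrow> config \<Rightarrow> real \<Rightarrow> bool" where
  "good A T cfg p \<longleftrightarrow>
     (\<forall>c\<in>set_pmf (run T cfg). halted c) \<and> p \<le> measure_pmf.prob (run T cfg) A"

lemma run_add: "run (s + t) cfg = bind_pmf (run s cfg) (run t)"
proof (induction s arbitrary: cfg)
  case (Suc s)
  then have "run (s + t) = (\<lambda>c. bind_pmf (run s c) (run t))" by (intro ext)
  then show ?case by (simp add: bind_assoc_pmf)
qed (simp add: bind_return_pmf)

lemma run_halted: "halted cfg \<Longrightarrow> run t cfg = return_pmf cfg"
  by (induction t) (cases cfg, auto simp: halted_def bind_return_pmf)+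

text \<open>Halted configurations are fixed points of \<open>step\<close>, so steps beyond
  \<open>T\<close> leave the distribution unchanged.\<close>

lemma good_mono:
  assumes "good A T cfg p" "T \<le> T'" "p' \<le> p"
  shows "good A T' cfg p'"
proof -
  obtain j where j: "T' = T + j" using assms(2) le_Suc_ex by blast
  have "run T' cfg = bind_pmf (run T cfg) (run j)" by (simp add: j run_add)
  also have "\<dots> = bind_pmf (run T cfg) return_pmf"
    using assms(1) by (intro bind_pmf_cong) (auto simp: good_def run_halted)
  finally have "run T' cfg = run T cfg" by (simp add: bind_return_pmf')
  then show ?thesis using assms by (auto simp: good_def)
qed

lemma good_halted:
  assumes "p \<le> (if ([], s) \<in> A then 1 else 0)"
  shows "good A 0 ([], s) p"
  using assms by (auto simp: good_def halted_def indicator_def)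

lemma good_step:
  assumes "step cfg = return_pmf cfg'" "good A T cfg' p"
  shows "good A (Suc T) cfg p"
  using assms by (simp add: good_def bind_return_pmf)

lemma good_Seq: "good A T (c1 # c2 # cs, s) p \<Longrightarrow> good A (Suc T) ((c1 ;; c2) # cs, s) p"
  by (cases s) (rule good_step[of _ "(c1 # c2 # cs, s)"], simp_all)

text \<open>Total probability over the drawn value. The bound \<open>p v\<close> may differ from
  value to value; this is how a lucky draw is rewarded.\<close>

lemma good_Rand:
  assumes "\<And>v. v \<le> r y \<Longrightarrow> good A T (cs, (r(x := v), a)) (p v)"
  shows "good A (Suc T) (Rand x y # cs, (r, a)) ((\<Sum>v\<le>r y. p v) / (real (r y) + 1))"
proof -
  let ?U = "pmf_of_set {0..r y}"
  let ?f = "\<lambda>v. run T (cs, (r(x := v), a))"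
  have run: "run (Suc T) (Rand x y # cs, (r, a)) = bind_pmf ?U ?f"
    by (simp add: bind_map_pmf)
  have "measure_pmf.prob (bind_pmf ?U ?f) A
      = (\<integral>v. measure_pmf.prob (?f v) A \<partial>measure_pmf ?U)"
    by (simp add: measure_pmf.measure_bind[where N = "count_space UNIV"]
        measure_pmf_bind space_subprob_algebra prob_space_imp_subprob_space
        measure_pmf.prob_space_axioms)
  also have "\<dots> = (\<Sum>v\<le>r y. measure_pmf.prob (?f v) A) / (real (r y) + 1)"
    by (simp add: integral_pmf_of_set atLeast0AtMost)
  also have "\<dots> \<ge> (\<Sum>v\<le>r y. p v) / (real (r y) + 1)"
    using assms by (intro divide_right_mono sum_mono) (auto simp: good_def)
  finally have "(\<Sum>v\<le>r y. p v) / (real (r y) + 1) \<le> measure_pmf.prob (bind_pmf ?U ?f) A" .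
  moreover have "\<forall>c\<in>set_pmf (bind_pmf ?U ?f). halted c"
    using assms by (auto simp: good_def)
  ultimately show ?thesis unfolding good_def run by blast
qed

section \<open>Deterministic evaluation with exact cost\<close>

inductive bs :: "com \<Rightarrow> state \<Rightarrow> nat \<Rightarrow> state \<Rightarrow> bool" where
  bs_Const: "bs (Const x n) (r, a) 1 (r(x := n), a)"
| bs_Add: "bs (Add x y z) (r, a) 1 (r(x := r y + r z), a)"
| bs_Sub: "bs (Sub x y z) (r, a) 1 (r(x := r y - r z), a)"
| bs_Load: "bs (Load x b y) (r, a) 1 (r(x := a b (r y)), a)"
| bs_Store: "bs (Store b x y) (r, a) 1 (r, a(b := (a b)(r x := r y)))"
| bs_Seq: "bs c1 s t1 s1 \<Longrightarrow> bs c2 s1 t2 s2 \<Longrightarrow> bs (Seq c1 c2) s (1 + t1 + t2) s2"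
| bs_CondT: "fst s x \<noteq> 0 \<Longrightarrow> bs c1 s t s' \<Longrightarrow> bs (Cond x c1 c2) s (1 + t) s'"
| bs_CondF: "fst s x = 0 \<Longrightarrow> bs c2 s t s' \<Longrightarrow> bs (Cond x c1 c2) s (1 + t) s'"
| bs_WhileF: "fst s x = 0 \<Longrightarrow> bs (While x c) s 1 s"
| bs_WhileT: "fst s x \<noteq> 0 \<Longrightarrow> bs c s t1 s1 \<Longrightarrow> bs (While x c) s1 t2 s2
    \<Longrightarrow> bs (While x c) s (1 + t1 + t2) s2"

text \<open>\<open>bs\<close> has no rule for \<open>Rand\<close>, so a derivation describes a
  stretch of the run that is certain: it delays the continuation by its cost and leaves the
  probability as it is.\<close>

lemma bs_good:
  "bs c s t s' \<Longrightarrow> good A T (cs, s') p \<Longrightarrow> good A (T + t) (c # cs, s) p"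
proof (induction arbitrary: cs T rule: bs.induct)
  case (bs_Seq c1 s t1 s1 c2 t2 s2)
  have "good A (Suc (T + t2 + t1)) (Seq c1 c2 # cs, s) p"
    by (rule good_step[OF _ bs_Seq.IH(1)[OF bs_Seq.IH(2)[OF bs_Seq.prems]]]) (cases s, simp)
  then show ?case by (simp add: add_ac)
next
  case (bs_CondT s x c1 t s' c2)
  have "good A (Suc (T + t)) (Cond x c1 c2 # cs, s) p"
    by (rule good_step[OF _ bs_CondT.IH[OF bs_CondT.prems]]) (cases s, use bs_CondT in simp)
  then show ?case by simp
next
  case (bs_CondF s x c2 t s' c1)
  have "good A (Suc (T + t)) (Cond x c1 c2 # cs, s) p"
    by (rule good_step[OF _ bs_CondF.IH[OF bs_CondF.prems]]) (cases s, use bs_CondF in simp)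
  then show ?case by simp
next
  case (bs_WhileF s x c)
  have "good A (Suc T) (While x c # cs, s) p"
    by (rule good_step[OF _ bs_WhileF.prems]) (cases s, use bs_WhileF in simp)
  then show ?case by simp
next
  case (bs_WhileT s x c t1 s1 t2 s2)
  have "good A (Suc (T + t2 + t1)) (While x c # cs, s) p"
    by (rule good_step[OF _ bs_WhileT.IH(1)[OF bs_WhileT.IH(2)[OF bs_WhileT.prems]]])
      (cases s, use bs_WhileT in simp)
  then show ?case by (simp add: add_ac)
qed (auto intro!: good_step)

primrec mods :: "com \<Rightarrow> nat set" where
  "mods (Const x n) = {x}"
| "mods (Add x y z) = {x}"
| "mods (Sub x y z) = {x}"
| "mods (Load x b y) = {x}"
| "mods (Store b x y) = {}"
| "mods (Rand x y) = {x}"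
| "mods (Seq c1 c2) = mods c1 \<union> mods c2"
| "mods (Cond x c1 c2) = mods c1 \<union> mods c2"
| "mods (While x c) = mods c"

primrec arrs :: "com \<Rightarrow> nat set" where
  "arrs (Const x n) = {}"
| "arrs (Add x y z) = {}"
| "arrs (Sub x y z) = {}"
| "arrs (Load x b y) = {}"
| "arrs (Store b x y) = {b}"
| "arrs (Rand x y) = {}"
| "arrs (Seq c1 c2) = arrs c1 \<union> arrs c2"
| "arrs (Cond x c1 c2) = arrs c1 \<union> arrs c2"
| "arrs (While x c) = arrs c"

lemma bs_frame:
  "bs c s t s' \<Longrightarrow> (\<forall>x. x \<notin> mods c \<longrightarrow> fst s' x = fst s x) \<and> (\<forall>b. b \<notin> arrs c \<longrightarrow> snd s' b = snd s b)"
  by (induction rule: bs.induct) auto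

definition same_outside :: "'a set \<Rightarrow> ('a \<Rightarrow> 'b) \<Rightarrow> ('a \<Rightarrow> 'b) \<Rightarrow> bool" where
  "same_outside X f g \<longleftrightarrow> (\<forall>x. x \<notin> X \<longrightarrow> f x = g x)"

lemma same_outsideD: "same_outside X f g \<Longrightarrow> x \<notin> X \<Longrightarrow> f x = g x"
  by (simp add: same_outside_def)

text \<open>Total correctness with a time bound from one concrete start state. The postcondition can
  mention \<open>r\<close> and \<open>a\<close> directly, so no ghost variables are required for
  initial values.\<close>

definition ok :: "com \<Rightarrow> regs \<Rightarrow> arrays \<Rightarrow> nat \<Rightarrow>
    (regs \<Rightarrow> arrays \<Rightarrow> bool) \<Rightarrow> bool" where
  "ok c r a \<tau> Q \<longleftrightarrow> (\<exists>t r' a'. t \<le> \<tau> \<and> bs c (r, a) t (r', a') \<and> Q r' a')"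

lemma ok_good:
  assumes "ok c r a \<tau> Q" "\<And>r' a'. Q r' a' \<Longrightarrow> good A T (cs, (r', a')) p"
  shows "good A (T + \<tau>) (c # cs, (r, a)) p"
proof -
  obtain t r' a' where t: "t \<le> \<tau>" "bs c (r, a) t (r', a')" "Q r' a'"
    using assms(1) by (auto simp: ok_def)
  have "good A (T + t) (c # cs, (r, a)) p" using bs_good[OF t(2) assms(2)[OF t(3)]] .
  then show ?thesis by (rule good_mono) (use t in auto)
qed

lemma ok_frame:
  assumes "ok c r a \<tau> Q"
  shows "ok c r a \<tau> (\<lambda>r' a'. Q r' a' \<and> same_outside (mods c) r' r \<and> same_outside (arrs c) a' a)"
  using assms bs_frame unfolding ok_def same_outside_def by fastforce

lemma ok_conseq:
  assumes "ok c r a \<tau> Q" "\<And>r' a'. Q r' a' \<Longrightarrow> Q' r' a'" "\<tau> \<le> \<tau>'"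
  shows "ok c r a \<tau>' Q'"
  using assms order_trans unfolding ok_def by meson

lemma ok_conseq_frame:
  assumes "ok c r a \<tau> Q" "\<tau> \<le> \<tau>'"
    "\<And>r' a'. Q r' a' \<Longrightarrow> same_outside (mods c) r' r \<Longrightarrow> same_outside (arrs c) a' a \<Longrightarrow> Q' r' a'"
  shows "ok c r a \<tau>' Q'"
  by (rule ok_conseq[OF ok_frame[OF assms(1)]]) (use assms in auto)

lemma ok_Seq:
  assumes "ok c1 r a \<rho> Q1" "\<And>r' a'. Q1 r' a' \<Longrightarrow> ok c2 r' a' \<sigma> Q" "1 + \<rho> + \<sigma> \<le> \<tau>"
  shows "ok (Seq c1 c2) r a \<tau> Q"
proof -
  obtain t1 r1 a1 where 1: "t1 \<le> \<rho>" "bs c1 (r, a) t1 (r1, a1)" "Q1 r1 a1"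
    using assms(1) by (auto simp: ok_def)
  obtain t2 r2 a2 where 2: "t2 \<le> \<sigma>" "bs c2 (r1, a1) t2 (r2, a2)" "Q r2 a2"
    using assms(2)[OF 1(3)] by (auto simp: ok_def)
  show ?thesis unfolding ok_def
    by (intro exI[of _ "1 + t1 + t2"] exI[of _ r2] exI[of _ a2])
      (use bs_Seq[OF 1(2) 2(2)] 1 2 assms(3) in auto)
qed

text \<open>Only for loop-free commands without random draws; elsewhere \<open>wp\<close> is false and \<open>tm\<close> is junk.\<close>

primrec wp :: "com \<Rightarrow> (regs \<Rightarrow> arrays \<Rightarrow> bool) \<Rightarrow>
    regs \<Rightarrow> arrays \<Rightarrow> bool" where
  "wp (Const x n) Q r a = Q (r(x := n)) a"
| "wp (Add x y z) Q r a = Q (r(x := r y + r z)) a"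
| "wp (Sub x y z) Q r a = Q (r(x := r y - r z)) a"
| "wp (Load x b y) Q r a = Q (r(x := a b (r y))) a"
| "wp (Store b x y) Q r a = Q r (a(b := (a b)(r x := r y)))"
| "wp (Rand x y) Q r a = False"
| "wp (Seq c1 c2) Q r a = wp c1 (wp c2 Q) r a"
| "wp (Cond x c1 c2) Q r a = (if r x \<noteq> 0 then wp c1 Q r a else wp c2 Q r a)"
| "wp (While x c) Q r a = False"

primrec tm :: "com \<Rightarrow> nat" where
  "tm (Const x n) = 1"
| "tm (Add x y z) = 1"
| "tm (Sub x y z) = 1"
| "tm (Load x b y) = 1"
| "tm (Store b x y) = 1"
| "tm (Rand x y) = 1"
| "tm (Seq c1 c2) = 1 + tm c1 + tm c2"
| "tm (Cond x c1 c2) = 1 + max (tm c1) (tm c2)"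
| "tm (While x c) = 0"

lemma ok_wp_tm: "wp c Q r a \<Longrightarrow> ok c r a (tm c) Q"
proof (induction c arbitrary: Q r a)
  case (Seq c1 c2)
  show ?case by (rule ok_Seq[OF Seq.IH(1) Seq.IH(2)]) (use Seq.prems in auto)
next
  case (Cond x c1 c2)
  show ?case
  proof (cases "r x = 0")
    case True
    then obtain t r' a' where "t \<le> tm c2" "bs c2 (r, a) t (r', a')" "Q r' a'"
      using Cond.IH(2)[of Q r a] Cond.prems by (auto simp: ok_def)
    then show ?thesis unfolding ok_def
      by (intro exI[of _ "1 + t"] exI[of _ r'] exI[of _ a']) (use True in \<open>auto intro: bs_CondF[simplified]\<close>)
  next
    case False
    then obtain t r' a' where "t \<le> tm c1" "bs c1 (r, a) t (r', a')" "Q r' a'"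
      using Cond.IH(1)[of Q r a] Cond.prems by (auto simp: ok_def)
    then show ?thesis unfolding ok_def
      by (intro exI[of _ "1 + t"] exI[of _ r'] exI[of _ a']) (use False in \<open>auto intro: bs_CondT[simplified]\<close>)
  qed
qed (auto simp: ok_def intro: bs.intros[simplified])

lemma ok_wp: "tm c \<le> \<tau> \<Longrightarrow> wp c Q r a \<Longrightarrow> ok c r a \<tau> Q"
  using ok_wp_tm ok_conseq by blast

lemma ok_wp_Seq:
  assumes "tm c1 = \<rho>" "wp c1 (\<lambda>r' a'. ok c2 r' a' \<sigma> Q) r a" "1 + \<rho> + \<sigma> \<le> \<tau>"
  shows "ok (Seq c1 c2) r a \<tau> Q"
  by (rule ok_Seq[OF ok_wp_tm[OF assms(2)]]) (use assms in auto)

lemma ok_Seq_wp: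
  assumes "wp c1 (\<lambda>r' a'. ok c2 r' a' (\<tau> - 1 - tm c1) Q) r a" "1 + tm c1 \<le> \<tau>"
  shows "ok (c1 ;; c2) r a \<tau> Q"
  by (rule ok_wp_Seq[OF refl assms(1)]) (use assms(2) in simp)

text \<open>Registers 28 to 31 are scratch: 29 holds the condition of the loop being entered or
  continued, so a loop body may overwrite it.\<close>

definition IfEq :: "nat \<Rightarrow> nat \<Rightarrow> com \<Rightarrow> com \<Rightarrow> com" where
  "IfEq x y c1 c2 = Sub 30 x y ;; Sub 31 y x ;; Add 30 30 31 ;; Cond 30 c2 c1"

definition IfLe :: "nat \<Rightarrow> nat \<Rightarrow> com \<Rightarrow> com \<Rightarrow> com" where
  "IfLe x y c1 c2 = Sub 30 x y ;; Cond 30 c2 c1"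

definition Skip :: com where
  "Skip = Const 30 0"

definition Inc :: "nat \<Rightarrow> com" where
  "Inc x = Const 28 1 ;; Add x x 28"

text \<open>Subtraction is truncated, so the sum of the two differences is \<open>0\<close> exactly
  for equal registers.\<close>

lemma wp_IfEq [simp]:
  assumes "x \<noteq> 30" "y \<noteq> 30"
  shows "wp (IfEq x y c1 c2) Q r a =
    (if r x = r y then wp c1 Q (r(30 := 0, 31 := 0)) a
     else wp c2 Q (r(31 := r y - r x, 30 := (r x - r y) + (r y - r x))) a)"
  using assms by (auto simp: IfEq_def fun_upd_twist)

lemma wp_IfLe [simp]:
  "wp (IfLe x y c1 c2) Q r a =
    (if r x \<le> r y then wp c1 Q (r(30 := 0)) a else wp c2 Q (r(30 := r x - r y)) a)"
  by (auto simp: IfLe_def)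

lemma wp_Skip [simp]: "wp Skip Q r a = Q (r(30 := 0)) a"
  by (simp add: Skip_def)

lemma wp_Inc [simp]: "x \<noteq> 28 \<Longrightarrow> wp (Inc x) Q r a = Q (r(28 := 1, x := Suc (r x))) a"
  by (simp add: Inc_def)

lemma tm_macros [simp]:
  "tm (IfEq x y c1 c2) = 7 + max (tm c1) (tm c2)" "tm (IfLe x y c1 c2) = 3 + max (tm c1) (tm c2)"
  "tm Skip = 1" "tm (Inc x) = 3"
  by (auto simp: IfEq_def IfLe_def Skip_def Inc_def)

lemma mods_macros [simp]:
  "mods (IfEq x y c1 c2) = {30, 31} \<union> mods c1 \<union> mods c2"
  "mods (IfLe x y c1 c2) = {30} \<union> mods c1 \<union> mods c2"
  "mods Skip = {30}" "mods (Inc x) = {28, x}"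
  "arrs (IfEq x y c1 c2) = arrs c1 \<union> arrs c2"
  "arrs (IfLe x y c1 c2) = arrs c1 \<union> arrs c2"
  "arrs Skip = {}" "arrs (Inc x) = {}"
  by (auto simp: IfEq_def IfLe_def Skip_def Inc_def)

section \<open>Counting loops\<close>

definition For_loop :: "nat \<Rightarrow> nat \<Rightarrow> com \<Rightarrow> com" where
  "For_loop i n body = While 29 (body ;; Const 29 1 ;; Add i i 29 ;; Sub 29 n i)"

definition For :: "nat \<Rightarrow> nat \<Rightarrow> com \<Rightarrow> com" where
  "For i n body = Const i 0 ;; Sub 29 n i ;; For_loop i n body"

lemma mods_For [simp]: "mods (For i n body) = {i, 29} \<union> mods body" "arrs (For i n body) = arrs body"
  by (auto simp: For_def For_loop_def)

text \<open>Besides the invariant, the body may assume that everything the loop does not write still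
  has its initial content, so invariants mention only what changes. The 7 extra steps per pass are
  the test, one sequencing and the counter update.\<close>

lemma ok_For_loop:
  assumes n: "i \<noteq> n" "i \<noteq> 29" "n \<noteq> 29" "i \<notin> mods body" "n \<notin> mods body"
    and I_upd: "\<And>j r a v w. I j r a \<Longrightarrow> I j (r(i := v, 29 := w)) a"
    and body: "\<And>j r a. j < N \<Longrightarrow> r i = j \<Longrightarrow> r n = N \<Longrightarrow>
        same_outside ({i, 29} \<union> mods body) r r0 \<Longrightarrow> same_outside (arrs body) a a0 \<Longrightarrow>
        I j r a \<Longrightarrow> ok body r a \<tau> (I (Suc j))"
    and "j \<le> N" "r i = j" "r n = N" "r 29 = N - j"
    "same_outside ({i, 29} \<union> mods body) r r0" "same_outside (arrs body) a a0" "I j r a"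
  shows "ok (For_loop i n body) r a (1 + (N - j) * (\<tau> + 7)) (I N)"
  using assms(8-)
proof (induction "N - j" arbitrary: j r a)
  case 0
  then have "j = N" "bs (For_loop i n body) (r, a) 1 (r, a)"
    by (auto simp: For_loop_def intro: bs_WhileF[simplified])
  then show ?case using 0 unfolding ok_def by auto
next
  case (Suc l)
  then have j: "j < N" by simp
  obtain t r1 a1 where 1: "t \<le> \<tau>" "bs body (r, a) t (r1, a1)" "I (Suc j) r1 a1"
    "same_outside (mods body) r1 r" "same_outside (arrs body) a1 a"
    using ok_frame[OF body[OF j Suc(4,5,7,8,9)]] unfolding ok_def by blast
  define r2 where "r2 = r1(i := Suc j, 29 := N - Suc j)"
  have r1: "r1 i = j" "r1 n = N" using 1(4) n Suc by (auto simp: same_outside_def)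
  let ?rest = "Const 29 1 ;; Add i i 29 ;; Sub 29 n i"
  have "wp ?rest (\<lambda>r a. r = r2 \<and> a = a1) r1 a1"
    using n r1 by (auto simp: r2_def fun_eq_iff)
  then obtain t' where "t' \<le> tm ?rest" "bs ?rest (r1, a1) t' (r2, a1)"
    using ok_wp_tm unfolding ok_def by blast
  then have t': "t' \<le> 5" "bs ?rest (r1, a1) t' (r2, a1)" by auto
  have "ok (For_loop i n body) r2 a1 (1 + (N - Suc j) * (\<tau> + 7)) (I N)"
  proof (rule Suc.hyps(1))
    show "l = N - Suc j" "Suc j \<le> N" using Suc by auto
    show "r2 i = Suc j" "r2 n = N" "r2 29 = N - Suc j" using n r1 by (auto simp: r2_def)
    show "same_outside ({i, 29} \<union> mods body) r2 r0"
      using 1(4) Suc.prems(5) by (auto simp: same_outside_def r2_def)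
    show "same_outside (arrs body) a1 a0"
      using 1(5) Suc.prems(6) by (auto simp: same_outside_def)
    show "I (Suc j) r2 a1" unfolding r2_def by (rule I_upd[OF 1(3)])
  qed
  then obtain t2 r3 a3 where 2: "t2 \<le> 1 + (N - Suc j) * (\<tau> + 7)"
    "bs (For_loop i n body) (r2, a1) t2 (r3, a3)" "I N r3 a3"
    unfolding ok_def by blast
  have "bs (For_loop i n body) (r, a) (1 + (1 + t + t') + t2) (r3, a3)"
    unfolding For_loop_def
    by (rule bs_WhileT[OF _ bs_Seq[OF 1(2) t'(2)] 2(2)[unfolded For_loop_def]])
      (use Suc in auto)
  moreover have "1 + (1 + t + t') + t2 \<le> 1 + (N - j) * (\<tau> + 7)"
  proof -
    have "(N - j) * (\<tau> + 7) = (N - Suc j) * (\<tau> + 7) + (\<tau> + 7)"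
      using j by (metis Suc_diff_Suc mult_Suc add.commute)
    then show ?thesis using 2(1) 1(1) t'(1) by linarith
  qed
  ultimately show ?case using 2(3) unfolding ok_def by blast
qed

text \<open>The 5 steps outside the passes are two assignments, two sequencings and the final
  test.\<close>

lemma ok_For:
  assumes "i \<noteq> n" "i \<noteq> 29" "n \<noteq> 29" "i \<notin> mods body" "n \<notin> mods body"
    and I_upd: "\<And>j r a v w. I j r a \<Longrightarrow> I j (r(i := v, 29 := w)) a"
    and body: "\<And>j r a. j < r0 n \<Longrightarrow> r i = j \<Longrightarrow> r n = r0 n \<Longrightarrow>
        same_outside ({i, 29} \<union> mods body) r r0 \<Longrightarrow> same_outside (arrs body) a a0 \<Longrightarrow>
        I j r a \<Longrightarrow> ok body r a \<tau> (I (Suc j))"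
    and I0: "I 0 r0 a0"
    and \<tau>': "r0 n * (\<tau> + 7) + 5 \<le> \<tau>'"
  shows "ok (For i n body) r0 a0 \<tau>' (I (r0 n))"
proof -
  have 1: "ok (For_loop i n body) (r0(i := 0, 29 := r0 n)) a0 (1 + (r0 n - 0) * (\<tau> + 7)) (I (r0 n))"
    by (rule ok_For_loop[where I = I and N = "r0 n" and ?r0.0 = r0 and ?a0.0 = a0,
            OF assms(1-5) I_upd body])
      (use assms I_upd[OF I0] in \<open>auto simp: same_outside_def\<close>)
  show ?thesis unfolding For_def
    apply (rule ok_wp_Seq[where \<sigma> = "r0 n * (\<tau> + 7) + 3"])
      apply simp
     apply simp
     apply (rule ok_wp_Seq[where \<sigma> = "r0 n * (\<tau> + 7) + 1"])
       apply simp
    using 1 assms \<tau>' by auto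
qed

section \<open>Filling an array with random numbers\<close>

definition fill :: "nat \<Rightarrow> nat \<Rightarrow> nat \<Rightarrow> com" where
  "fill arr n b = For 20 n (Rand 21 b ;; Store arr 20 21)"

lemma good_steps:
  assumes "bs c (r, a) t (r', a')" "good A T (cs, (r', a')) p" "T + t \<le> T'"
  shows "good A T' (c # cs, (r, a)) p"
  using good_mono[OF bs_good[OF assms(1,2)]] assms(3) by simp

text \<open>Independence of the draws in the form of an affine bound: \<open>p0\<close> is what
  remains after a miss, and every target multiplies the surplus \<open>p1 - p0\<close> by the
  probability of hitting it. In this form fills can be chained, the bound obtained for a later one
  serving as \<open>p1\<close> of an earlier one. A pass takes 10 steps: the test, two sequencings,
  draw, store and 5 for the counter.\<close>

lemma fill_loop_good:
  fixes r :: regs and p0 p1 :: real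
  assumes "n < 20" "b < 20"
    and "j \<le> N" "r 20 = j" "r n = N" "r 29 = N - j" "p0 \<le> p1"
    and "\<And>l. X l \<subseteq> {..r b}"
    and "\<And>r' f. same_outside {20, 21, 29} r' r \<Longrightarrow> \<forall>l\<in>{j..<N}. f l \<le> r b \<Longrightarrow>
        same_outside {j..<N} f (a arr) \<Longrightarrow>
        good A T (cs, (r', a(arr := f))) (if \<forall>l\<in>{j..<N}. f l \<in> X l then p1 else p0)"
  shows "good A (T + 1 + (N - j) * 10) (For_loop 20 n (Rand 21 b ;; Store arr 20 21) # cs, (r, a))
    (p0 + (p1 - p0) * (\<Prod>l\<in>{j..<N}. real (card (X l)) / (real (r b) + 1)))"
  using assms(3-)
proof (induction "N - j" arbitrary: j r a p1)
  case 0
  then have "j = N" "r 29 = 0" by auto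
  have "good A T (cs, (r, a(arr := a arr))) p1"
    using 0(8)[of r "a arr"] \<open>j = N\<close> by (auto simp: same_outside_def)
  then have "good A T (cs, (r, a)) p1" by simp
  then have "good A (Suc T) (For_loop 20 n (Rand 21 b ;; Store arr 20 21) # cs, (r, a)) p1"
    by (rule good_step[rotated]) (simp add: For_loop_def \<open>r 29 = 0\<close>)
  then show ?case using \<open>j = N\<close> by simp
next
  case (Suc l)
  let ?loop = "For_loop 20 n (Rand 21 b ;; Store arr 20 21)"
  let ?\<pi> = "\<lambda>j. \<Prod>l\<in>{j..<N}. real (card (X l)) / (real (r b) + 1)"
  have j: "j < N" and r29: "r 29 > 0" using Suc by auto
  have "good A (T + 1 + (N - Suc j) * 10 + 6)
      (Store arr 20 21 # (Const 29 1 ;; Add 20 20 29 ;; Sub 29 n 20) # ?loop # cs, (r(21 := v), a))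
      (p0 + (if v \<in> X j then p1 - p0 else 0) * ?\<pi> (Suc j))" if v: "v \<le> r b" for v
  proof -
    define r' where "r' = r(21 := v, 20 := Suc j, 29 := N - Suc j)"
    define a' where "a' = a(arr := (a arr)(j := v))"
    \<comment> \<open>A miss at cell \<open>j\<close> lowers the prize to \<open>p0\<close>; the
      surplus then vanishes and the induction hypothesis covers hit and miss alike. This is why the
      induction generalizes over \<open>p1\<close>.\<close>
    define q where "q = (if v \<in> X j then p1 else p0)"
    have "good A (T + 1 + (N - Suc j) * 10) (?loop # cs, (r', a'))
        (p0 + (q - p0) * (\<Prod>l\<in>{Suc j..<N}. real (card (X l)) / (real (r' b) + 1)))"
    proof (rule Suc.hyps(1))
      show "l = N - Suc j" "Suc j \<le> N" "r' 20 = Suc j" "r' n = N" "r' 29 = N - Suc j"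
        using Suc assms(1) by (auto simp: r'_def)
      show "p0 \<le> q" using Suc by (auto simp: q_def)
      show "X l \<subseteq> {..r' b}" for l using Suc assms(2) by (auto simp: r'_def)
    next
      fix r'' f
      assume f: "same_outside {20, 21, 29} r'' r'" "\<forall>l\<in>{Suc j..<N}. f l \<le> r' b"
        "same_outside {Suc j..<N} f (a' arr)"
      have fj: "f j = v" using f(3) by (auto simp: same_outside_def a'_def)
      have "good A T (cs, (r'', a(arr := f))) (if \<forall>l\<in>{j..<N}. f l \<in> X l then p1 else p0)"
      proof (rule Suc.prems(7))
        show "same_outside {20, 21, 29} r'' r" using f(1) by (auto simp: same_outside_def r'_def)
        show "\<forall>l\<in>{j..<N}. f l \<le> r b"
        proof
          fix l assume "l \<in> {j..<N}"
          then show "f l \<le> r b" using f(2) fj v assms(2) by (cases "l = j") (auto simp: r'_def)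
        qed
        show "same_outside {j..<N} f (a arr)" using f(3) j
          by (auto simp: same_outside_def a'_def)
      qed
      moreover have "{j..<N} = insert j {Suc j..<N}" using j by auto
      ultimately have "good A T (cs, (r'', a(arr := f))) (if \<forall>l\<in>{Suc j..<N}. f l \<in> X l then q else p0)"
        using fj by (auto simp: q_def split: if_splits)
      then show "good A T (cs, (r'', a'(arr := f))) (if \<forall>l\<in>{Suc j..<N}. f l \<in> X l then q else p0)"
        by (simp add: a'_def)
    qed
    moreover have "r' b = r b" using assms(2) by (auto simp: r'_def)
    moreover have "p0 + (q - p0) * ?\<pi> (Suc j) = p0 + (if v \<in> X j then p1 - p0 else 0) * ?\<pi> (Suc j)"
      by (simp add: q_def)
    ultimately have loop: "good A (T + 1 + (N - Suc j) * 10) (?loop # cs, (r', a'))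
      (p0 + (if v \<in> X j then p1 - p0 else 0) * ?\<pi> (Suc j))" by simp
    have "wp (Const 29 1 ;; Add 20 20 29 ;; Sub 29 n 20) (\<lambda>r a. r = r' \<and> a = a') (r(21 := v)) a'"
      using Suc.prems(2,3) assms(1) by (auto simp: r'_def fun_eq_iff)
    from ok_wp_tm[OF this] obtain t where "t \<le> tm (Const 29 1 ;; Add 20 20 29 ;; Sub 29 n 20)"
      "bs (Const 29 1 ;; Add 20 20 29 ;; Sub 29 n 20) (r(21 := v), a') t (r', a')"
      unfolding ok_def by blast
    then have t: "t \<le> 5"
      "bs (Const 29 1 ;; Add 20 20 29 ;; Sub 29 n 20) (r(21 := v), a') t (r', a')"
      by auto
    have "good A (T + 1 + (N - Suc j) * 10 + 5)
      ((Const 29 1 ;; Add 20 20 29 ;; Sub 29 n 20) # ?loop # cs, (r(21 := v), a'))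
      (p0 + (if v \<in> X j then p1 - p0 else 0) * ?\<pi> (Suc j))"
      by (rule good_steps[OF t(2) loop]) (use t in simp)
    then have "good A (Suc (T + 1 + (N - Suc j) * 10 + 5))
      (Store arr 20 21 # (Const 29 1 ;; Add 20 20 29 ;; Sub 29 n 20) # ?loop # cs, (r(21 := v), a))
      (p0 + (if v \<in> X j then p1 - p0 else 0) * ?\<pi> (Suc j))"
      by (rule good_step[rotated]) (use Suc.prems(2) in \<open>simp add: a'_def\<close>)
    then show ?thesis by (rule good_mono) auto
  qed
  from good_Rand[of r b, OF this]
  have "good A (Suc (T + 1 + (N - Suc j) * 10 + 6))
     (Rand 21 b # Store arr 20 21 # (Const 29 1 ;; Add 20 20 29 ;; Sub 29 n 20) # ?loop # cs, (r, a))
     ((\<Sum>v\<le>r b. p0 + (if v \<in> X j then p1 - p0 else 0) * ?\<pi> (Suc j)) / (real (r b) + 1))"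
    (is "good A ?T _ ?p") by simp
  then have "good A (Suc ?T)
     ((Rand 21 b ;; Store arr 20 21) # (Const 29 1 ;; Add 20 20 29 ;; Sub 29 n 20) # ?loop # cs, (r, a)) ?p"
    by (rule good_step[rotated]) simp
  then have "good A (Suc (Suc ?T))
     (((Rand 21 b ;; Store arr 20 21) ;; Const 29 1 ;; Add 20 20 29 ;; Sub 29 n 20) # ?loop # cs, (r, a)) ?p"
    by (rule good_step[rotated]) simp
  then have "good A (Suc (Suc (Suc ?T))) (?loop # cs, (r, a)) ?p"
    by (rule good_step[rotated]) (use r29 in \<open>simp add: For_loop_def\<close>)
  then show ?case
  proof (rule good_mono)
    have "(N - j) * 10 = (N - Suc j) * 10 + 10" using j by simp
    then show "Suc (Suc (Suc ?T)) \<le> T + 1 + (N - j) * 10" by simp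
    have "(\<Sum>v\<le>r b. p0 + (if v \<in> X j then p1 - p0 else 0) * ?\<pi> (Suc j))
        = (real (r b) + 1) * p0 + (\<Sum>v\<le>r b. if v \<in> X j then (p1 - p0) * ?\<pi> (Suc j) else 0)"
      by (simp add: sum.distrib if_distrib[of "\<lambda>x. x * _"] cong: if_cong)
    also have "(\<Sum>v\<le>r b. if v \<in> X j then (p1 - p0) * ?\<pi> (Suc j) else 0)
        = real (card (X j)) * ((p1 - p0) * ?\<pi> (Suc j))"
      using Suc.prems(6)[of j] by (simp add: sum.If_cases Int_absorb1)
    finally have "?p = p0 + real (card (X j)) / (real (r b) + 1) * ((p1 - p0) * ?\<pi> (Suc j))"
      by (simp add: field_simps)
    also have "\<dots> = p0 + (p1 - p0) * ?\<pi> j"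
      using j by (simp add: prod.atLeast_Suc_lessThan)
    finally show "p0 + (p1 - p0) * ?\<pi> j \<le> ?p" by simp
  qed
qed

lemma fill_good:
  fixes p0 p1 :: real
  assumes "n < 20" "b < 20" "p0 \<le> p1" "\<And>l. X l \<subseteq> {..r b}"
    and cont: "\<And>r' f. same_outside {20, 21, 29} r' r \<Longrightarrow> \<forall>l<r n. f l \<le> r b \<Longrightarrow>
        same_outside {..<r n} f (a arr) \<Longrightarrow>
        good A T (cs, (r', a(arr := f))) (if \<forall>l<r n. f l \<in> X l then p1 else p0)"
    and "T + r n * 10 + 5 \<le> T'"
  shows "good A T' (fill arr n b # cs, (r, a))
    (p0 + (p1 - p0) * (\<Prod>l<r n. real (card (X l)) / (real (r b) + 1)))" (is "good _ _ _ ?p")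
proof -
  let ?r = "r(20 := 0, 29 := r n)"
  let ?loop = "For_loop 20 n (Rand 21 b ;; Store arr 20 21)"
  have "good A (T + 1 + (r n - 0) * 10) (?loop # cs, (?r, a))
    (p0 + (p1 - p0) * (\<Prod>l\<in>{0..<r n}. real (card (X l)) / (real (?r b) + 1)))"
  proof (rule fill_loop_good)
    fix r' f
    assume "same_outside {20, 21, 29} r' ?r" "\<forall>l\<in>{0..<r n}. f l \<le> ?r b"
      "same_outside {0..<r n} f (a arr)"
    then show "good A T (cs, (r', a(arr := f))) (if \<forall>l\<in>{0..<r n}. f l \<in> X l then p1 else p0)"
      using cont[of r' f] assms(2) by (auto simp: same_outside_def atLeast0LessThan Ball_def)
  qed (use assms in auto)
  then have 1: "good A (T + 1 + r n * 10) (?loop # cs, (?r, a)) ?p"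
    using assms(2) by (simp add: atLeast0LessThan)
  have "good A (Suc (T + 1 + r n * 10)) (Sub 29 n 20 # ?loop # cs, (r(20 := 0), a)) ?p"
    by (rule good_step[OF _ 1]) (use assms(1) in simp)
  then have "good A (Suc (Suc (T + 1 + r n * 10))) ((Sub 29 n 20 ;; ?loop) # cs, (r(20 := 0), a)) ?p"
    by (rule good_step[rotated]) simp
  then have "good A (Suc (Suc (Suc (T + 1 + r n * 10))))
      (Const 20 0 # (Sub 29 n 20 ;; ?loop) # cs, (r, a)) ?p"
    by (rule good_step[rotated]) simp
  then have "good A (Suc (Suc (Suc (Suc (T + 1 + r n * 10))))) (fill arr n b # cs, (r, a)) ?p"
    by (rule good_step[rotated]) (simp add: fill_def For_def)
  then show ?thesis by (rule good_mono) (use assms(6) in auto)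
qed

section \<open>Witnesses and the index graph of an encoded instance\<close>

text \<open>Vertices are added one at a time with the least color \<open>c\<close> missing among
  their colored neighbours. Always \<open>c <= k + 1\<close>, and if \<open>c = k + 1\<close> the
  new vertex sees all older colors and is itself the dominator of its new class.\<close>

lemma partial_grundy_extend:
  assumes "finite V" "D \<subseteq> V" "partial_grundy_coloring D E k g" "\<forall>e\<in>E. card e = 2"
  shows "\<exists>k'\<ge>k. \<exists>g'. partial_grundy_coloring V E k' g'"
  using assms(2,3)
proof (induction "card (V - D)" arbitrary: D k g)
  case 0
  then have "D = V" using assms(1) by auto
  then show ?case using 0 by auto
next
  case (Suc l)
  then obtain x where x: "x \<in> V" "x \<notin> D"
    by (metis Diff_eq_empty_iff card.empty nat.distinct(1) subsetI)
  have l: "l = card (V - insert x D)"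
  proof -
    have "V - insert x D = (V - D) - {x}" by auto
    then show ?thesis using Suc.hyps(2) x by simp
  qed
  have loop: "{v, v} \<notin> E" for v using assms(4) by force
  have fin: "finite D" using Suc.prems(1) assms(1) finite_subset by blast
  have pg: "\<And>v. v \<in> D \<Longrightarrow> 1 \<le> g v \<and> g v \<le> k"
    "\<And>u v. u \<in> D \<Longrightarrow> v \<in> D \<Longrightarrow> {u, v} \<in> E \<Longrightarrow> g u \<noteq> g v"
    "\<And>i. 1 \<le> i \<Longrightarrow> i \<le> k \<Longrightarrow> \<exists>v\<in>D. g v = i \<and> (\<forall>j\<in>{1..<i}. \<exists>u\<in>D. {u, v} \<in> E \<and> g u = j)"
    using Suc.prems(2) unfolding partial_grundy_coloring_def by auto
  define N where "N = g ` {u \<in> D. {u, x} \<in> E}"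
  have NK: "N \<subseteq> {1..k}" using pg(1) by (auto simp: N_def)
  define c where "c = (LEAST c. c \<ge> 1 \<and> c \<notin> N)"
  have ex: "Suc k \<ge> 1 \<and> Suc k \<notin> N" using NK by auto
  have c: "c \<ge> 1" "c \<notin> N" using LeastI[of "\<lambda>c. c \<ge> 1 \<and> c \<notin> N", OF ex] by (auto simp: c_def)
  have cK: "c \<le> Suc k" unfolding c_def by (rule Least_le) (rule ex)
  have below: "j \<in> N" if j: "j \<in> {1..<c}" for j
    using not_less_Least[of j "\<lambda>c. c \<ge> 1 \<and> c \<notin> N"] that by (auto simp: c_def)
  let ?g = "g(x := c)"
  have "partial_grundy_coloring (insert x D) E (max k c) ?g"
    unfolding partial_grundy_coloring_def
  proof (intro conjI ballI impI)
    fix v assume "v \<in> insert x D"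
    then show "?g v \<in> {1..max k c}"
      using pg(1) c(1) by (cases "v = x") (auto simp: le_max_iff_disj)
  next
    fix u v assume uv: "u \<in> insert x D" "v \<in> insert x D" "{u, v} \<in> E"
    show "?g u \<noteq> ?g v"
    proof (cases "u = x \<or> v = x")
      case True
      then show ?thesis using uv loop c(2) x by (auto simp: N_def insert_commute)
    next
      case False
      then show ?thesis using uv pg(2) by auto
    qed
  next
    fix i assume i: "i \<in> {1..max k c}"
    show "\<exists>v\<in>insert x D. ?g v = i \<and> (\<forall>j\<in>{1..<i}. \<exists>u\<in>insert x D. {u, v} \<in> E \<and> ?g u = j)"
    proof (cases "i \<le> k")
      case True
      then obtain v where "v \<in> D" "g v = i" "\<forall>j\<in>{1..<i}. \<exists>u\<in>D. {u, v} \<in> E \<and> g u = j"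
        using i pg(3)[of i] by auto
      moreover have "?g u = g u" if "u \<in> D" for u using that x by auto
      ultimately show ?thesis by (intro bexI[of _ v]) (metis insertCI)+
    next
      case False
      then have "i = c" using i cK by auto
      have "\<exists>u\<in>insert x D. {u, x} \<in> E \<and> ?g u = j" if j: "j \<in> {1..<c}" for j
      proof -
        obtain u where "u \<in> D" "{u, x} \<in> E" "g u = j" using below[OF j] by (auto simp: N_def)
        then show ?thesis using x by (intro bexI[of _ u]) auto
      qed
      then show ?thesis using \<open>i = c\<close> by (intro bexI[of _ x]) auto
    qed
  qed
  from Suc.hyps(1)[OF l _ this] x Suc.prems(1)
  obtain k' g' where "k' \<ge> max k c" "partial_grundy_coloring V E k' g'" by auto
  then show ?case by auto
qed

section \<open>An encoded instance in terms of positions\<close>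

locale spgc_input =
  fixes k d :: nat and V :: "nat set" and E :: "nat set set" and As :: "(nat set \<times> nat set) list"
    and vs :: "nat list" and es :: "(nat \<times> nat) list" and bcs :: "(nat list \<times> nat list) list"
    and xs :: "nat list"
  assumes inst: "spgc_instance k d V E As"
    and vs: "distinct vs" "set vs = V"
    and es: "\<forall>(i, j)\<in>set es. i < length vs \<and> j < length vs"
      "distinct (map (\<lambda>(i, j). {vs ! i, vs ! j}) es)"
      "set (map (\<lambda>(i, j). {vs ! i, vs ! j}) es) = E"
    and bcs: "\<forall>(ls, rs)\<in>set bcs. distinct ls \<and> distinct rs \<and>
           set ls \<subseteq> {..<length vs} \<and> set rs \<subseteq> {..<length vs}"
      "map (\<lambda>(ls, rs). ((!) vs ` set ls, (!) vs ` set rs)) bcs = As"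
    and xs: "xs = [k, d, length As, card V, card E]
             @ concat (map (\<lambda>(i, j). [i, j]) es)
             @ concat (map (\<lambda>(ls, rs). length ls # ls @ length rs # rs) bcs)"
begin

abbreviation n :: nat where "n \<equiv> length vs"
abbreviation m :: nat where "m \<equiv> length es"
abbreviation l :: nat where "l \<equiv> length bcs"

definition inp :: "nat \<Rightarrow> nat" where "inp i = (if i < length xs then xs ! i else 0)"
definition eu :: "nat \<Rightarrow> nat" where "eu e = fst (es ! e)"
definition ev :: "nat \<Rightarrow> nat" where "ev e = snd (es ! e)"
definition ls :: "nat \<Rightarrow> nat list" where "ls t = fst (bcs ! t)"
definition rs :: "nat \<Rightarrow> nat list" where "rs t = snd (bcs ! t)"
text \<open>Input position at which biclique \<open>t\<close> starts. It depends on the sizes of all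
  earlier bicliques, so the program reaches it by scanning them in order.\<close>

definition offs :: "nat \<Rightarrow> nat" where
  "offs t = 5 + 2 * m + length (concat (map (\<lambda>(ls, rs). length ls # ls @ length rs # rs) (take t bcs)))"
definition adj :: "nat \<Rightarrow> nat \<Rightarrow> bool" where
  "adj i j \<longleftrightarrow> i < n \<and> j < n \<and> {vs ! i, vs ! j} \<in> E"

lemma k_ge1: "k \<ge> 1" and d_ge1: "d \<ge> 1" and l_ge1: "l \<ge> 1"
  using inst bcs(2) by (auto simp: spgc_instance_def)

lemma card_V: "card V = n" using vs distinct_card by blast

lemma card_E: "card E = m" using es(2,3) distinct_card by fastforce

lemma length_As: "length As = l" using bcs(2) by auto

lemma card2: "e \<in> E \<Longrightarrow> card e = 2"
  using inst by (auto simp: spgc_instance_def simple_graph_def)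

lemma eu_ev_less: "e < m \<Longrightarrow> eu e < n" "e < m \<Longrightarrow> ev e < n"
  using es(1) nth_mem[of e es] by (auto simp: eu_def ev_def case_prod_beta)

lemma edge_in: "e < m \<Longrightarrow> {vs ! eu e, vs ! ev e} \<in> E"
  using es(3) nth_mem[of e es] by (force simp: eu_def ev_def split: prod.splits)

lemma eu_neq_ev: "e < m \<Longrightarrow> eu e \<noteq> ev e"
  using edge_in card2 by fastforce

lemma nth_vs_eq: "i < n \<Longrightarrow> j < n \<Longrightarrow> vs ! i = vs ! j \<longleftrightarrow> i = j"
  using vs(1) by (simp add: nth_eq_iff_index_eq)

lemma adj_iff: "adj i j \<longleftrightarrow> (\<exists>e<m. (eu e = i \<and> ev e = j) \<or> (eu e = j \<and> ev e = i))"
proof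
  assume a: "adj i j"
  then have "{vs ! i, vs ! j} \<in> set (map (\<lambda>(i, j). {vs ! i, vs ! j}) es)"
    unfolding es(3) by (simp add: adj_def)
  then obtain p where p: "p \<in> set es" "{vs ! i, vs ! j} = {vs ! fst p, vs ! snd p}"
    by (auto simp: case_prod_beta)
  then obtain e where e: "e < m" "es ! e = p" by (auto simp: in_set_conv_nth)
  have "{vs ! i, vs ! j} = {vs ! eu e, vs ! ev e}" using p e by (simp add: eu_def ev_def)
  then have "(i = eu e \<and> j = ev e) \<or> (i = ev e \<and> j = eu e)"
    using a eu_ev_less[OF e(1)] by (auto simp: doubleton_eq_iff nth_vs_eq adj_def)
  then show "\<exists>e<m. (eu e = i \<and> ev e = j) \<or> (eu e = j \<and> ev e = i)" using e by blast
next
  assume "\<exists>e<m. (eu e = i \<and> ev e = j) \<or> (eu e = j \<and> ev e = i)"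
  then show "adj i j" using eu_ev_less edge_in by (auto simp: adj_def insert_commute)
qed

lemma adj_edge: "e < m \<Longrightarrow> adj (eu e) (ev e)" "e < m \<Longrightarrow> adj (ev e) (eu e)"
  by (auto simp: adj_iff)

lemma edge_inj:
  assumes "e < m" "e' < m" "{vs ! eu e, vs ! ev e} = {vs ! eu e', vs ! ev e'}"
  shows "e = e'"
  using assms nth_eq_iff_index_eq[OF es(2), of e e']
  by (auto simp: eu_def ev_def split: prod.splits)

lemma inp_header [simp]: "inp 0 = k" "inp (Suc 0) = d" "inp 2 = l" "inp 3 = n" "inp 4 = m"
  unfolding inp_def by (auto simp: xs card_V card_E length_As nth_append nth_Cons')

lemma length_concat_pairs: "length (concat (map (\<lambda>(i, j). [i, j]) ps)) = 2 * length ps"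
  by (induction ps) auto

lemma nth_concat_pairs:
  "i < length ps \<Longrightarrow> concat (map (\<lambda>(i, j). [i, j]) ps) ! (2 * i) = fst (ps ! i) \<and>
    concat (map (\<lambda>(i, j). [i, j]) ps) ! Suc (2 * i) = snd (ps ! i)"
proof (induction ps arbitrary: i)
  case (Cons p ps)
  then show ?case by (cases i; cases p) auto
qed simp

lemma inp_edge [simp]:
  assumes "e < m"
  shows "inp (5 + 2 * e) = eu e" "inp (6 + 2 * e) = ev e"
proof -
  let ?C = "concat (map (\<lambda>(i, j). [i, j]) es)"
  have "xs ! (5 + i) = ?C ! i \<and> 5 + i < length xs" if "i < 2 * m" for i
    using that length_concat_pairs[of es] by (auto simp: xs nth_append)
  from this[of "2 * e"] this[of "Suc (2 * e)"]
  show "inp (5 + 2 * e) = eu e" "inp (6 + 2 * e) = ev e"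
    using assms nth_concat_pairs[OF assms] by (auto simp: inp_def eu_def ev_def)
qed

lemma inp_biclique:
  assumes "t < l"
  shows "inp (offs t) = length (ls t)"
    "\<And>i. i < length (ls t) \<Longrightarrow> inp (offs t + 1 + i) = ls t ! i"
    "inp (offs t + 1 + length (ls t)) = length (rs t)"
    "\<And>i. i < length (rs t) \<Longrightarrow> inp (offs t + 1 + length (ls t) + 1 + i) = rs t ! i"
    "offs (Suc t) = offs t + 1 + length (ls t) + 1 + length (rs t)"
proof -
  let ?g = "\<lambda>(ls, rs). length ls # ls @ length rs # rs"
  have t: "?g (bcs ! t) = length (ls t) # ls t @ length (rs t) # rs t"
    by (simp add: ls_def rs_def split: prod.splits)
  have "concat (map ?g bcs) = concat (map ?g (take t bcs)) @ ?g (bcs ! t) @ concat (map ?g (drop (Suc t) bcs))"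
    using id_take_nth_drop[OF assms]
    by (metis (no_types, lifting) concat.simps(2) concat_append list.simps(9) map_append)
  then obtain A B where A: "length A = offs t"
    "xs = A @ (length (ls t) # ls t @ length (rs t) # rs t) @ B"
    using length_concat_pairs[of es] unfolding t
    by (intro that[of "[k, d, length As, card V, card E] @ concat (map (\<lambda>(i, j). [i, j]) es) @
       concat (map ?g (take t bcs))" "concat (map ?g (drop (Suc t) bcs))"]) (auto simp: xs offs_def)
  have "inp (offs t + i) = (length (ls t) # ls t @ length (rs t) # rs t) ! i"
    if "i < 2 + length (ls t) + length (rs t)" for i
    using that A(1) unfolding inp_def by (auto simp: A(2) nth_append nth_Cons')
  note * = this
  show "inp (offs t) = length (ls t)" using *[of 0] by simp
  show "inp (offs t + 1 + i) = ls t ! i" if "i < length (ls t)" for i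
    using *[of "1 + i"] that by (simp add: nth_append)
  show "inp (offs t + 1 + length (ls t)) = length (rs t)"
    using *[of "1 + length (ls t)"] by (simp add: nth_append)
  show "inp (offs t + 1 + length (ls t) + 1 + i) = rs t ! i" if "i < length (rs t)" for i
    using *[of "1 + length (ls t) + 1 + i"] that by (simp add: nth_append add.assoc)
  show "offs (Suc t) = offs t + 1 + length (ls t) + 1 + length (rs t)"
    using assms by (simp add: offs_def take_Suc_conv_app_nth ls_def rs_def split: prod.splits)
qed

lemma biclique_lists:
  assumes "t < l"
  shows "distinct (ls t)" "distinct (rs t)" "set (ls t) \<subseteq> {..<n}" "set (rs t) \<subseteq> {..<n}"
    "length (ls t) \<le> n" "length (rs t) \<le> n"
proof -
  show *: "distinct (ls t)" "distinct (rs t)" "set (ls t) \<subseteq> {..<n}" "set (rs t) \<subseteq> {..<n}"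
    using bcs(1) nth_mem[OF assms] by (auto simp: ls_def rs_def case_prod_beta)
  show "length (ls t) \<le> n" "length (rs t) \<le> n"
    using * card_mono[of "{..<n}"] distinct_card by (metis card_lessThan finite_lessThan)+
qed

lemma As_nth: "t < l \<Longrightarrow> ((!) vs ` set (ls t), (!) vs ` set (rs t)) = As ! t"
  by (simp add: bcs(2)[symmetric] ls_def rs_def split: prod.splits)

lemma biclique_adj:
  assumes "t < l" "u \<in> set (ls t)" "v \<in> set (rs t)"
  shows "adj u v"
proof -
  have "As ! t \<in> set As" using assms(1) length_As by simp
  then have "biclique_in (As ! t) V E" using inst by (auto simp: spgc_instance_def)
  then have "biclique_edges (As ! t) \<subseteq> E" by (auto simp: biclique_in_def subgraph_def)
  moreover have "{vs ! u, vs ! v} \<in> biclique_edges (As ! t)"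
    using assms As_nth[OF assms(1), symmetric] by (auto simp: biclique_edges_def)
  ultimately show ?thesis using assms biclique_lists[OF assms(1)] by (auto simp: adj_def)
qed

text \<open>The edges in \<open>M\<close> avoid all bicliques, so those inside \<open>X\<close> form
  a subgraph of the graph assumed to be degenerate; a vertex of low degree there is transported back
  to positions.\<close>

lemma degenerate_index:
  assumes M: "M \<subseteq> {..<m}"
    "\<And>e t. e \<in> M \<Longrightarrow> t < l \<Longrightarrow> \<not> (eu e \<in> set (ls t) \<and> ev e \<in> set (rs t))"
    "\<And>e t. e \<in> M \<Longrightarrow> t < l \<Longrightarrow> \<not> (ev e \<in> set (ls t) \<and> eu e \<in> set (rs t))"
    and X: "X \<subseteq> {..<n}" "X \<noteq> {}"
  shows "\<exists>x\<in>X. card {e \<in> M. (eu e = x \<and> ev e \<in> X) \<or> (ev e = x \<and> eu e \<in> X)} \<le> d"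
proof -
  let ?F = "\<Union>A\<in>set As. biclique_edges A"
  let ?f = "\<lambda>e. {vs ! eu e, vs ! ev e}"
  let ?M = "{e \<in> M. eu e \<in> X \<and> ev e \<in> X}"
  have "?f e \<notin> ?F" if e: "e \<in> M" for e
  proof
    assume "?f e \<in> ?F"
    then obtain t where t: "t < l" "?f e \<in> biclique_edges (As ! t)"
      using length_As by (auto simp: in_set_conv_nth)
    then obtain u v where uv: "u \<in> set (ls t)" "v \<in> set (rs t)" "?f e = {vs ! u, vs ! v}"
      using As_nth[OF t(1), symmetric] by (auto simp: biclique_edges_def)
    have "u < n" "v < n" using uv biclique_lists[OF t(1)] by auto
    moreover have "eu e < n" "ev e < n" using e M(1) eu_ev_less by auto
    ultimately have "(eu e = u \<and> ev e = v) \<or> (eu e = v \<and> ev e = u)"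
      using uv(3) by (auto simp: doubleton_eq_iff nth_vs_eq)
    then show False using M(2,3)[OF e t(1)] uv by auto
  qed
  then have sub: "?f ` ?M \<subseteq> E - ?F" using M(1) edge_in by auto
  have XV: "(!) vs ` X \<subseteq> V" using X vs(2) by force
  have "subgraph ((!) vs ` X) (?f ` ?M) V (E - ?F)"
    unfolding subgraph_def simple_graph_def
    using sub XV card2 finite_subset[OF X(1)] by auto
  moreover have "degenerate d V (E - ?F)" using inst by (simp add: spgc_instance_def)
  ultimately obtain x where x: "x \<in> X" "degree (?f ` ?M) (vs ! x) \<le> d"
    using X(2) unfolding degenerate_def by blast
  let ?N = "{e \<in> M. (eu e = x \<and> ev e \<in> X) \<or> (ev e = x \<and> eu e \<in> X)}"
  \<comment> \<open>Distinct positions in \<open>es\<close> carry distinct edges, so counting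
    positions and counting edges agree.\<close>
  have "inj_on ?f ?N"
    by (rule inj_onI, rule edge_inj) (use M(1) in auto)
  then have "card ?N = card (?f ` ?N)" by (simp add: card_image)
  also have "\<dots> \<le> card {e \<in> ?f ` ?M. vs ! x \<in> e}"
    by (rule card_mono) (use finite_subset[OF M(1)] x in auto)
  also have "\<dots> \<le> d" using x(2) by (simp add: degree_def)
  finally show ?thesis using x(1) by blast
qed

text \<open>Colors start at \<open>0\<close> here: color \<open>i\<close> stands for color
  \<open>i + 1\<close> of a partial Grundy coloring.\<close>

definition dominates :: "(nat \<Rightarrow> nat) \<Rightarrow> nat \<Rightarrow> nat \<Rightarrow> bool" where
  "dominates col i v \<longleftrightarrow> v < n \<and> col v = i \<and> (\<forall>j<i. \<exists>u. adj u v \<and> col u = j)"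

text \<open>Class \<open>k - 1\<close> may contain edges, since it also collects the vertices
  without a color. Only one dominator \<open>z\<close> of it is kept, so no edge inside the class
  remains; all dominators look only at smaller classes, which are kept in full. The rest is colored
  by \<open>partial_grundy_extend\<close>.\<close>

lemma accept_sound:
  assumes indep: "\<And>u v. adj u v \<Longrightarrow> col u = col v \<Longrightarrow> col u \<ge> k - 1"
    and dom: "\<And>i. i < k \<Longrightarrow> \<exists>v. dominates col i v"
  shows "spgc_yes k V E"
proof -
  obtain z where z: "dominates col (k - 1) z" using dom[of "k - 1"] k_ge1 by auto
  define D where "D = {v. v < n \<and> (col v < k - 1 \<or> v = z)}"
  define idx where "idx x = (THE i. i < n \<and> vs ! i = x)" for x
  have idx: "idx (vs ! i) = i" if "i < n" for i
    unfolding idx_def using that nth_vs_eq by (intro the_equality) auto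
  define g where "g x = Suc (col (idx x))" for x
  have "partial_grundy_coloring ((!) vs ` D) E k g"
    unfolding partial_grundy_coloring_def
  proof (intro conjI ballI impI)
    fix v assume "v \<in> (!) vs ` D"
    then show "g v \<in> {1..k}"
      using k_ge1 z by (auto simp: g_def D_def idx dominates_def)
  next
    fix u v assume uv: "u \<in> (!) vs ` D" "v \<in> (!) vs ` D" "{u, v} \<in> E"
    then obtain i j where ij: "i \<in> D" "j \<in> D" "u = vs ! i" "v = vs ! j" by auto
    have "adj i j" using uv ij by (auto simp: adj_def D_def)
    then have ne: "i \<noteq> j" using card2[of "{vs ! i}"] by (auto simp: adj_def)
    show "g u \<noteq> g v"
    proof
      assume "g u = g v"
      then have "col i = col j" using ij by (auto simp: g_def D_def idx)
      then show False using indep[OF \<open>adj i j\<close>] ij ne by (auto simp: D_def)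
    qed
  next
    fix i assume i: "i \<in> {1..k}"
    have "\<exists>v\<in>D. dominates col (i - 1) v"
    proof (cases "i = k")
      case True
      then show ?thesis using z by (auto simp: D_def dominates_def)
    next
      case False
      then have "i - 1 < k" "i - 1 < k - 1" using i by auto
      then show ?thesis using dom[of "i - 1"] by (auto simp: D_def dominates_def)
    qed
    then obtain v where v: "v \<in> D" "dominates col (i - 1) v" by blast
    have "\<exists>u\<in>(!) vs ` D. {u, vs ! v} \<in> E \<and> g u = j" if j: "j \<in> {1..<i}" for j
    proof -
      have "j - 1 < i - 1" using j by auto
      then obtain u where "adj u v" "col u = j - 1" using v(2) by (auto simp: dominates_def)
      then show ?thesis using i j
        by (intro bexI[of _ "vs ! u"]) (auto simp: D_def adj_def g_def idx)
    qed
    moreover have "g (vs ! v) = i" using v i by (auto simp: D_def dominates_def g_def idx)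
    ultimately show "\<exists>v\<in>(!) vs ` D. g v = i \<and> (\<forall>j\<in>{1..<i}. \<exists>u\<in>(!) vs ` D. {u, v} \<in> E \<and> g u = j)"
      using v(1) by blast
  qed
  moreover have "(!) vs ` D \<subseteq> V" using vs(2) by (auto simp: D_def)
  moreover have "finite V" using vs(2) by auto
  ultimately show ?thesis unfolding spgc_yes_def
    using partial_grundy_extend card2 by blast
qed

text \<open>Row \<open>i\<close> of \<open>w\<close> is a star: \<open>w i i\<close> is the
  dominator of color \<open>i\<close>, and \<open>w i j\<close> its neighbour of color
  \<open>j\<close>. Rows may share vertices.\<close>

lemma yes_witness:
  assumes "spgc_yes k V E"
  obtains w cw where "\<And>i j. i < k \<Longrightarrow> j \<le> i \<Longrightarrow> w i j < n \<and> cw (w i j) = j"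
    "\<And>i j. i < k \<Longrightarrow> j < i \<Longrightarrow> adj (w i j) (w i i)" "\<And>u v. adj u v \<Longrightarrow> cw u \<noteq> cw v"
proof -
  obtain k' c where c: "k' \<ge> k" "partial_grundy_coloring V E k' c"
    using assms by (auto simp: spgc_yes_def)
  have mem: "\<exists>i<n. vs ! i = x" if "x \<in> V" for x using that vs(2) by (auto simp: in_set_conv_nth)
  \<comment> \<open>On vertices the colors are at least \<open>1\<close>, so the truncated
    subtraction is injective and \<open>cw\<close> stays proper.\<close>
  define cw where "cw i = c (vs ! i) - 1" for i
  have c1: "c (vs ! i) \<ge> 1" if "i < n" for i
    using c(2) that vs(2) nth_mem[OF that] by (auto simp: partial_grundy_coloring_def)
  have "\<exists>f. \<forall>j\<le>i. f j < n \<and> cw (f j) = j \<and> (j < i \<longrightarrow> adj (f j) (f i))" if i: "i < k" for i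
  proof -
    have "\<exists>v\<in>V. c v = Suc i \<and> (\<forall>j\<in>{1..<Suc i}. \<exists>u\<in>V. {u, v} \<in> E \<and> c u = j)"
      using c i by (auto simp: partial_grundy_coloring_def)
    then obtain v where v: "v < n" "c (vs ! v) = Suc i"
      "\<forall>j\<in>{1..<Suc i}. \<exists>u\<in>V. {u, vs ! v} \<in> E \<and> c u = j" using mem by metis
    have "\<exists>u. u < n \<and> adj u v \<and> cw u = j" if j: "j < i" for j
    proof -
      have "Suc j \<in> {1..<Suc i}" using j by auto
      then obtain u where "u \<in> V" "{u, vs ! v} \<in> E" "c u = Suc j" using v(3) by blast
      then show ?thesis using mem v(1) by (force simp: adj_def cw_def)
    qed
    then obtain f where f: "\<forall>j<i. f j < n \<and> adj (f j) v \<and> cw (f j) = j" by metis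
    show ?thesis using f v by (intro exI[of _ "f(i := v)"]) (auto simp: cw_def)
  qed
  then obtain w where w: "\<forall>i<k. \<forall>j\<le>i. w i j < n \<and> cw (w i j) = j \<and> (j < i \<longrightarrow> adj (w i j) (w i i))"
    by metis
  have "cw u \<noteq> cw v" if "adj u v" for u v
  proof -
    have "c (vs ! u) \<noteq> c (vs ! v)"
      using that c(2) vs(2) by (auto simp: adj_def partial_grundy_coloring_def)
    moreover have "c (vs ! u) \<ge> 1" "c (vs ! v) \<ge> 1" using c1 that by (auto simp: adj_def)
    ultimately show ?thesis by (auto simp: cw_def)
  qed
  then show ?thesis using that[of w cw] w by auto
qed

end

section \<open>The steps of one round\<close>

declare One_nat_def [simp del]

text \<open>
  Registers: 0 the answer, 1 \<open>k\<close>, 2 \<open>d\<close>, 3 the number of bicliques, 4 \<open>n\<close>, 5 \<open>m\<close>, 6 \<open>k - 1\<close>, 7 the number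
  of rounds left, 8 the number of biclique guesses, 9 \<open>n + 2 m\<close>, 11 the constant 1; from 20 on scratch.
  Arrays: 0 the input, 1 the color of each vertex, 2 the biclique guesses, 3 the subsampling,
  4 to 6 heads, links and targets of the adjacency lists, 7 degrees, 8 the queue, 9 queue positions,
  10 the number of colors \<open>0, 1, \<dots>\<close> seen without a gap. Colors start at 0, and color \<open>k - 1\<close> also
  marks the vertices without a color.
\<close>

definition del_side :: com where
  "del_side = Load 25 0 22 ;; Inc 22 ;; For 26 25 (Load 21 0 22 ;; Load 27 1 21 ;; Add 32 24 27 ;;
     Load 33 2 32 ;; IfEq 33 23 (Store 1 21 6) Skip ;; Inc 22)"

definition del_bicliques :: com where
  "del_bicliques = Const 22 5 ;; Add 22 22 5 ;; Add 22 22 5 ;; Const 24 0 ;;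
     For 20 3 (Const 23 0 ;; del_side ;; Const 23 1 ;; del_side ;; Add 24 24 1)"

definition reset_lists :: com where
  "reset_lists = For 20 4 (Const 21 0 ;; Store 4 20 21 ;; Store 7 20 21)"

text \<open>The degree increased is that of the target \<open>v\<close>: it counts the entries
  pointing to \<open>v\<close>, which the peeling cancels one by one. Register 28 holds
  \<open>1\<close> here.\<close>

definition add_entry :: "nat \<Rightarrow> nat \<Rightarrow> nat \<Rightarrow> com" where
  "add_entry p u v = Load 32 4 u ;; Store 5 p 32 ;; Store 4 u p ;; Store 6 p v ;;
     Load 32 7 v ;; Add 32 32 28 ;; Store 7 v 32"

definition build_lists :: com where
  "build_lists = Const 22 5 ;; For 20 5 (Const 28 1 ;; Load 23 0 22 ;; Add 24 22 28 ;; Load 25 0 24 ;;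
     Load 26 1 23 ;; Load 27 1 25 ;;
     IfEq 26 27 (IfEq 26 6 Skip (add_entry 22 23 25 ;; add_entry 24 25 23)) Skip ;;
     Add 22 24 28)"

definition enqueue :: "nat \<Rightarrow> com" where
  "enqueue v = Store 8 35 v ;; Store 9 v 35 ;; Inc 35"

definition init_queue :: com where
  "init_queue = Const 35 0 ;; For 20 4 (Load 21 7 20 ;; IfLe 21 2 (enqueue 20) Skip)"

text \<open>A single counting loop replaces two nested loops. Register 37 points into the list of
  the vertex being removed, with \<open>0\<close> as null pointer; each pass either handles one list
  entry or takes one vertex from the queue, so \<open>n + 2 * m\<close> passes are enough.\<close>

definition peel :: com where
  "peel = Const 36 0 ;; Const 37 0 ;; For 20 9
     (Cond 37
       (Load 21 6 37 ;; Load 22 7 21 ;; Const 28 1 ;; Sub 22 22 28 ;; Store 7 21 22 ;;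
        IfEq 22 2 (enqueue 21) Skip ;; Load 37 5 37)
       (IfLe 35 36 Skip (Load 21 8 36 ;; Load 37 4 21 ;; Inc 36)))"

definition subsample :: com where
  "subsample = For 20 4 (Const 21 0 ;; Store 10 20 21 ;; Load 21 3 20 ;; Cond 21 (Store 1 20 6) Skip)"

text \<open>The end point that entered the queue earlier is the tail and loses its color. A vertex
  is thus threatened only by later neighbours of its color, of which the peeling leaves at most
  \<open>d\<close>.\<close>

definition clean :: com where
  "clean = Const 22 5 ;; For 20 5 (Load 23 0 22 ;; Inc 22 ;; Load 25 0 22 ;; Inc 22 ;;
     Load 26 1 23 ;; Load 27 1 25 ;;
     IfEq 26 27 (IfEq 26 6 Skip
       (Load 32 9 23 ;; Load 33 9 25 ;; IfLe 33 32 (Store 1 25 6) (Store 1 23 6))) Skip)"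

text \<open>Comparing the level of \<open>v\<close> with the current color \<open>i\<close> makes
  the update idempotent: after one increase the level is \<open>i + 1\<close>, and further
  neighbours of color \<open>i\<close> have no effect.\<close>

definition raise_level :: "nat \<Rightarrow> nat \<Rightarrow> com" where
  "raise_level u v = Load 26 1 u ;; IfEq 26 20 (Load 26 10 v ;;
     IfEq 26 20 (Const 28 1 ;; Add 26 26 28 ;; Store 10 v 26) Skip) Skip"

definition find_dom :: com where
  "find_dom = Const 39 0 ;; For 21 4 (Load 23 1 21 ;;
     IfEq 23 20 (Load 23 10 21 ;; IfEq 23 20 (Const 39 1) Skip) Skip)"

definition raise_levels :: com where
  "raise_levels = Const 22 5 ;; For 21 5 (Load 23 0 22 ;; Inc 22 ;; Load 25 0 22 ;; Inc 22 ;;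
     raise_level 23 25 ;; raise_level 25 23)"

definition check :: com where
  "check = Const 38 1 ;; For 20 1 (find_dom ;; Cond 39 Skip (Const 38 0) ;; raise_levels)"

section \<open>Correctness and cost of the single steps\<close>

context spgc_input
begin

definition env :: "regs \<Rightarrow> arrays \<Rightarrow> bool" where
  "env r a \<longleftrightarrow> a 0 = inp \<and> r 1 = k \<and> r 2 = d \<and> r 3 = l \<and> r 4 = n \<and> r 5 = m \<and> r 6 = k - 1 \<and>
     r 8 = l * k \<and> r 9 = n + 2 * m \<and> r 11 = 1"

lemma envD:
  assumes "env r a"
  shows "a 0 = inp" "r 1 = k" "r 2 = d" "r 3 = l" "r 4 = n" "r 5 = m" "r 6 = k - 1"
    "r 8 = l * k" "r 9 = n + 2 * m" "r 11 = 1"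
  using assms by (auto simp: env_def)

lemma env_frame:
  assumes "env r0 a0" "same_outside X r r0" "same_outside Y a a0"
    "\<forall>x\<in>{1, 2, 3, 4, 5, 6, 8, 9, 11}. x \<notin> X" "0 \<notin> Y"
  shows "env r a"
  using assms by (auto simp: env_def same_outside_def)

lemma del_side_ok:
  assumes a0: "a 0 = inp" and p: "r 22 = p" "inp p = length zs"
    "\<And>i. i < length zs \<Longrightarrow> inp (p + 1 + i) = zs ! i" and zs: "distinct zs" "length zs \<le> n"
  shows "ok del_side r a (n * 40 + 40) (\<lambda>r' a'. r' 22 = p + 1 + length zs \<and>
    a' 1 = (\<lambda>v. if v \<in> set zs \<and> a 2 (r 24 + a 1 v) = r 23 then r 6 else a 1 v))"
proof -
  define I where "I = (\<lambda>(j::nat) (r'::regs) (a'::arrays). r' 22 = p + 1 + j \<and>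
    a' 1 = (\<lambda>v. if v \<in> set (take j zs) \<and> a 2 (r 24 + a 1 v) = r 23 then r 6 else a 1 v))"
  let ?r = "r(25 := length zs, 28 := 1, 22 := Suc p)"
  let ?body = "Load 21 0 22 ;; Load 27 1 21 ;; Add 32 24 27 ;;
     Load 33 2 32 ;; IfEq 33 23 (Store 1 21 6) Skip ;; Inc 22"
  have "ok (For 26 25 ?body) ?r a (n * 40 + 20) (I (?r 25))"
  proof (rule ok_For[where \<tau> = 30])
    fix j r' a'
    assume j: "j < ?r 25" and so: "same_outside ({26, 29} \<union> mods ?body) r' ?r"
      "same_outside (arrs ?body) a' a" and I: "I j r' a'"
    have r': "r' 24 = r 24" "r' 23 = r 23" "r' 6 = r 6" and a': "a' 0 = inp" "a' 2 = a 2"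
      using same_outsideD[OF so(1)] same_outsideD[OF so(2)] a0 by auto
    have jl: "j < length zs" using j by simp
    \<comment> \<open>The side lists each vertex once, so the color read for \<open>zs ! j\<close>
      is still its initial one. A second visit would consult the guess for color
      \<open>k - 1\<close> instead.\<close>
    have nj: "zs ! j \<notin> set (take j zs)"
      using zs(1) jl by (metis distinct_take id_take_nth_drop not_distinct_conv_prefix)
    show "ok ?body r' a' 30 (I (Suc j))"
      apply (rule ok_wp)
       apply simp
      using I nj p(3)[OF jl] jl
      by (auto simp: I_def r' a' take_Suc_conv_app_nth fun_eq_iff)
  qed (use zs in \<open>auto simp: I_def\<close>)
  then have "ok (For 26 25 ?body) ?r a (n * 40 + 20)
    (\<lambda>r' a'. r' 22 = p + 1 + length zs \<and>
    a' 1 = (\<lambda>v. if v \<in> set zs \<and> a 2 (r 24 + a 1 v) = r 23 then r 6 else a 1 v))"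
    by (simp add: I_def)
  then show ?thesis unfolding del_side_def
    apply -
    apply (rule ok_Seq_wp)
     apply (simp add: a0 p)
     apply (rule ok_Seq_wp)
      apply (simp add: p)
      apply (erule ok_conseq)
       apply auto
    done
qed

text \<open>Cell \<open>t * k + c\<close> holds the guess for biclique \<open>t\<close> and color
  \<open>c\<close>: \<open>0\<close> takes the color from the left side, \<open>1\<close> from the
  right. For \<open>c = k - 1\<close> either value is harmless, as the replacement color is again
  \<open>k - 1\<close>.\<close>

definition bad :: "(nat \<Rightarrow> nat) \<Rightarrow> nat \<Rightarrow> nat \<Rightarrow> nat \<Rightarrow> bool" where
  "bad g t v c \<longleftrightarrow> (v \<in> set (ls t) \<and> g (t * k + c) = 0) \<or> (v \<in> set (rs t) \<and> g (t * k + c) = 1)"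

lemma del_bicliques_ok:
  assumes env: "env r a"
  shows "ok del_bicliques r a (l * (80 * n + 120) + 30)
    (\<lambda>r' a'. a' 1 = (\<lambda>v. if \<exists>t<l. bad (a 2) t v (a 1 v) then k - 1 else a 1 v))"
proof -
  define C where "C j = (\<lambda>v. if \<exists>t<j. bad (a 2) t v (a 1 v) then k - 1 else a 1 v)" for j
  define I where "I = (\<lambda>j (r'::regs) (a'::arrays). r' 22 = offs j \<and> r' 24 = j * k \<and> a' 1 = C j)"
  let ?r = "r(22 := offs 0, 24 := 0)"
  let ?body = "Const 23 0 ;; del_side ;; Const 23 1 ;; del_side ;; Add 24 24 1"
  have "ok (For 20 3 ?body) ?r a (l * (80 * n + 120) + 10) (I (?r 3))"
  proof (rule ok_For[where \<tau> = "80 * n + 110"])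
    fix j r' a'
    assume j: "j < ?r 3" and so: "same_outside ({20, 29} \<union> mods ?body) r' ?r"
      "same_outside (arrs ?body) a' a" and I: "I j r' a'"
    have r': "r' 6 = k - 1" "r' 1 = k" and a': "a' 0 = inp" "a' 2 = a 2"
      using same_outsideD[OF so(1)] same_outsideD[OF so(2)] envD[OF env] by (auto simp: del_side_def)
    have jl: "j < l" using j envD[OF env] by simp
    let ?C1 = "\<lambda>v. if v \<in> set (ls j) \<and> a 2 (j * k + C j v) = 0 then k - 1 else C j v"
    have 1: "ok del_side (r'(23 := 0)) a' (n * 40 + 40) (\<lambda>r1 a1. r1 22 = offs j + 1 + length (ls j) \<and>
        a1 1 = ?C1)"
      using del_side_ok[of a' "r'(23 := 0)" "offs j" "ls j"] I jl
        inp_biclique[OF jl] biclique_lists[OF jl] by (simp add: I_def r' a' cong: if_cong)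
    have 2: "ok del_side (r1(23 := 1)) a1 (n * 40 + 40) (\<lambda>r2 a2.
        r2 22 = offs j + 1 + length (ls j) + 1 + length (rs j) \<and>
        a2 1 = (\<lambda>v. if v \<in> set (rs j) \<and> a 2 (j * k + ?C1 v) = 1 then k - 1 else ?C1 v))"
      if "r1 22 = offs j + 1 + length (ls j)" "a1 1 = ?C1" "a1 0 = inp" "r1 24 = j * k"
        "a1 2 = a 2" "r1 6 = k - 1" for r1 a1
      using del_side_ok[of a1 "r1(23 := 1)" "offs j + 1 + length (ls j)" "rs j"] that
        inp_biclique[OF jl] biclique_lists[OF jl] by (simp cong: if_cong)
    \<comment> \<open>A vertex that has lost its color has color \<open>k - 1\<close> and keeps it
      whatever guess is read for it later. So testing the current color amounts to testing the
      initial one.\<close>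
    have C: "(\<lambda>v. if v \<in> set (rs j) \<and> a 2 (j * k + ?C1 v) = 1 then k - 1 else ?C1 v) = C (Suc j)"
      by (auto simp: C_def bad_def fun_eq_iff less_Suc_eq)
    show "ok ?body r' a' (80 * n + 110) (I (Suc j))"
    proof (rule ok_Seq_wp, unfold wp.simps, rule ok_Seq[OF ok_frame[OF 1], where \<sigma> = "40 * n + 55"])
      fix r1 a1
      assume 3: "(r1 22 = offs j + 1 + length (ls j) \<and> a1 1 = ?C1) \<and>
        same_outside (mods del_side) r1 (r'(23 := 0)) \<and> same_outside (arrs del_side) a1 a'"
      then have 4: "r1 22 = offs j + 1 + length (ls j)" "a1 1 = ?C1" "a1 0 = inp" "r1 24 = j * k"
        "a1 2 = a 2" "r1 6 = k - 1" "r1 1 = k"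
        using I by (auto simp: same_outside_def del_side_def r' a' I_def)
      show "ok (Const 23 1 ;; del_side ;; Add 24 24 1) r1 a1 (40 * n + 55) (I (Suc j))"
      proof (rule ok_Seq_wp, unfold wp.simps, rule ok_Seq[OF ok_frame[OF 2[OF 4(1-6)]], where \<sigma> = 5])
        fix r2 a2
        assume "(r2 22 = offs j + 1 + length (ls j) + 1 + length (rs j) \<and>
          a2 1 = (\<lambda>v. if v \<in> set (rs j) \<and> a 2 (j * k + ?C1 v) = 1 then k - 1 else ?C1 v)) \<and>
          same_outside (mods del_side) r2 (r1(23 := 1)) \<and> same_outside (arrs del_side) a2 a1"
        then have 5: "r2 22 = offs (Suc j)" "a2 1 = C (Suc j)" "r2 24 = j * k" "r2 1 = k"
          using 4 inp_biclique(5)[OF jl] unfolding C by (auto simp: same_outside_def del_side_def)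
        show "ok (Add 24 24 1) r2 a2 5 (I (Suc j))"
          using 5 by (intro ok_wp) (auto simp: I_def)
      qed auto
    qed auto
  qed (use envD[OF env] in \<open>auto simp: I_def C_def del_side_def algebra_simps\<close>)
  then have *: "ok (For 20 3 ?body) ?r a (l * (80 * n + 120) + 10) (I l)"
    using envD[OF env] by simp
  have o: "offs 0 = 2 * m + 5" by (simp add: offs_def)
  show ?thesis unfolding del_bicliques_def
    apply (rule ok_Seq_wp)
     apply simp
     apply (rule ok_Seq_wp)
      apply simp
      apply (rule ok_Seq_wp)
       apply simp
       apply (rule ok_Seq_wp)
        apply (simp add: envD[OF env])
        apply (rule ok_conseq[OF *[unfolded o]])
         apply (auto simp: I_def C_def)
    done
qed

lemma reset_lists_ok:
  assumes env: "env r a"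
  shows "ok reset_lists r a (n * 20 + 10) (\<lambda>r' a'. \<forall>v<n. a' 4 v = 0 \<and> a' 7 v = 0)"
proof -
  have "ok reset_lists r a (n * 20 + 10) ((\<lambda>j r' a'. \<forall>v<j. a' 4 v = 0 \<and> a' 7 v = 0) (r 4))"
    unfolding reset_lists_def
  proof (rule ok_For[where \<tau> = 10])
    fix j and r' :: regs and a' :: arrays
    assume "r' 20 = j" "\<forall>v<j. a' 4 v = 0 \<and> a' 7 v = (0::nat)"
    then show "ok (Const 21 0 ;; Store 4 20 21 ;; Store 7 20 21) r' a' 10
        (\<lambda>r' a'. \<forall>v<Suc j. a' 4 v = 0 \<and> a' 7 v = 0)"
      by (intro ok_wp) (auto simp: less_Suc_eq)
  qed (use envD[OF env] in auto)
  then show ?thesis using envD[OF env] by simp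
qed

lemma subsample_ok:
  assumes env: "env r a"
  shows "ok subsample r a (n * 20 + 10) (\<lambda>r' a'. (\<forall>v<n. a' 10 v = 0) \<and>
    (\<forall>v<n. a' 1 v = (if a 3 v \<noteq> 0 then k - 1 else a 1 v)))"
proof -
  let ?body = "Const 21 0 ;; Store 10 20 21 ;; Load 21 3 20 ;; Cond 21 (Store 1 20 6) Skip"
  have "ok subsample r a (n * 20 + 10) ((\<lambda>j r' a'. (\<forall>v<j. a' 10 v = 0) \<and>
      a' 1 = (\<lambda>v. if v < j \<and> a 3 v \<noteq> 0 then k - 1 else a 1 v)) (r 4))"
    unfolding subsample_def
  proof (rule ok_For[where \<tau> = 10])
    fix j r' a'
    assume so: "same_outside ({20, 29} \<union> mods ?body) r' r"
      "same_outside (arrs ?body) a' a" and j: "r' 20 = j" and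
      I: "(\<forall>v<j. a' 10 v = (0::nat)) \<and> a' 1 = (\<lambda>v. if v < j \<and> a 3 v \<noteq> 0 then k - 1 else a 1 v)"
    have r': "r' 6 = k - 1" and a': "a' 3 = a 3"
      using same_outsideD[OF so(1)] same_outsideD[OF so(2)] envD[OF env] by auto
    show "ok ?body r' a' 10 (\<lambda>r' a'. (\<forall>v<Suc j. a' 10 v = 0) \<and>
      a' 1 = (\<lambda>v. if v < Suc j \<and> a 3 v \<noteq> 0 then k - 1 else a 1 v))"
      using I j by (intro ok_wp) (auto simp: less_Suc_eq r' a' fun_eq_iff)
  qed (use envD[OF env] in auto)
  then show ?thesis by (rule ok_conseq) (use envD[OF env] in auto)
qed

text \<open>Which vertices lose their color depends on the order of the edges, since one deletion
  can settle several edges. The specification is therefore loose: the classes become independent,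
  and a vertex survives if all its initial rivals have smaller positions.\<close>

lemma clean_ok:
  assumes env: "env r a"
  shows "ok clean r a (m * 70 + 20) (\<lambda>r' a'. (\<forall>v. a' 1 v = a 1 v \<or> a' 1 v = k - 1) \<and>
    (\<forall>u v. adj u v \<longrightarrow> a' 1 u = a' 1 v \<longrightarrow> a' 1 u = k - 1) \<and>
    (\<forall>w. (\<forall>y. adj w y \<longrightarrow> a 1 y = a 1 w \<longrightarrow> a 1 w \<noteq> k - 1 \<longrightarrow> a 9 y < a 9 w) \<longrightarrow> a' 1 w = a 1 w))"
proof -
  define I where "I = (\<lambda>j (r'::regs) (a'::arrays). r' 22 = 5 + 2 * j \<and>
    (\<forall>v. a' 1 v = a 1 v \<or> a' 1 v = k - 1) \<and>
    (\<forall>e<j. a' 1 (eu e) = a' 1 (ev e) \<longrightarrow> a' 1 (eu e) = k - 1) \<and>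
    (\<forall>w. (\<forall>y. adj w y \<longrightarrow> a 1 y = a 1 w \<longrightarrow> a 1 w \<noteq> k - 1 \<longrightarrow> a 9 y < a 9 w) \<longrightarrow> a' 1 w = a 1 w))"
  let ?body = "Load 23 0 22 ;; Inc 22 ;; Load 25 0 22 ;; Inc 22 ;;
     Load 26 1 23 ;; Load 27 1 25 ;;
     IfEq 26 27 (IfEq 26 6 Skip
       (Load 32 9 23 ;; Load 33 9 25 ;; IfLe 33 32 (Store 1 25 6) (Store 1 23 6))) Skip"
  have upd: "I j (r'(20 := v, 29 := w)) a' = I j r' a'" for j r' a' v w by (simp add: I_def)
  have I0: "I 0 (r(22 := 5)) a" by (simp add: I_def)
  have "ok (For 20 5 ?body) (r(22 := 5)) a (m * 70 + 10) (I ((r(22 := 5)) 5))"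
  proof (rule ok_For[where \<tau> = 60])
    fix j r' a'
    assume j: "j < (r(22 := 5)) 5" and so: "same_outside ({20, 29} \<union> mods ?body) r' (r(22 := 5))"
      "same_outside (arrs ?body) a' a" and I: "I j r' a'"
    have r': "r' 6 = k - 1" and a': "a' 0 = inp" "a' 9 = a 9"
      using same_outsideD[OF so(1)] same_outsideD[OF so(2)] envD[OF env] by auto
    have jm: "j < m" using j envD[OF env] by simp
    note e = inp_edge[OF jm, simplified] eu_neq_ev[OF jm]
    have ad: "adj (eu j) (ev j)" "adj (ev j) (eu j)" using jm adj_edge by auto
    note II = I[unfolded I_def]
    have I22: "r' 22 = 5 + 2 * j" by (rule II[THEN conjunct1])
    have I1: "a' 1 v = a 1 v \<or> a' 1 v = k - 1" for v
      using II[THEN conjunct2, THEN conjunct1] by (rule spec)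
    have I2: "a' 1 (eu e) = k - 1" if "e < j" "a' 1 (eu e) = a' 1 (ev e)" for e
      using II[THEN conjunct2, THEN conjunct2, THEN conjunct1] that by simp
    note I3 = II[THEN conjunct2, THEN conjunct2, THEN conjunct2, THEN spec, THEN mp]
    have keep: "I (Suc j) r1 (a'(1 := (a' 1)(x := k - 1)))"
      if "r1 22 = 7 + 2 * j" "x = eu j \<or> x = ev j" "a' 1 (eu j) = a' 1 (ev j)" "a' 1 (eu j) \<noteq> k - 1"
        "x = eu j \<Longrightarrow> a 9 (ev j) \<ge> a 9 (eu j)" "x = ev j \<Longrightarrow> a 9 (eu j) \<ge> a 9 (ev j)" for x r1
    proof -
      have c: "a' 1 (eu j) = a 1 (eu j)" "a' 1 (ev j) = a 1 (ev j)"
        using I1[of "eu j"] I1[of "ev j"] that(3,4) by auto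
      \<comment> \<open>Colors only ever change to \<open>k - 1\<close>, so both ends still have
        their initial colors. The end \<open>x\<close> about to lose its color has an initial rival
        whose position is not smaller, and is not among the protected vertices.\<close>
      have no: "\<not> (\<forall>y. adj x y \<longrightarrow> a 1 y = a 1 x \<longrightarrow> a 1 x \<noteq> k - 1 \<longrightarrow> a 9 y < a 9 x)"
      proof
        assume all: "\<forall>y. adj x y \<longrightarrow> a 1 y = a 1 x \<longrightarrow> a 1 x \<noteq> k - 1 \<longrightarrow> a 9 y < a 9 x"
        have eq: "a 1 (eu j) = a 1 (ev j)" "a 1 (eu j) \<noteq> k - 1" using c that(3,4) by auto
        show False
        proof (cases "x = eu j")
          case True
          then have "a 9 (ev j) < a 9 (eu j)" using all ad(1) eq by metis
          then show False using that(5)[OF True] by simp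
        next
          case False
          then have x: "x = ev j" using that(2) by simp
          then have "a 9 (eu j) < a 9 (ev j)" using all ad(2) eq by metis
          then show False using that(6)[OF x] by simp
        qed
      qed
      let ?c = "(a' 1)(x := k - 1)"
      have "?c v = a 1 v \<or> ?c v = k - 1" for v using I1[of v] by auto
      moreover have "?c (eu e) = k - 1" if "e < Suc j" "?c (eu e) = ?c (ev e)" for e
      proof (cases "eu e = x \<or> ev e = x")
        case True
        then show ?thesis using that by (auto split: if_splits)
      next
        case False
        then have "e < j" using that(1) \<open>x = eu j \<or> x = ev j\<close> by (auto simp: less_Suc_eq)
        then show ?thesis using that(2) False I2[of e] by simp
      qed
      moreover have "?c w = a 1 w"
        if "\<forall>y. adj w y \<longrightarrow> a 1 y = a 1 w \<longrightarrow> a 1 w \<noteq> k - 1 \<longrightarrow> a 9 y < a 9 w" for w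
      proof -
        have "w \<noteq> x" using that no by blast
        then show ?thesis using I3[OF that] by simp
      qed
      ultimately show ?thesis unfolding I_def using \<open>r1 22 = 7 + 2 * j\<close> by simp
    qed
    have skip: "I (Suc j) r1 a'" if "r1 22 = 7 + 2 * j"
        "a' 1 (eu j) = a' 1 (ev j) \<longrightarrow> a' 1 (eu j) = k - 1" for r1
    proof -
      have "a' 1 (eu e) = k - 1" if "e < Suc j" "a' 1 (eu e) = a' 1 (ev e)" for e
        using that I2[of e] \<open>a' 1 (eu j) = a' 1 (ev j) \<longrightarrow> _\<close> by (cases "e = j") auto
      then have "\<forall>e<Suc j. a' 1 (eu e) = a' 1 (ev e) \<longrightarrow> a' 1 (eu e) = k - 1" by blast
      moreover have "r1 22 = 5 + 2 * Suc j" using that(1) by simp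
      ultimately show ?thesis unfolding I_def
        using II[THEN conjunct2, THEN conjunct1] II[THEN conjunct2, THEN conjunct2, THEN conjunct2]
        by (intro conjI)
    qed
    let ?x = "if a 9 (ev j) \<le> a 9 (eu j) then ev j else eu j"
    have "wp ?body (\<lambda>r1 a1. r1 22 = 7 + 2 * j \<and>
        a1 = (if a' 1 (eu j) = a' 1 (ev j) \<and> a' 1 (eu j) \<noteq> k - 1
              then a'(1 := (a' 1)(?x := k - 1)) else a')) r' a'"
      by (simp add: I22 r' a' e)
    then have "ok ?body r' a' 60 (\<lambda>r1 a1. r1 22 = 7 + 2 * j \<and>
        a1 = (if a' 1 (eu j) = a' 1 (ev j) \<and> a' 1 (eu j) \<noteq> k - 1
              then a'(1 := (a' 1)(?x := k - 1)) else a'))"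
      by (intro ok_wp) simp_all
    then show "ok ?body r' a' 60 (I (Suc j))"
    proof (rule ok_conseq)
      fix r1 :: regs and a1
      assume 1: "r1 22 = 7 + 2 * j \<and>
        a1 = (if a' 1 (eu j) = a' 1 (ev j) \<and> a' 1 (eu j) \<noteq> k - 1
              then a'(1 := (a' 1)(?x := k - 1)) else a')"
      show "I (Suc j) r1 a1"
      proof (cases "a' 1 (eu j) = a' 1 (ev j) \<and> a' 1 (eu j) \<noteq> k - 1")
        case True
        then have "a1 = a'(1 := (a' 1)(?x := k - 1))" using 1 by simp
        then show ?thesis using 1 True e(3) keep[of r1 ?x] by (simp split: if_splits)
      next
        case False
        then have "a1 = a'" using 1 by (simp only: if_False)
        moreover have "I (Suc j) r1 a'" by (rule skip) (use 1 False in auto)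
        ultimately show ?thesis by simp
      qed
    qed simp
  next
    show "I j (r'(20 := v, 29 := w)) a'" if "I j r' a'" for j r' a' v w
      using that by (simp only: upd)
    show "I 0 (r(22 := 5)) a" by (rule I0)
  qed (use envD[OF env] in auto)
  then have *: "ok (For 20 5 ?body) (r(22 := 5)) a (m * 70 + 10) (I m)"
    using envD[OF env] by simp
  show ?thesis unfolding clean_def
  proof (rule ok_Seq_wp, unfold wp.simps, rule ok_conseq[OF *])
    fix r' a' assume I: "I m r' a'"
    have "a' 1 u = k - 1" if "adj u v" "a' 1 u = a' 1 v" for u v
      using that I unfolding I_def adj_iff by metis
    then show "(\<forall>v. a' 1 v = a 1 v \<or> a' 1 v = k - 1) \<and>
    (\<forall>u v. adj u v \<longrightarrow> a' 1 u = a' 1 v \<longrightarrow> a' 1 u = k - 1) \<and>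
    (\<forall>w. (\<forall>y. adj w y \<longrightarrow> a 1 y = a 1 w \<longrightarrow> a 1 w \<noteq> k - 1 \<longrightarrow> a 9 y < a 9 w) \<longrightarrow> a' 1 w = a 1 w)"
      using I unfolding I_def by blast
  qed auto
qed

lemma find_dom_ok:
  assumes env: "env r a"
  shows "ok find_dom r a (n * 50 + 20)
    (\<lambda>r' a'. r' 39 \<noteq> 0 \<longleftrightarrow> (\<exists>v<n. a 1 v = r 20 \<and> a 10 v = r 20))"
proof -
  define I where "I = (\<lambda>j (r'::regs) (a'::arrays).
    r' 39 \<noteq> 0 \<longleftrightarrow> (\<exists>v<j. a 1 v = r 20 \<and> a 10 v = r 20))"
  let ?body = "Load 23 1 21 ;; IfEq 23 20 (Load 23 10 21 ;; IfEq 23 20 (Const 39 1) Skip) Skip"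
  have "ok (For 21 4 ?body) (r(39 := 0)) a (n * 50 + 10) (I ((r(39 := 0)) 4))"
  proof (rule ok_For[where \<tau> = 30])
    fix j r' a'
    assume so: "same_outside ({21, 29} \<union> mods ?body) r' (r(39 := 0))"
      "same_outside (arrs ?body) a' a" and j: "r' 21 = j" and I: "I j r' a'"
    have r': "r' 20 = r 20" and a': "a' = a"
      using same_outsideD[OF so(1)] same_outsideD[OF so(2)] envD[OF env] by auto
    show "ok ?body r' a' 30 (I (Suc j))"
      using I j by (intro ok_wp) (auto simp: less_Suc_eq r' a' I_def)
  qed (use envD[OF env] in \<open>auto simp: I_def\<close>)
  then have *: "ok (For 21 4 ?body) (r(39 := 0)) a (n * 50 + 10) (I n)"
    using envD[OF env] by simp
  show ?thesis unfolding find_dom_def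
    apply (rule ok_Seq_wp)
     apply simp
     apply (rule ok_conseq[OF *])
      apply (auto simp: I_def)
    done
qed

lemma raise_levels_ok:
  assumes env: "env r a"
  shows "ok raise_levels r a (m * 80 + 20)
    (\<lambda>r' a'. a' 10 = (\<lambda>v. if a 10 v = r 20 \<and> (\<exists>u. adj u v \<and> a 1 u = r 20) then Suc (r 20) else a 10 v))"
proof -
  define hit where "hit e v \<longleftrightarrow> (ev e = v \<and> a 1 (eu e) = r 20) \<or> (eu e = v \<and> a 1 (ev e) = r 20)" for e v
  define I where "I = (\<lambda>j (r'::regs) (a'::arrays). r' 22 = 5 + 2 * j \<and>
    a' 10 = (\<lambda>v. if a 10 v = r 20 \<and> (\<exists>e<j. hit e v) then Suc (r 20) else a 10 v))"
  let ?body = "Load 23 0 22 ;; Inc 22 ;; Load 25 0 22 ;; Inc 22 ;; raise_level 23 25 ;; raise_level 25 23"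
  have "ok (For 21 5 ?body) (r(22 := 5)) a (m * 80 + 10) (I ((r(22 := 5)) 5))"
  proof (rule ok_For[where \<tau> = 70])
    fix j r' a'
    assume j: "j < (r(22 := 5)) 5" and so: "same_outside ({21, 29} \<union> mods ?body) r' (r(22 := 5))"
      "same_outside (arrs ?body) a' a" and I: "I j r' a'"
    have r': "r' 20 = r 20" and a': "a' 0 = inp" "a' 1 = a 1"
      using same_outsideD[OF so(1)] same_outsideD[OF so(2)] envD[OF env]
      by (auto simp: raise_level_def)
    have jm: "j < m" using j envD[OF env] by simp
    note e = inp_edge[OF jm, simplified] eu_neq_ev[OF jm]
    have I22: "r' 22 = 5 + 2 * j" and
      I10: "a' 10 = (\<lambda>v. if a 10 v = r 20 \<and> (\<exists>e<j. hit e v) then Suc (r 20) else a 10 v)"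
      using I unfolding I_def by blast+
    have h: "hit j v \<longleftrightarrow> (v = ev j \<and> a 1 (eu j) = r 20) \<or> (v = eu j \<and> a 1 (ev j) = r 20)" for v
      by (auto simp: hit_def)
    have upd: "(\<lambda>v. if a 10 v = r 20 \<and> (\<exists>e<Suc j. hit e v) then Suc (r 20) else a 10 v) =
      (\<lambda>v. if a' 10 v = r 20 \<and> hit j v then Suc (r 20) else a' 10 v)"
      unfolding I10 less_Suc_eq by (auto simp: fun_eq_iff)
    show "ok ?body r' a' 70 (I (Suc j))"
      apply (rule ok_wp)
       apply (simp add: raise_level_def)
      unfolding I_def upd h
      using e by (auto simp add: raise_level_def I22 r' a' fun_eq_iff)
  qed (use envD[OF env] in \<open>auto simp: I_def raise_level_def\<close>)
  then have *: "ok (For 21 5 ?body) (r(22 := 5)) a (m * 80 + 10) (I m)"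
    using envD[OF env] by simp
  have h: "(\<exists>e<m. hit e v) \<longleftrightarrow> (\<exists>u. adj u v \<and> a 1 u = r 20)" for v
    unfolding hit_def adj_iff by auto
  show ?thesis unfolding raise_levels_def
    apply (rule ok_Seq_wp)
     apply simp
     apply (rule ok_conseq[OF *])
      apply (auto simp: I_def h)
    done
qed

lemma check_ok:
  assumes env: "env r a" and lev: "\<forall>v<n. a 10 v = 0"
  shows "ok check r a (k * (50 * n + 80 * m + 80) + 20)
    (\<lambda>r' a'. r' 38 \<noteq> 0 \<longleftrightarrow> (\<forall>i<k. \<exists>v. dominates (a 1) i v))"
proof -
  \<comment> \<open>A level below the current color is final: the vertex has missed a color and can
    dominate none of the later ones. Hence knowing whether the level equals \<open>j\<close>
    suffices for pass \<open>j\<close>.\<close>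
  define I where "I = (\<lambda>j (r'::regs) (a'::arrays).
    (r' 38 \<noteq> 0 \<longleftrightarrow> (\<forall>i<j. \<exists>v. dominates (a 1) i v)) \<and>
    (\<forall>v<n. a' 10 v \<le> j \<and> (a' 10 v = j \<longleftrightarrow> (\<forall>i<j. \<exists>u. adj u v \<and> a 1 u = i))))"
  let ?body = "find_dom ;; Cond 39 Skip (Const 38 0) ;; raise_levels"
  have "ok (For 20 1 ?body) (r(38 := 1)) a (k * (50 * n + 80 * m + 80) + 10) (I ((r(38 := 1)) 1))"
  proof (rule ok_For[where \<tau> = "50 * n + 80 * m + 60"])
    fix j r' a'
    assume j: "r' 20 = j" and so: "same_outside ({20, 29} \<union> mods ?body) r' (r(38 := 1))"
      "same_outside (arrs ?body) a' a" and I: "I j r' a'"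
    have env': "env r' a'"
      by (rule env_frame[of "r(38 := 1)" a, OF _ so])
        (use env in \<open>auto simp: env_def find_dom_def raise_levels_def raise_level_def\<close>)
    have a1: "a' 1 = a 1"
      using same_outsideD[OF so(2)] by (auto simp: find_dom_def raise_levels_def raise_level_def)
    have dom: "(\<exists>v<n. a' 1 v = j \<and> a' 10 v = j) \<longleftrightarrow> (\<exists>v. dominates (a 1) j v)"
      using I by (auto simp: I_def dominates_def a1)
    show "ok ?body r' a' (50 * n + 80 * m + 60) (I (Suc j))"
    proof (rule ok_Seq[OF ok_frame[OF find_dom_ok[OF env']], where \<sigma> = "80 * m + 30"])
      fix r2 a2
      assume 2: "((r2 39 \<noteq> 0) = (\<exists>v<n. a' 1 v = r' 20 \<and> a' 10 v = r' 20)) \<and>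
        same_outside (mods find_dom) r2 r' \<and> same_outside (arrs find_dom) a2 a'"
      have r2: "r2 38 = r' 38" "r2 20 = j" "a2 = a'" and env2: "env r2 a2"
        using 2 j env' by (auto simp: same_outside_def find_dom_def env_def)
      have d2: "r2 39 \<noteq> 0 \<longleftrightarrow> (\<exists>v. dominates (a 1) j v)" using 2 dom j by simp
      show "ok (Cond 39 Skip (Const 38 0) ;; raise_levels) r2 a2 (80 * m + 30) (I (Suc j))"
      proof (rule ok_Seq[where \<sigma> = "80 * m + 20" and \<rho> = 2])
        show "ok (Cond 39 Skip (Const 38 0)) r2 a2 2 (\<lambda>r3 a3. a3 = a2 \<and> env r3 a3 \<and> r3 20 = j \<and>
            (r3 38 \<noteq> 0 \<longleftrightarrow> r2 38 \<noteq> 0 \<and> (\<exists>v. dominates (a 1) j v)))"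
          using env2 r2 d2 by (intro ok_wp) (auto simp: env_def)
      next
        fix r3 a3
        assume 3: "a3 = a2 \<and> env r3 a3 \<and> r3 20 = j \<and>
            (r3 38 \<noteq> 0 \<longleftrightarrow> r2 38 \<noteq> 0 \<and> (\<exists>v. dominates (a 1) j v))"
        show "ok raise_levels r3 a3 (80 * m + 20) (I (Suc j))"
        proof (rule ok_conseq_frame[OF raise_levels_ok[of r3 a3]])
          fix r4 and a4 :: arrays
          assume 4: "a4 10 = (\<lambda>v. if a3 10 v = r3 20 \<and> (\<exists>u. adj u v \<and> a3 1 u = r3 20)
            then Suc (r3 20) else a3 10 v)" "same_outside (mods raise_levels) r4 r3"
          have "r4 38 = r3 38"
            using same_outsideD[OF 4(2)] by (auto simp: raise_levels_def raise_level_def)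
          then have "r4 38 \<noteq> 0 \<longleftrightarrow> (\<forall>i<Suc j. \<exists>v. dominates (a 1) i v)"
            using 3 I r2 unfolding I_def by (auto simp: less_Suc_eq)
          moreover have "a4 10 v \<le> Suc j \<and> (a4 10 v = Suc j \<longleftrightarrow> (\<forall>i<Suc j. \<exists>u. adj u v \<and> a 1 u = i))"
            if "v < n" for v
          proof -
            have "a' 10 v \<le> j" "a' 10 v = j \<longleftrightarrow> (\<forall>i<j. \<exists>u. adj u v \<and> a 1 u = i)"
              using I that unfolding I_def by auto
            moreover have "a4 10 v = (if a' 10 v = j \<and> (\<exists>u. adj u v \<and> a 1 u = j) then Suc j else a' 10 v)"
              using 4(1) 3 r2(3) a1 by simp
            ultimately show ?thesis unfolding less_Suc_eq by auto
          qed
          ultimately show "I (Suc j) r4 a4" unfolding I_def by blast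
        qed (use 3 in auto)
      qed simp
    qed (use j in auto)
  qed (use envD[OF env] lev in \<open>auto simp: algebra_simps I_def find_dom_def raise_levels_def raise_level_def\<close>)
  then have *: "ok (For 20 1 ?body) (r(38 := 1)) a (k * (50 * n + 80 * m + 80) + 10) (I k)"
    using envD[OF env] by simp
  show ?thesis unfolding check_def
  proof (rule ok_Seq_wp, unfold wp.simps, rule ok_conseq[OF *])
  qed (auto simp: I_def)
qed

end

section \<open>Peeling by linked lists and a queue\<close>

text \<open>The list of a vertex runs through its entries in decreasing order, so the rest of a list is
  determined by its first entry.\<close>

definition lists_inv :: "nat set \<Rightarrow> (nat \<Rightarrow> nat) \<Rightarrow> (nat \<Rightarrow> nat) \<Rightarrow> nat \<Rightarrow> (nat \<Rightarrow> nat) \<Rightarrow> (nat \<Rightarrow> nat) \<Rightarrow>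
    (nat \<Rightarrow> nat) \<Rightarrow> (nat \<Rightarrow> nat) \<Rightarrow> bool" where
  "lists_inv S own par n first nx to dg \<longleftrightarrow>
     (\<forall>v<n. first v = Max (insert 0 {q \<in> S. own q = v})) \<and>
     (\<forall>q\<in>S. nx q = Max (insert 0 {q' \<in> S. own q' = own q \<and> q' < q}) \<and> to q = par q) \<and>
     (\<forall>v<n. dg v = card {q \<in> S. par q = v})"

text \<open>Entries are inserted with increasing numbers, so the newest is the maximum of its list
  and becomes its head, with the old head as successor. The lists of other vertices do not
  change.\<close>

lemma lists_inv_insert:
  assumes "lists_inv S own par n first nx to dg" "finite S" "\<And>q. q \<in> S \<Longrightarrow> q < p"
    "own p < n" "par p < n"
  shows "lists_inv (insert p S) own par n (first(own p := p)) (nx(p := first (own p))) (to(p := par p))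
    (dg(par p := Suc (dg (par p))))"
proof -
  have p: "p \<notin> S" using assms(3) by auto
  have 1: "(first(own p := p)) v = Max (insert 0 {q \<in> insert p S. own q = v})" if "v < n" for v
  proof (cases "v = own p")
    case True
    have "Max (insert 0 {q \<in> insert p S. own q = v}) = p"
      using True assms(2,3) by (intro Max_eqI) (auto intro: less_imp_le)
    then show ?thesis using True by simp
  next
    case False
    then have "{q \<in> insert p S. own q = v} = {q \<in> S. own q = v}" by auto
    then show ?thesis using False assms(1) that by (simp add: lists_inv_def)
  qed
  have 2: "(nx(p := first (own p))) q = Max (insert 0 {q' \<in> insert p S. own q' = own q \<and> q' < q}) \<and>
      (to(p := par p)) q = par q" if q: "q \<in> insert p S" for q
  proof (cases "q = p")
    case True
    then have "{q' \<in> insert p S. own q' = own q \<and> q' < q} = {q' \<in> S. own q' = own p}"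
      using assms(3) by auto
    then show ?thesis using True assms(1,4) by (simp add: lists_inv_def)
  next
    case False
    then have qS: "q \<in> S" using q by simp
    then have "q < p" by (rule assms(3))
    then have "{q' \<in> insert p S. own q' = own q \<and> q' < q} = {q' \<in> S. own q' = own q \<and> q' < q}"
      by auto
    then show ?thesis using False assms(1) qS by (simp add: lists_inv_def)
  qed
  have 3: "(dg(par p := Suc (dg (par p)))) v = card {q \<in> insert p S. par q = v}" if "v < n" for v
  proof (cases "v = par p")
    case True
    then have "{q \<in> insert p S. par q = v} = insert p {q \<in> S. par q = v}" by auto
    then show ?thesis using True assms(1,2,5) p by (simp add: lists_inv_def)
  next
    case False
    then have "{q \<in> insert p S. par q = v} = {q \<in> S. par q = v}" by auto
    then show ?thesis using False assms(1) that by (simp add: lists_inv_def)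
  qed
  show ?thesis unfolding lists_inv_def using 1 2 3 by blast
qed

text \<open>An entry \<open>q\<close> lies in the list of vertex \<open>own q\<close> and points to
  \<open>par q\<close>. Entries are positive, so \<open>0\<close> can mean the end of a list, in
  agreement with \<open>Max (insert 0 ...)\<close>.\<close>

locale peeling =
  fixes S :: "nat set" and own par :: "nat \<Rightarrow> nat" and n d :: nat
  assumes fin: "finite S" and S: "\<And>q. q \<in> S \<Longrightarrow> 0 < q \<and> own q < n \<and> par q < n"
begin

text \<open>The vertices \<open>Qu 0, \<dots>, Qu (h - 1)\<close> have been taken from the queue, and the list of the last
  one has been processed down to, but excluding, entry \<open>p\<close>.\<close>

definition pending :: "nat \<Rightarrow> nat \<Rightarrow> (nat \<Rightarrow> nat) \<Rightarrow> nat set" where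
  "pending h p Qu = {q \<in> S. own q \<notin> Qu ` {..<h} \<or> (0 < h \<and> own q = Qu (h - 1) \<and> q \<le> p)}"

text \<open>The count concerns entries that point to \<open>Qu i\<close> from vertices not among the
  first \<open>i + 1\<close> of the queue. When all vertices have been queued, these are its
  out-neighbours, so the queue order is the orientation.\<close>

definition queue_ok :: "nat \<Rightarrow> (nat \<Rightarrow> nat) \<Rightarrow> (nat \<Rightarrow> nat) \<Rightarrow> bool" where
  "queue_ok t Qu pos \<longleftrightarrow> (\<forall>i<t. Qu i < n \<and> pos (Qu i) = i \<and>
     card {q \<in> S. par q = Qu i \<and> own q \<notin> Qu ` {..i}} \<le> d)"

text \<open>Degrees count pending entries only, and a vertex is queued exactly when its degree is at
  most \<open>d\<close>. The last conjunct is a clock: every pass has taken a vertex or processed an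
  entry, until nothing is left and the passes idle.\<close>

definition peel_inv :: "nat \<Rightarrow> nat \<Rightarrow> nat \<Rightarrow> nat \<Rightarrow> (nat \<Rightarrow> nat) \<Rightarrow> (nat \<Rightarrow> nat) \<Rightarrow> (nat \<Rightarrow> nat) \<Rightarrow> bool" where
  "peel_inv j h t p Qu pos dg \<longleftrightarrow> h \<le> t \<and> queue_ok t Qu pos \<and>
     (p = 0 \<or> p \<in> S \<and> 0 < h \<and> own p = Qu (h - 1)) \<and>
     (\<forall>v<n. dg v = card {q \<in> pending h p Qu. par q = v}) \<and>
     (\<forall>v<n. v \<in> Qu ` {..<t} \<longleftrightarrow> dg v \<le> d) \<and>
     ((p = 0 \<and> h = t) \<or> j = h + card (S - pending h p Qu))"

lemma pending_subset: "pending h p Qu \<subseteq> S" by (auto simp: pending_def)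

lemma pending_zero: "pending h 0 Qu = {q \<in> S. own q \<notin> Qu ` {..<h}}"
  using S by (fastforce simp: pending_def)

lemma queue_ok_enqueue:
  assumes "queue_ok t Qu pos" "u < n" "u \<notin> Qu ` {..<t}"
    "card {q \<in> S. par q = u \<and> own q \<notin> Qu ` {..<t}} \<le> d"
  shows "queue_ok (Suc t) (Qu(t := u)) (pos(u := t))"
  unfolding queue_ok_def
proof (intro allI impI)
  fix i assume i: "i < Suc t"
  let ?Q = "Qu(t := u)"
  show "?Q i < n \<and> (pos(u := t)) (?Q i) = i \<and> card {q \<in> S. par q = ?Q i \<and> own q \<notin> ?Q ` {..i}} \<le> d"
  proof (cases "i = t")
    case True
    have "card {q \<in> S. par q = u \<and> own q \<notin> ?Q ` {..t}} \<le> card {q \<in> S. par q = u \<and> own q \<notin> Qu ` {..<t}}"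
      by (rule card_mono) (use fin in \<open>auto simp: image_iff\<close>)
    then show ?thesis using True assms by auto
  next
    case False
    then have "i < t" using i by simp
    then have "?Q ` {..i} = Qu ` {..i}" "?Q i = Qu i" by (auto intro!: image_cong)
    moreover have "Qu i \<noteq> u" using assms(3) \<open>i < t\<close> by auto
    ultimately show ?thesis using assms(1) \<open>i < t\<close> by (simp add: queue_ok_def)
  qed
qed

lemma image_enqueue: "(Qu(t := u)) ` {..<Suc t} = insert u (Qu ` {..<t})"
  by (auto simp: lessThan_Suc)

lemma queue_ok_inj: "queue_ok t Qu pos \<Longrightarrow> inj_on Qu {..<t}"
  by (rule inj_onI) (metis lessThan_iff queue_ok_def)

lemma queue_ok_le: "queue_ok t Qu pos \<Longrightarrow> t \<le> n"
proof -
  assume q: "queue_ok t Qu pos"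
  have "card (Qu ` {..<t}) \<le> card {..<n}"
    by (rule card_mono) (use q in \<open>auto simp: queue_ok_def\<close>)
  then show ?thesis using card_image[OF queue_ok_inj[OF q]] by simp
qed

lemma pending_next:
  assumes pS: "p \<in> S" "0 < h" "own p = Qu (h - 1)"
    and p': "p' = Max (insert 0 {q \<in> S. own q = own p \<and> q < p})"
  shows "pending h p' Qu = pending h p Qu - {p}" "p' = 0 \<or> p' \<in> S \<and> own p' = own p"
proof -
  let ?X = "{q \<in> S. own q = own p \<and> q < p}"
  have finX: "finite ?X" using fin by simp
  have p'le: "q \<le> p'" if "q \<in> ?X" for q unfolding p' using that finX by (intro Max_ge) auto
  have p'in: "p' = 0 \<or> p' \<in> ?X"
    using Max_in[of "insert 0 ?X"] finX unfolding p' by blast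
  then show "p' = 0 \<or> p' \<in> S \<and> own p' = own p" by blast
  have popped: "own p \<in> Qu ` {..<h}" unfolding pS(3) by (rule imageI) (use pS(2) in simp)
  show "pending h p' Qu = pending h p Qu - {p}"
  proof (intro set_eqI iffI)
    fix q assume "q \<in> pending h p' Qu"
    then consider "q \<in> S" "own q \<notin> Qu ` {..<h}" | "q \<in> S" "own q = Qu (h - 1)" "q \<le> p'"
      unfolding pending_def by blast
    then show "q \<in> pending h p Qu - {p}"
    proof cases
      case 1
      then have "q \<noteq> p" using popped by blast
      then show ?thesis using 1 by (simp add: pending_def)
    next
      case 2
      then have "p' \<noteq> 0" using S[of q] by simp
      then have "q < p" using p'in 2(3) by auto
      then show ?thesis using 2 pS by (simp add: pending_def)
    qed
  next
    fix q assume q: "q \<in> pending h p Qu - {p}"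
    show "q \<in> pending h p' Qu"
    proof (cases "own q \<in> Qu ` {..<h}")
      case False
      then show ?thesis using q by (simp add: pending_def)
    next
      case True
      then have q': "q \<in> S" "own q = Qu (h - 1)" "q \<le> p" "q \<noteq> p"
        using q unfolding pending_def by blast+
      then have "q \<le> p'" using pS(3) by (intro p'le) simp
      then show ?thesis unfolding pending_def using q' pS(2) by blast
    qed
  qed
qed

lemma pending_enqueue: "0 < h \<Longrightarrow> h \<le> t \<Longrightarrow> pending h p (Qu(t := u)) = pending h p Qu"
proof -
  assume h: "0 < h" "h \<le> t"
  have "(Qu(t := u)) ` {..<h} = Qu ` {..<h}" using h by (intro image_cong) auto
  moreover have "h - 1 \<noteq> t" using h by linarith
  then have "(Qu(t := u)) (h - 1) = Qu (h - 1)" by simp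
  ultimately show ?thesis by (simp add: pending_def)
qed

text \<open>Degrees only decrease, by one at a time, so each of them drops from \<open>d + 1\<close>
  to \<open>d\<close> at most once. Testing for equality with \<open>d\<close> therefore queues no
  vertex twice.\<close>

lemma peel_entry:
  assumes inv: "peel_inv j h t p Qu pos dg" and p: "p \<noteq> 0"
    and p': "p' = Max (insert 0 {q \<in> S. own q = own p \<and> q < p})"
    and u: "u = par p"
  shows "dg u - 1 = d \<Longrightarrow>
      peel_inv (Suc j) h (Suc t) p' (Qu(t := u)) (pos(u := t)) (dg(u := dg u - 1))"
    and "dg u - 1 \<noteq> d \<Longrightarrow> peel_inv (Suc j) h t p' Qu pos (dg(u := dg u - 1))"
proof -
  note I = inv[unfolded peel_inv_def]
  have pS: "p \<in> S" "0 < h" "own p = Qu (h - 1)" and ht: "h \<le> t" and qok: "queue_ok t Qu pos"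
    and cnt: "j = h + card (S - pending h p Qu)"
    using I p by blast+
  have dg: "dg v = card {q \<in> pending h p Qu. par q = v}" if "v < n" for v using I that by blast
  have enq: "v \<in> Qu ` {..<t} \<longleftrightarrow> dg v \<le> d" if "v < n" for v using I that by blast
  have un: "u < n" using S[OF pS(1)] u by simp
  note pend = pending_next(1)[of p h Qu, OF pS p']
  have ptr: "p' = 0 \<or> p' \<in> S \<and> 0 < h \<and> own p' = Qu (h - 1)"
    using pending_next(2)[of p h Qu, OF pS p'] pS by simp
  have pin: "p \<in> pending h p Qu" using pS by (simp add: pending_def)
  have finp: "finite (pending h p Qu)" by (rule finite_subset[OF pending_subset fin])
  have "{q \<in> pending h p Qu. par q = u} = insert p {q \<in> pending h p' Qu. par q = u}"
    using pin u pend by auto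
  moreover have "p \<notin> {q \<in> pending h p' Qu. par q = u}" using pend by simp
  \<comment> \<open>The entry \<open>p\<close> is itself pending and points to \<open>u\<close>, so
    the degree of \<open>u\<close> is positive and the truncated subtraction is exact.\<close>
  ultimately have dgu: "dg u = Suc (card {q \<in> pending h p' Qu. par q = u})"
    using dg[OF un] finp pend by simp
  have dg': "(dg(u := dg u - 1)) v = card {q \<in> pending h p' Qu. par q = v}" if "v < n" for v
  proof (cases "v = u")
    case False
    then have "{q \<in> pending h p' Qu. par q = v} = {q \<in> pending h p Qu. par q = v}"
      using pend u by auto
    then show ?thesis using False dg[OF that] by simp
  qed (use dgu in simp)
  have "S - pending h p' Qu = insert p (S - pending h p Qu)" using pend pS(1) by auto
  then have cnt': "Suc j = h + card (S - pending h p' Qu)"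
    using cnt pin fin by (simp add: card_insert_if)
  show "peel_inv (Suc j) h (Suc t) p' (Qu(t := u)) (pos(u := t)) (dg(u := dg u - 1))"
    if d: "dg u - 1 = d"
  proof -
    have unq: "u \<notin> Qu ` {..<t}" using enq[OF un] dgu d by simp
    \<comment> \<open>Vertices outside the queue have not been taken from it, as
      \<open>h <= t\<close>, so all their entries are pending and counted in the degree of
      \<open>u\<close>.\<close>
    have "card {q \<in> S. par q = u \<and> own q \<notin> Qu ` {..<t}} \<le> card {q \<in> pending h p' Qu. par q = u}"
    proof (rule card_mono)
      show "finite {q \<in> pending h p' Qu. par q = u}" using finp pend by simp
      have "Qu ` {..<h} \<subseteq> Qu ` {..<t}" using ht by (intro image_mono) auto
      then show "{q \<in> S. par q = u \<and> own q \<notin> Qu ` {..<t}} \<subseteq> {q \<in> pending h p' Qu. par q = u}"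
        unfolding pending_def by blast
    qed
    then have "queue_ok (Suc t) (Qu(t := u)) (pos(u := t))"
      using queue_ok_enqueue[OF qok un unq] dgu d by simp
    moreover have "p' = 0 \<or> p' \<in> S \<and> 0 < h \<and> own p' = (Qu(t := u)) (h - 1)"
    proof -
      have "h - 1 \<noteq> t" using ht pS(2) by linarith
      then show ?thesis using ptr by simp
    qed
    moreover have "v \<in> (Qu(t := u)) ` {..<Suc t} \<longleftrightarrow> (dg(u := dg u - 1)) v \<le> d" if "v < n" for v
      unfolding image_enqueue using enq[OF that] d by simp
    moreover have "h \<le> Suc t" using ht by simp
    ultimately show ?thesis
      unfolding peel_inv_def pending_enqueue[OF pS(2) ht] using dg' cnt' by blast
  qed
  show "peel_inv (Suc j) h t p' Qu pos (dg(u := dg u - 1))" if d: "dg u - 1 \<noteq> d"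
  proof -
    have "v \<in> Qu ` {..<t} \<longleftrightarrow> (dg(u := dg u - 1)) v \<le> d" if "v < n" for v
      using enq[OF that] d dgu by (cases "v = u") auto
    then show ?thesis
      unfolding peel_inv_def using ht qok ptr dg' cnt' by blast
  qed
qed

lemma peel_pop:
  assumes inv: "peel_inv j h t 0 Qu pos dg" and ht: "h < t"
    and p': "p' = Max (insert 0 {q \<in> S. own q = Qu h})"
  shows "peel_inv (Suc j) (Suc h) t p' Qu pos dg"
proof -
  have qok: "queue_ok t Qu pos"
    and dg: "\<And>v. v < n \<Longrightarrow> dg v = card {q \<in> pending h 0 Qu. par q = v}"
    and enq: "\<And>v. v < n \<Longrightarrow> v \<in> Qu ` {..<t} \<longleftrightarrow> dg v \<le> d"
    and cnt: "j = h + card (S - pending h 0 Qu)"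
    using inv ht by (auto simp: peel_inv_def)
  let ?X = "{q \<in> S. own q = Qu h}"
  have finX: "finite ?X" using fin by simp
  have p'le: "q \<le> p'" if "q \<in> ?X" for q unfolding p' using that finX by (intro Max_ge) auto
  have p'in: "p' = 0 \<or> p' \<in> ?X"
    using Max_in[of "insert 0 ?X"] finX unfolding p' by blast
  have new: "Qu h \<notin> Qu ` {..<h}"
  proof
    assume "Qu h \<in> Qu ` {..<h}"
    then obtain i where "i < h" "Qu h = Qu i" by auto
    then show False using inj_onD[OF queue_ok_inj[OF qok], of h i] ht by auto
  qed
  \<comment> \<open>Taking \<open>Qu h\<close> moves its entries from the first alternative of
    \<open>pending\<close> to the second; with \<open>p'\<close> the largest of them, none is
    lost.\<close>
  have "pending (Suc h) p' Qu = pending h 0 Qu"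
  proof (intro set_eqI iffI)
    fix q assume "q \<in> pending (Suc h) p' Qu"
    then have q: "q \<in> S" "own q \<notin> Qu ` {..<Suc h} \<or> own q = Qu h" by (auto simp: pending_def)
    then have "own q \<notin> Qu ` {..<h}" using new by auto
    then show "q \<in> pending h 0 Qu" using q(1) by (simp add: pending_def)
  next
    fix q assume "q \<in> pending h 0 Qu"
    then have q: "q \<in> S" "own q \<notin> Qu ` {..<h}" by (auto simp: pending_zero)
    then show "q \<in> pending (Suc h) p' Qu"
      using p'le[of q] by (cases "own q = Qu h") (auto simp: pending_def lessThan_Suc)
  qed
  then show ?thesis unfolding peel_inv_def using qok dg enq cnt ht p'in by auto
qed

text \<open>At most \<open>n\<close> vertices can be taken and at most \<open>N\<close> entries
  processed. A clock still running after \<open>n + N\<close> passes means that both are exhausted;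
  but then a nonzero pointer would be a pending entry, although none is pending.\<close>

lemma peel_done:
  assumes "peel_inv (n + N) h t p Qu pos dg" "card S \<le> N"
  shows "p = 0 \<and> h = t"
proof (rule ccontr)
  assume not: "\<not> (p = 0 \<and> h = t)"
  then have cnt: "n + N = h + card (S - pending h p Qu)" and ht: "h \<le> t" and q: "queue_ok t Qu pos"
    and ptr: "p = 0 \<or> p \<in> S \<and> 0 < h \<and> own p = Qu (h - 1)"
    using assms(1) by (auto simp: peel_inv_def)
  have "t \<le> n" by (rule queue_ok_le[OF q])
  moreover have "card (S - pending h p Qu) \<le> card S" by (rule card_mono) (use fin in auto)
  ultimately have h: "h = t" "card (S - pending h p Qu) = card S" using cnt ht assms(2) by auto
  then have "S - pending h p Qu = S" using fin by (intro card_subset_eq) auto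
  then have "p \<notin> pending h p Qu" if "p \<in> S" using that by auto
  moreover have "p \<in> S" "p \<in> pending h p Qu" using ptr not h(1) by (auto simp: pending_def)
  ultimately show False by blast
qed

text \<open>Were some vertices never queued, one of them would have at most \<open>d\<close>
  neighbours among them. With the queue exhausted, exactly these neighbours make up its degree, so
  it would have been queued. Hence \<open>pos\<close> inverts \<open>Qu\<close> on all
  vertices.\<close>

lemma peel_complete:
  assumes inv: "peel_inv j t t 0 Qu pos dg"
    and core: "\<And>X. X \<subseteq> {..<n} \<Longrightarrow> X \<noteq> {} \<Longrightarrow> \<exists>x\<in>X. card {q \<in> S. par q = x \<and> own q \<in> X} \<le> d"
  shows "inj_on pos {..<n}" "v < n \<Longrightarrow> card {q \<in> S. par q = v \<and> pos v < pos (own q)} \<le> d"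
proof -
  have qok: "queue_ok t Qu pos"
    and dg: "\<And>v. v < n \<Longrightarrow> dg v = card {q \<in> S. own q \<notin> Qu ` {..<t} \<and> par q = v}"
    and enq: "\<And>v. v < n \<Longrightarrow> v \<in> Qu ` {..<t} \<longleftrightarrow> dg v \<le> d"
    using inv by (auto simp: peel_inv_def pending_zero)
  have all: "Qu ` {..<t} = {..<n}"
  proof (rule ccontr)
    assume ne: "Qu ` {..<t} \<noteq> {..<n}"
    define X where "X = {..<n} - Qu ` {..<t}"
    have "Qu ` {..<t} \<subseteq> {..<n}" using qok by (auto simp: queue_ok_def)
    then have "X \<noteq> {}" using ne by (auto simp: X_def)
    then obtain x where x: "x \<in> X" "card {q \<in> S. par q = x \<and> own q \<in> X} \<le> d"
      using core[of X] by (auto simp: X_def)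
    have "{q \<in> S. par q = x \<and> own q \<in> X} = {q \<in> S. own q \<notin> Qu ` {..<t} \<and> par q = x}"
      using S by (auto simp: X_def)
    then have "dg x \<le> d" using dg[of x] x by (simp add: X_def)
    then show False using enq[of x] x(1) by (auto simp: X_def)
  qed
  have Qpos: "pos v < t \<and> Qu (pos v) = v" if "v < n" for v
  proof -
    have "v \<in> Qu ` {..<t}" using all that by simp
    then obtain i where "i < t" "v = Qu i" by auto
    then show ?thesis using qok by (auto simp: queue_ok_def)
  qed
  show "inj_on pos {..<n}" by (rule inj_onI) (metis Qpos lessThan_iff)
  show "card {q \<in> S. par q = v \<and> pos v < pos (own q)} \<le> d" if v: "v < n"
  proof -
    have "card {q \<in> S. par q = v \<and> pos v < pos (own q)}
        \<le> card {q \<in> S. par q = Qu (pos v) \<and> own q \<notin> Qu ` {..pos v}}"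
    proof (rule card_mono)
      show "finite {q \<in> S. par q = Qu (pos v) \<and> own q \<notin> Qu ` {..pos v}}" using fin by simp
      show "{q \<in> S. par q = v \<and> pos v < pos (own q)}
          \<subseteq> {q \<in> S. par q = Qu (pos v) \<and> own q \<notin> Qu ` {..pos v}}"
      proof
        fix q assume q: "q \<in> {q \<in> S. par q = v \<and> pos v < pos (own q)}"
        have "own q \<notin> Qu ` {..pos v}"
        proof
          assume "own q \<in> Qu ` {..pos v}"
          then obtain i where "i \<le> pos v" "own q = Qu i" by auto
          moreover have "pos (Qu i) = i" using qok \<open>i \<le> pos v\<close> Qpos[OF v] by (auto simp: queue_ok_def)
          ultimately show False using q by simp
        qed
        then show "q \<in> {q \<in> S. par q = Qu (pos v) \<and> own q \<notin> Qu ` {..pos v}}"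
          using q Qpos[OF v] by simp
      qed
    qed
    also have "\<dots> \<le> d" using qok Qpos[OF v] unfolding queue_ok_def by blast
    finally show ?thesis .
  qed
qed

end

section \<open>Peeling the monochromatic edges of the input\<close>

context spgc_input
begin

definition same_class :: "(nat \<Rightarrow> nat) \<Rightarrow> nat \<Rightarrow> bool" where
  "same_class col e \<longleftrightarrow> col (eu e) = col (ev e) \<and> col (eu e) \<noteq> k - 1"

text \<open>Edge \<open>e\<close> gives two list entries, named by the input positions of its end points; the entry
  \<open>q\<close> belongs to the list of vertex \<open>inp q\<close> and points to the other end point \<open>mate q\<close>.\<close>

definition entries :: "(nat \<Rightarrow> nat) \<Rightarrow> nat \<Rightarrow> nat set" where
  "entries col j = {q. \<exists>e<j. same_class col e \<and> (q = 5 + 2 * e \<or> q = 6 + 2 * e)}"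

definition mate :: "nat \<Rightarrow> nat" where
  "mate q = inp (if odd q then Suc q else q - 1)"

text \<open>The edges start at input position 5, so first end points stand at odd positions and
  second ones at even positions.\<close>

lemma mate_edge [simp]:
  assumes "e < m"
  shows "mate (5 + 2 * e) = ev e" "mate (6 + 2 * e) = eu e"
proof -
  have "Suc (5 + 2 * e) = 6 + 2 * e" "6 + 2 * e - 1 = 5 + 2 * e" by auto
  then show "mate (5 + 2 * e) = ev e" "mate (6 + 2 * e) = eu e"
    using inp_edge[OF assms] unfolding mate_def by (simp_all del: inp_edge)
qed

lemma entries_Suc:
  "entries col (Suc j) =
    (if same_class col j then insert (6 + 2 * j) (insert (5 + 2 * j) (entries col j)) else entries col j)"
  by (auto simp: entries_def less_Suc_eq)

lemma entries_bounds: "q \<in> entries col j \<Longrightarrow> 5 \<le> q \<and> q < 5 + 2 * j"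
  by (auto simp: entries_def)

lemma finite_entries: "finite (entries col j)"
  by (rule finite_subset[of _ "{..<5 + 2 * j}"]) (use entries_bounds in auto)

lemma card_entries: "card (entries col j) \<le> 2 * j"
proof -
  have "card (entries col j) \<le> card {5..<5 + 2 * j}"
    by (rule card_mono) (use entries_bounds in auto)
  then show ?thesis by simp
qed

lemma entries_cases:
  assumes "q \<in> entries col m"
  obtains e where "e < m" "same_class col e" "q = 5 + 2 * e" "inp q = eu e" "mate q = ev e"
  | e where "e < m" "same_class col e" "q = 6 + 2 * e" "inp q = ev e" "mate q = eu e"
  using assms inp_edge mate_edge by (auto simp: entries_def)

interpretation P: peeling "entries col m" inp mate n d for col
proof
  show "finite (entries col m)" by (rule finite_entries)
  show "0 < q \<and> inp q < n \<and> mate q < n" if "q \<in> entries col m" for q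
    using that by (rule entries_cases) (use eu_ev_less in auto)
qed

text \<open>The assumption on \<open>col\<close> says that monochromatic edges below color
  \<open>k - 1\<close> avoid the bicliques, so degeneracy applies to them; it remains to pass from
  edges to list entries.\<close>

lemma entries_core:
  assumes col: "\<And>t u v. t < l \<Longrightarrow> u \<in> set (ls t) \<Longrightarrow> v \<in> set (rs t) \<Longrightarrow> col u = col v \<Longrightarrow> col u = k - 1"
    and X: "X \<subseteq> {..<n}" "X \<noteq> {}"
  shows "\<exists>x\<in>X. card {q \<in> entries col m. mate q = x \<and> inp q \<in> X} \<le> d"
proof -
  let ?M = "{e. e < m \<and> same_class col e}"
  have "\<exists>x\<in>X. card {e \<in> ?M. (eu e = x \<and> ev e \<in> X) \<or> (ev e = x \<and> eu e \<in> X)} \<le> d"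
    by (rule degenerate_index[OF _ _ _ X]) (use col in \<open>auto simp: same_class_def\<close>)
  then obtain x where x: "x \<in> X"
    "card {e \<in> ?M. (eu e = x \<and> ev e \<in> X) \<or> (ev e = x \<and> eu e \<in> X)} \<le> d" by blast
  let ?Q = "{q \<in> entries col m. mate q = x \<and> inp q \<in> X}"
  let ?f = "\<lambda>q. (q - 5) div 2"
  have f: "?f (5 + 2 * e) = e" "?f (6 + 2 * e) = e" for e :: nat by auto
  \<comment> \<open>The two entries of an edge point to different vertices, so at most one of them
    points to \<open>x\<close>, and the edge determines the entry.\<close>
  have "inj_on ?f ?Q"
  proof (rule inj_onI)
    fix q q' assume q: "q \<in> ?Q" "q' \<in> ?Q" "?f q = ?f q'"
    have "q \<in> entries col m" "q' \<in> entries col m" using q by auto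
    then show "q = q'"
    proof (elim entries_cases)
    qed (use q eu_neq_ev eu_neq_ev[THEN not_sym] f in auto)
  qed
  then have "card ?Q = card (?f ` ?Q)" by (simp add: card_image)
  also have "\<dots> \<le> card {e \<in> ?M. (eu e = x \<and> ev e \<in> X) \<or> (ev e = x \<and> eu e \<in> X)}"
  proof (rule card_mono)
    show "?f ` ?Q \<subseteq> {e \<in> ?M. (eu e = x \<and> ev e \<in> X) \<or> (ev e = x \<and> eu e \<in> X)}"
    proof
      fix e assume "e \<in> ?f ` ?Q"
      then obtain q where q: "q \<in> entries col m" "mate q = x" "inp q \<in> X" "e = ?f q" by auto
      from q(1) show "e \<in> {e \<in> ?M. (eu e = x \<and> ev e \<in> X) \<or> (ev e = x \<and> eu e \<in> X)}"
        by (rule entries_cases) (use q f in auto)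
    qed
  qed simp
  finally show ?thesis using x by (intro bexI[of _ x]) auto
qed

lemma build_lists_ok:
  assumes env: "env r a" and z: "\<forall>v<n. a 4 v = 0 \<and> a 7 v = 0"
  shows "ok build_lists r a (m * 90 + 20)
    (\<lambda>r' a'. lists_inv (entries (a 1) m) inp mate n (a' 4) (a' 5) (a' 6) (a' 7))"
proof -
  define I where "I = (\<lambda>j (r'::regs) (a'::arrays). r' 22 = 5 + 2 * j \<and>
    lists_inv (entries (a 1) j) inp mate n (a' 4) (a' 5) (a' 6) (a' 7))"
  let ?body = "Const 28 1 ;; Load 23 0 22 ;; Add 24 22 28 ;; Load 25 0 24 ;;
     Load 26 1 23 ;; Load 27 1 25 ;;
     IfEq 26 27 (IfEq 26 6 Skip (add_entry 22 23 25 ;; add_entry 24 25 23)) Skip ;;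
     Add 22 24 28"
  have "ok (For 20 5 ?body) (r(22 := 5)) a (m * 90 + 10) (I ((r(22 := 5)) 5))"
  proof (rule ok_For[where \<tau> = 80])
    fix j r' a'
    assume j: "j < (r(22 := 5)) 5" and so: "same_outside ({20, 29} \<union> mods ?body) r' (r(22 := 5))"
      "same_outside (arrs ?body) a' a" and I: "I j r' a'"
    have r': "r' 6 = k - 1" and a': "a' 0 = inp" "a' 1 = a 1"
      using same_outsideD[OF so(1)] same_outsideD[OF so(2)] envD[OF env]
      by (auto simp: add_entry_def)
    have jm: "j < m" using j envD[OF env] by simp
    have e: "inp (5 + 2 * j) = eu j" "inp (6 + 2 * j) = ev j" "eu j \<noteq> ev j" "ev j \<noteq> eu j"
      using inp_edge[OF jm] eu_neq_ev[OF jm] by auto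
    have I22: "r' 22 = 5 + 2 * j" and
      L: "lists_inv (entries (a 1) j) inp mate n (a' 4) (a' 5) (a' 6) (a' 7)"
      using I unfolding I_def by blast+
    let ?p = "5 + 2 * j" and ?q = "6 + 2 * j"
    let ?Q = "\<lambda>r1 a1. r1 22 = 7 + 2 * j \<and> (if same_class (a 1) j
      then a1 4 = (a' 4)(eu j := ?p, ev j := ?q) \<and> a1 5 = (a' 5)(?p := a' 4 (eu j), ?q := a' 4 (ev j)) \<and>
        a1 6 = (a' 6)(?p := ev j, ?q := eu j) \<and>
        a1 7 = (a' 7)(ev j := Suc (a' 7 (ev j)), eu j := Suc (a' 7 (eu j)))
      else a1 = a')"
    have "wp ?body ?Q r' a'"
      by (simp add: I22 r' a' e add_entry_def same_class_def Suc_eq_plus1)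
    moreover have "tm ?body \<le> 80" by (simp add: add_entry_def)
    ultimately have "ok ?body r' a' 80 ?Q" by (rule ok_wp[rotated])
    then show "ok ?body r' a' 80 (I (Suc j))"
    proof (rule ok_conseq)
      fix r1 :: regs and a1 :: arrays assume Q: "?Q r1 a1"
      show "I (Suc j) r1 a1"
      proof (cases "same_class (a 1) j")
        case False
        then show ?thesis using Q L by (simp add: I_def entries_Suc)
      next
        case True
        have 1: "lists_inv (insert ?p (entries (a 1) j)) inp mate n ((a' 4)(eu j := ?p))
          ((a' 5)(?p := a' 4 (eu j))) ((a' 6)(?p := ev j)) ((a' 7)(ev j := Suc (a' 7 (ev j))))"
          using lists_inv_insert[OF L finite_entries, of ?p] entries_bounds[of _ "a 1" j]
            eu_ev_less[OF jm] mate_edge[OF jm] e by simp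
        have 2: "lists_inv (insert ?q (insert ?p (entries (a 1) j))) inp mate n
          ((a' 4)(eu j := ?p, ev j := ?q)) ((a' 5)(?p := a' 4 (eu j), ?q := a' 4 (ev j)))
          ((a' 6)(?p := ev j, ?q := eu j)) ((a' 7)(ev j := Suc (a' 7 (ev j)), eu j := Suc (a' 7 (eu j))))"
          using lists_inv_insert[OF 1, of ?q] entries_bounds[of _ "a 1" j]
            eu_ev_less[OF jm] mate_edge[OF jm] e finite_entries[of "a 1" j] by force
        then show ?thesis using Q True by (simp add: I_def entries_Suc)
      qed
    qed simp
  next
    show "I 0 (r(22 := 5)) a" using z by (simp add: I_def lists_inv_def entries_def)
  qed (use envD[OF env] in \<open>auto simp: I_def add_entry_def\<close>)
  then have *: "ok (For 20 5 ?body) (r(22 := 5)) a (m * 90 + 10) (I m)"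
    using envD[OF env] by simp
  show ?thesis unfolding build_lists_def
  proof (rule ok_Seq_wp, unfold wp.simps, rule ok_conseq[OF *])
  qed (auto simp: I_def)
qed

lemma init_queue_ok:
  assumes env: "env r a" and L: "lists_inv (entries col m) inp mate n h1 h2 h3 (a 7)"
  shows "ok init_queue r a (n * 30 + 20)
    (\<lambda>r' a'. P.peel_inv col 0 0 (r' 35) 0 (a' 8) (a' 9) (a' 7))"
proof -
  have dg: "a 7 v = card {q \<in> entries col m. mate q = v}" if "v < n" for v
    using L that unfolding lists_inv_def by blast
  define I where "I = (\<lambda>j (r'::regs) (a'::arrays). P.queue_ok col (r' 35) (a' 8) (a' 9) \<and>
    a' 8 ` {..<r' 35} = {v. v < j \<and> a 7 v \<le> d})"
  let ?body = "Load 21 7 20 ;; IfLe 21 2 (enqueue 20) Skip"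
  have "ok (For 20 4 ?body) (r(35 := 0)) a (n * 30 + 10) (I ((r(35 := 0)) 4))"
  proof (rule ok_For[where \<tau> = 20])
    fix j r' a'
    assume j: "j < (r(35 := 0)) 4" "r' 20 = j"
      and so: "same_outside ({20, 29} \<union> mods ?body) r' (r(35 := 0))"
      "same_outside (arrs ?body) a' a" and I: "I j r' a'"
    have r': "r' 2 = d" and a': "a' 7 = a 7"
      using same_outsideD[OF so(1)] same_outsideD[OF so(2)] envD[OF env]
      by (auto simp: enqueue_def)
    have jn: "j < n" using j envD[OF env] by simp
    have q: "P.queue_ok col (r' 35) (a' 8) (a' 9)" and im: "a' 8 ` {..<r' 35} = {v. v < j \<and> a 7 v \<le> d}"
      using I unfolding I_def by blast+
    let ?Q = "\<lambda>r1 a1. if a 7 j \<le> d then r1 35 = Suc (r' 35) \<and> a1 8 = (a' 8)(r' 35 := j) \<and>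
      a1 9 = (a' 9)(j := r' 35) else r1 35 = r' 35 \<and> a1 = a'"
    have "wp ?body ?Q r' a'" by (simp add: r' a' j enqueue_def)
    moreover have "tm ?body \<le> 20" by (simp add: enqueue_def)
    ultimately have "ok ?body r' a' 20 ?Q" by (rule ok_wp[rotated])
    then show "ok ?body r' a' 20 (I (Suc j))"
    proof (rule ok_conseq)
      fix r1 :: regs and a1 :: arrays assume Q: "?Q r1 a1"
      show "I (Suc j) r1 a1"
      proof (cases "a 7 j \<le> d")
        case False
        then have "{v. v < Suc j \<and> a 7 v \<le> d} = {v. v < j \<and> a 7 v \<le> d}" by (auto simp: less_Suc_eq)
        then show ?thesis using False Q q im by (simp add: I_def)
      next
        case True
        have "card {q \<in> entries col m. mate q = j \<and> inp q \<notin> a' 8 ` {..<r' 35}}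
            \<le> card {q \<in> entries col m. mate q = j}"
          by (rule card_mono) (use finite_entries in auto)
        then have "P.queue_ok col (Suc (r' 35)) ((a' 8)(r' 35 := j)) ((a' 9)(j := r' 35))"
          using dg[OF jn] True im by (intro P.queue_ok_enqueue q jn) auto
        moreover have "insert j {v. v < j \<and> a 7 v \<le> d} = {v. v < Suc j \<and> a 7 v \<le> d}"
          using True by auto
        ultimately show ?thesis using True Q im P.image_enqueue[of "a' 8" "r' 35" j] by (simp add: I_def)
      qed
    qed simp
  qed (use envD[OF env] in \<open>auto simp: I_def enqueue_def P.queue_ok_def\<close>)
  then have *: "ok (For 20 4 ?body) (r(35 := 0)) a (n * 30 + 10) (I n)"
    using envD[OF env] by simp
  show ?thesis unfolding init_queue_def
  proof (rule ok_Seq_wp, unfold wp.simps, rule ok_conseq_frame[OF *])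
    fix r' a'
    assume I: "I n r' a'" and so: "same_outside (arrs (For 20 4 ?body)) a' a"
    have a': "a' 7 = a 7" using same_outsideD[OF so] by (auto simp: enqueue_def)
    have pend: "P.pending col 0 0 (a' 8) = entries col m" by (auto simp: P.pending_def)
    show "P.peel_inv col 0 0 (r' 35) 0 (a' 8) (a' 9) (a' 7)"
      unfolding P.peel_inv_def pend a' using I dg unfolding I_def by simp
  qed auto
qed

lemma peel_ok:
  assumes env: "env r a" and L: "lists_inv (entries col m) inp mate n (a 4) (a 5) (a 6) dg"
    and inv: "P.peel_inv col 0 0 (r 35) 0 (a 8) (a 9) (a 7)"
    and col: "\<And>t u v. t < l \<Longrightarrow> u \<in> set (ls t) \<Longrightarrow> v \<in> set (rs t) \<Longrightarrow> col u = col v \<Longrightarrow> col u = k - 1"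
  shows "ok peel r a ((n + 2 * m) * 50 + 20) (\<lambda>r' a'. inj_on (a' 9) {..<n} \<and>
    (\<forall>v<n. card {q \<in> entries col m. mate q = v \<and> a' 9 v < a' 9 (inp q)} \<le> d))"
proof -
  define I where "I = (\<lambda>j (r'::regs) (a'::arrays).
    P.peel_inv col j (r' 36) (r' 35) (r' 37) (a' 8) (a' 9) (a' 7))"
  let ?r = "r(36 := 0, 37 := 0)"
  let ?body = "Cond 37
       (Load 21 6 37 ;; Load 22 7 21 ;; Const 28 1 ;; Sub 22 22 28 ;; Store 7 21 22 ;;
        IfEq 22 2 (enqueue 21) Skip ;; Load 37 5 37)
       (IfLe 35 36 Skip (Load 21 8 36 ;; Load 37 4 21 ;; Inc 36))"
  have "ok (For 20 9 ?body) ?r a ((n + 2 * m) * 50 + 10) (I (?r 9))"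
  proof (rule ok_For[where \<tau> = 40])
    fix j r' a'
    assume so: "same_outside ({20, 29} \<union> mods ?body) r' ?r"
      "same_outside (arrs ?body) a' a" and I: "I j r' a'"
    have r': "r' 2 = d" and a': "a' 4 = a 4" "a' 5 = a 5" "a' 6 = a 6"
      using same_outsideD[OF so(1)] same_outsideD[OF so(2)] envD[OF env]
      by (auto simp: enqueue_def)
    have inv': "P.peel_inv col j (r' 36) (r' 35) (r' 37) (a' 8) (a' 9) (a' 7)"
      using I unfolding I_def .
    have tm: "tm ?body \<le> 40" by (simp add: enqueue_def)
    show "ok ?body r' a' 40 (I (Suc j))"
    proof (cases "r' 37 = 0")
      case False
      let ?p = "r' 37"
      have pS: "?p \<in> entries col m" using inv' False unfolding P.peel_inv_def by blast
      have to: "a 6 ?p = mate ?p"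
        and nx: "a 5 ?p = Max (insert 0 {q \<in> entries col m. inp q = inp ?p \<and> q < ?p})"
        using L pS unfolding lists_inv_def by blast+
      let ?u = "mate ?p"
      let ?Q = "\<lambda>r1 a1. r1 36 = r' 36 \<and> r1 37 = a 5 ?p \<and> a1 7 = (a' 7)(?u := a' 7 ?u - 1) \<and>
        (if a' 7 ?u - 1 = d then r1 35 = Suc (r' 35) \<and> a1 8 = (a' 8)(r' 35 := ?u) \<and>
          a1 9 = (a' 9)(?u := r' 35)
         else r1 35 = r' 35 \<and> a1 8 = a' 8 \<and> a1 9 = a' 9)"
      have "wp ?body ?Q r' a'" using False by (simp add: r' a' to enqueue_def)
      then have "ok ?body r' a' 40 ?Q" by (rule ok_wp[OF tm])
      then show ?thesis
      proof (rule ok_conseq)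
        fix r1 :: regs and a1 :: arrays assume Q: "?Q r1 a1"
        show "I (Suc j) r1 a1"
        proof (cases "a' 7 ?u - 1 = d")
          case True
          then show ?thesis using P.peel_entry(1)[OF inv' False nx refl] Q by (simp add: I_def)
        next
          case F: False
          then show ?thesis using P.peel_entry(2)[OF inv' False nx refl] Q by (simp add: I_def)
        qed
      qed simp
    next
      case True
      let ?Q = "\<lambda>r1 a1. r1 35 = r' 35 \<and> a1 = a' \<and> (if r' 35 \<le> r' 36 then r1 36 = r' 36 \<and> r1 37 = 0
        else r1 36 = Suc (r' 36) \<and> r1 37 = a 4 (a' 8 (r' 36)))"
      have "wp ?body ?Q r' a'" using True by (simp add: r' a')
      then have "ok ?body r' a' 40 ?Q" by (rule ok_wp[OF tm])
      then show ?thesis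
      proof (rule ok_conseq)
        fix r1 :: regs and a1 :: arrays assume Q: "?Q r1 a1"
        have inv0: "P.peel_inv col j (r' 36) (r' 35) 0 (a' 8) (a' 9) (a' 7)" using inv' True by simp
        show "I (Suc j) r1 a1"
        proof (cases "r' 35 \<le> r' 36")
          case le: True
          then have "r' 36 = r' 35" using inv0 by (simp add: P.peel_inv_def)
          then have "P.peel_inv col (Suc j) (r' 36) (r' 35) 0 (a' 8) (a' 9) (a' 7)"
            using inv0 by (simp add: P.peel_inv_def)
          then show ?thesis using Q le by (simp add: I_def)
        next
          case False
          then have lt: "r' 36 < r' 35" by simp
          have "a' 8 (r' 36) < n" using inv0 lt by (simp add: P.peel_inv_def P.queue_ok_def)
          then have "a 4 (a' 8 (r' 36)) = Max (insert 0 {q \<in> entries col m. inp q = a' 8 (r' 36)})"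
            using L unfolding lists_inv_def by blast
          from P.peel_pop[OF inv0 lt this] show ?thesis using Q False by (simp add: I_def)
        qed
      qed simp
    qed
  next
    show "I 0 ?r a" using inv by (simp add: I_def)
  qed (use envD[OF env] in \<open>auto simp: I_def enqueue_def\<close>)
  then have *: "ok (For 20 9 ?body) ?r a ((n + 2 * m) * 50 + 10) (I (n + 2 * m))"
    using envD[OF env] by simp
  show ?thesis unfolding peel_def
  proof (rule ok_Seq_wp, unfold wp.simps, rule ok_Seq_wp, unfold wp.simps, rule ok_conseq[OF *])
    fix r' a' assume "I (n + 2 * m) r' a'"
    then have inv1: "P.peel_inv col (n + 2 * m) (r' 36) (r' 35) (r' 37) (a' 8) (a' 9) (a' 7)"
      unfolding I_def .
    have "r' 37 = 0 \<and> r' 36 = r' 35" by (rule P.peel_done[OF inv1 card_entries])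
    then have inv2: "P.peel_inv col (n + 2 * m) (r' 35) (r' 35) 0 (a' 8) (a' 9) (a' 7)"
      using inv1 by simp
    have core: "\<exists>x\<in>X. card {q \<in> entries col m. mate q = x \<and> inp q \<in> X} \<le> d"
      if "X \<subseteq> {..<n}" "X \<noteq> {}" for X by (rule entries_core[OF col that])
    show "inj_on (a' 9) {..<n} \<and>
      (\<forall>v<n. card {q \<in> entries col m. mate q = v \<and> a' 9 v < a' 9 (inp q)} \<le> d)"
      using P.peel_complete[OF inv2 core] by blast
  qed auto
qed

end

section \<open>One round\<close>

definition order_classes :: com where
  "order_classes = del_bicliques ;; reset_lists ;; build_lists ;; init_queue ;; peel"

definition test_classes :: com where
  "test_classes = subsample ;; clean ;; check ;; Cond 38 (Const 0 1) Skip"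

definition iteration :: com where
  "iteration = fill 1 4 6 ;; fill 2 8 11 ;; order_classes ;; fill 3 4 2 ;; test_classes"

lemmas prog_defs = order_classes_def test_classes_def del_bicliques_def del_side_def reset_lists_def
  build_lists_def add_entry_def init_queue_def enqueue_def peel_def subsample_def clean_def check_def
  find_dom_def raise_levels_def raise_level_def

lemma prod_if_in:
  fixes c :: "'b :: comm_monoid_mult"
  assumes "finite A" "W \<subseteq> A"
  shows "(\<Prod>v\<in>A. if v \<in> W then c else 1) = c ^ card W"
proof -
  have "(\<Prod>v\<in>A. if v \<in> W then c else 1) = (\<Prod>v\<in>A \<inter> W. c)"
    by (rule prod.inter_restrict[OF assms(1), symmetric])
  then show ?thesis using assms(2) by (simp add: Int_absorb1)
qed

text \<open>The inverse is \<open>(1 + 1 / d) ^ d <= exp 1\<close>. The constant is rounded to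
  \<open>1 / 4\<close>, which fits the estimate \<open>4 <= k * (d + 1)\<close> for
  \<open>k >= 2\<close>.\<close>

lemma one_minus_inverse_power_ge:
  fixes d :: nat
  assumes "d \<ge> 1"
  shows "(real d / (real d + 1)) ^ d \<ge> 1 / 4"
proof -
  have "1 + 1 / real d \<le> exp (1 / real d)" by (rule exp_ge_add_one_self)
  then have "(1 + 1 / real d) ^ d \<le> exp (1 / real d) ^ d" by (intro power_mono) auto
  also have "\<dots> = exp 1" using assms by (simp add: exp_of_nat_mult[symmetric])
  also have "\<dots> \<le> 4" using exp_le by simp
  finally have "inverse ((1 + 1 / real d) ^ d) \<ge> inverse 4"
    using assms by (intro le_imp_inverse_le) (auto intro!: zero_less_power add_pos_nonneg)
  moreover have "inverse (1 + 1 / real d) = real d / (real d + 1)"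
    using assms by (simp add: field_simps)
  ultimately show ?thesis by (simp add: power_inverse[symmetric])
qed

section \<open>The deterministic phases of a round\<close>

context spgc_input
begin

definition survivors :: "(nat \<Rightarrow> nat) \<Rightarrow> (nat \<Rightarrow> nat) \<Rightarrow> nat \<Rightarrow> nat" where
  "survivors c g v = (if \<exists>t<l. bad g t v (c v) then k - 1 else c v)"

definition order_time :: nat where
  "order_time = l * (80 * n + 120) + n * 100 + m * 190 + 200"

definition test_time :: nat where
  "test_time = n * 20 + m * 70 + k * (50 * n + 80 * m + 80) + 100"

text \<open>A guess is \<open>0\<close> or \<open>1\<close>, so one side of the biclique always
  loses the color in question. This holds for every outcome of the guesses, so the peeling bound
  never depends on luck.\<close>

lemma survivors_biclique:
  assumes c: "\<And>v. v < n \<Longrightarrow> c v \<le> k - 1" and g: "\<And>i. i < l * k \<Longrightarrow> g i \<le> 1"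
    and t: "t < l" "u \<in> set (ls t)" "v \<in> set (rs t)" "survivors c g u = survivors c g v"
  shows "survivors c g u = k - 1"
proof (rule ccontr)
  assume ne: "survivors c g u \<noteq> k - 1"
  then have u: "c u = survivors c g u" "\<not> bad g t u (c u)"
    using t(1) by (auto simp: survivors_def split: if_splits)
  have v: "c v = survivors c g v" "\<not> bad g t v (c v)"
    using t(1,4) ne by (auto simp: survivors_def split: if_splits)
  have "u < n" using biclique_lists[OF t(1)] t(2) by auto
  then have "c u < k" using c[of u] k_ge1 by linarith
  have "t * k + c u < Suc t * k" using \<open>c u < k\<close> by simp
  also have "\<dots> \<le> l * k" using t(1) by (intro mult_right_mono) auto
  finally have "g (t * k + c u) \<le> 1" by (rule g)
  then show False using u v t by (auto simp: bad_def)
qed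

lemma order_classes_ok:
  assumes env: "env r a" and c: "\<And>v. v < n \<Longrightarrow> a 1 v \<le> k - 1" and g: "\<And>i. i < l * k \<Longrightarrow> a 2 i \<le> 1"
  shows "ok order_classes r a order_time (\<lambda>r' a'. env r' a' \<and> r' 0 = r 0 \<and> r' 7 = r 7 \<and>
    a' 1 = survivors (a 1) (a 2) \<and> inj_on (a' 9) {..<n} \<and>
    (\<forall>v<n. card {q \<in> entries (a' 1) m. mate q = v \<and> a' 9 v < a' 9 (inp q)} \<le> d))"
proof -
  let ?C = "survivors (a 1) (a 2)"
  let ?Q = "\<lambda>r' a'. a' 1 = ?C \<and> inj_on (a' 9) {..<n} \<and>
    (\<forall>v<n. card {q \<in> entries ?C m. mate q = v \<and> a' 9 v < a' 9 (inp q)} \<le> d)"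
  have 0: "ok del_bicliques r a (l * (80 * n + 120) + 30) (\<lambda>r' a'. a' 1 = ?C)"
    by (rule ok_conseq[OF del_bicliques_ok[OF env]]) (auto simp: survivors_def)
  have "ok order_classes r a order_time ?Q"
    unfolding order_classes_def
  proof (rule ok_Seq[OF ok_frame[OF 0], where \<sigma> = "n * 100 + m * 190 + 160"])
    fix r1 a1
    assume 1: "a1 1 = ?C \<and> same_outside (mods del_bicliques) r1 r \<and> same_outside (arrs del_bicliques) a1 a"
    have env1: "env r1 a1"
      by (rule env_frame[OF env 1[THEN conjunct2, THEN conjunct1] 1[THEN conjunct2, THEN conjunct2]])
        (auto simp: prog_defs)
    show "ok (reset_lists ;; build_lists ;; init_queue ;; peel) r1 a1 (n * 100 + m * 190 + 160) ?Q"
    proof (rule ok_Seq[OF ok_frame[OF reset_lists_ok[OF env1]], where \<sigma> = "n * 80 + m * 190 + 140"])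
      fix r2 a2
      assume 2: "(\<forall>v<n. a2 4 v = 0 \<and> a2 7 v = 0) \<and>
        same_outside (mods reset_lists) r2 r1 \<and> same_outside (arrs reset_lists) a2 a1"
      have env2: "env r2 a2"
        by (rule env_frame[OF env1 2[THEN conjunct2, THEN conjunct1] 2[THEN conjunct2, THEN conjunct2]])
          (auto simp: prog_defs)
      have C2: "a2 1 = ?C"
        using 1 same_outsideD[OF 2[THEN conjunct2, THEN conjunct2], of 1] by (simp add: prog_defs)
      show "ok (build_lists ;; init_queue ;; peel) r2 a2 (n * 80 + m * 190 + 140) ?Q"
      proof (rule ok_Seq[OF ok_frame[OF build_lists_ok[OF env2 2[THEN conjunct1]]],
            where \<sigma> = "n * 80 + m * 100 + 100"])
        fix r3 a3
        assume 3: "lists_inv (entries (a2 1) m) inp mate n (a3 4) (a3 5) (a3 6) (a3 7) \<and>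
          same_outside (mods build_lists) r3 r2 \<and> same_outside (arrs build_lists) a3 a2"
        have env3: "env r3 a3"
          by (rule env_frame[OF env2 3[THEN conjunct2, THEN conjunct1] 3[THEN conjunct2, THEN conjunct2]])
            (auto simp: prog_defs)
        have C3: "a3 1 = ?C"
          using C2 same_outsideD[OF 3[THEN conjunct2, THEN conjunct2], of 1] by (simp add: prog_defs)
        have L3: "lists_inv (entries ?C m) inp mate n (a3 4) (a3 5) (a3 6) (a3 7)" using 3 C2 by simp
        show "ok (init_queue ;; peel) r3 a3 (n * 80 + m * 100 + 100) ?Q"
        proof (rule ok_Seq[OF ok_frame[OF init_queue_ok[OF env3 L3]], where \<sigma> = "n * 50 + m * 100 + 50"])
          fix r4 a4
          assume 4: "peeling.peel_inv (entries ?C m) inp mate n d 0 0 (r4 35) 0 (a4 8) (a4 9) (a4 7) \<and>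
            same_outside (mods init_queue) r4 r3 \<and> same_outside (arrs init_queue) a4 a3"
          have env4: "env r4 a4"
            by (rule env_frame[OF env3 4[THEN conjunct2, THEN conjunct1] 4[THEN conjunct2, THEN conjunct2]])
              (auto simp: prog_defs)
          have a4: "a4 1 = ?C" "a4 4 = a3 4" "a4 5 = a3 5" "a4 6 = a3 6"
            using C3 same_outsideD[OF 4[THEN conjunct2, THEN conjunct2]] by (auto simp: prog_defs)
          have L4: "lists_inv (entries ?C m) inp mate n (a4 4) (a4 5) (a4 6) (a3 7)" using L3 a4 by simp
          show "ok peel r4 a4 (n * 50 + m * 100 + 50) ?Q"
          proof (rule ok_conseq_frame[OF peel_ok[OF env4 L4 4[THEN conjunct1]]])
            show "survivors (a 1) (a 2) u = k - 1"
              if "t < l" "u \<in> set (ls t)" "v \<in> set (rs t)" "?C u = ?C v" for t u v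
              using survivors_biclique[of "a 1" "a 2"] c g that by blast
          next
            fix r5 a5
            assume 5: "inj_on (a5 9) {..<n} \<and>
              (\<forall>v<n. card {q \<in> entries ?C m. mate q = v \<and> a5 9 v < a5 9 (inp q)} \<le> d)"
              and so: "same_outside (arrs peel) a5 a4"
            have "a5 1 = ?C" using a4 same_outsideD[OF so, of 1] by (simp add: prog_defs)
            then show "?Q r5 a5" using 5 by blast
          qed simp
        qed simp
      qed simp
    qed simp
  qed (simp add: order_time_def)
  then show ?thesis
  proof (rule ok_conseq_frame)
    fix r' a'
    assume Q: "?Q r' a'" and so: "same_outside (mods order_classes) r' r" "same_outside (arrs order_classes) a' a"
    have "env r' a'" by (rule env_frame[OF env so]) (auto simp: prog_defs)
    moreover have "r' 0 = r 0" "r' 7 = r 7"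
      using same_outsideD[OF so(1)] by (auto simp: prog_defs)
    ultimately show "env r' a' \<and> r' 0 = r 0 \<and> r' 7 = r 7 \<and>
      a' 1 = ?C \<and> inj_on (a' 9) {..<n} \<and>
      (\<forall>v<n. card {q \<in> entries (a' 1) m. mate q = v \<and> a' 9 v < a' 9 (inp q)} \<le> d)"
      using Q by simp
  qed simp
qed

text \<open>A relation, because the exact outcome depends on the order of the edges. The first two
  conjuncts carry soundness; the third makes the witness survive. A value \<open>0\<close> of
  \<open>s\<close> means that the vertex is kept.\<close>

definition cleaned :: "(nat \<Rightarrow> nat) \<Rightarrow> (nat \<Rightarrow> nat) \<Rightarrow> (nat \<Rightarrow> nat) \<Rightarrow> (nat \<Rightarrow> nat) \<Rightarrow> bool" where
  "cleaned c s pos c' \<longleftrightarrow> (\<forall>v<n. c' v \<le> k - 1) \<and>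
    (\<forall>u v. adj u v \<longrightarrow> c' u = c' v \<longrightarrow> c' u = k - 1) \<and>
    (\<forall>w<n. s w = 0 \<longrightarrow> (\<forall>y. adj w y \<longrightarrow> s y = 0 \<longrightarrow> c y = c w \<longrightarrow> c w \<noteq> k - 1 \<longrightarrow> pos y < pos w) \<longrightarrow>
      c' w = c w)"

lemma test_classes_ok:
  assumes env: "env r a" and c: "\<And>v. v < n \<Longrightarrow> a 1 v \<le> k - 1"
  shows "ok test_classes r a test_time (\<lambda>r' a'. env r' a' \<and> r' 7 = r 7 \<and>
    (\<exists>c'. cleaned (a 1) (a 3) (a 9) c' \<and>
      (r' 0 \<noteq> 0 \<longleftrightarrow> r 0 \<noteq> 0 \<or> (\<forall>i<k. \<exists>v. dominates c' i v))))"
proof -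
  let ?Q = "\<lambda>r' a'. \<exists>c'. cleaned (a 1) (a 3) (a 9) c' \<and>
      (r' 0 \<noteq> 0 \<longleftrightarrow> r 0 \<noteq> 0 \<or> (\<forall>i<k. \<exists>v. dominates c' i v))"
  have "ok test_classes r a test_time ?Q"
    unfolding test_classes_def
  proof (rule ok_Seq[OF ok_frame[OF subsample_ok[OF env]], where \<sigma> = "m * 70 + k * (50 * n + 80 * m + 80) + 80"])
    fix r1 a1
    assume 1: "((\<forall>v<n. a1 10 v = 0) \<and> (\<forall>v<n. a1 1 v = (if a 3 v \<noteq> 0 then k - 1 else a 1 v))) \<and>
      same_outside (mods subsample) r1 r \<and> same_outside (arrs subsample) a1 a"
    have env1: "env r1 a1"
      by (rule env_frame[OF env 1[THEN conjunct2, THEN conjunct1] 1[THEN conjunct2, THEN conjunct2]])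
        (auto simp: prog_defs)
    have r1: "r1 0 = r 0" "a1 9 = a 9"
      using same_outsideD[OF 1[THEN conjunct2, THEN conjunct1]]
        same_outsideD[OF 1[THEN conjunct2, THEN conjunct2]] by (auto simp: prog_defs)
    show "ok (clean ;; check ;; Cond 38 (Const 0 1) Skip) r1 a1 (m * 70 + k * (50 * n + 80 * m + 80) + 80) ?Q"
    proof (rule ok_Seq[OF ok_frame[OF clean_ok[OF env1]], where \<sigma> = "k * (50 * n + 80 * m + 80) + 50"])
      fix r2 a2
      assume 2: "((\<forall>v. a2 1 v = a1 1 v \<or> a2 1 v = k - 1) \<and>
        (\<forall>u v. adj u v \<longrightarrow> a2 1 u = a2 1 v \<longrightarrow> a2 1 u = k - 1) \<and>
        (\<forall>w. (\<forall>y. adj w y \<longrightarrow> a1 1 y = a1 1 w \<longrightarrow> a1 1 w \<noteq> k - 1 \<longrightarrow> a1 9 y < a1 9 w) \<longrightarrow> a2 1 w = a1 1 w)) \<and>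
        same_outside (mods clean) r2 r1 \<and> same_outside (arrs clean) a2 a1"
      have env2: "env r2 a2"
        by (rule env_frame[OF env1 2[THEN conjunct2, THEN conjunct1] 2[THEN conjunct2, THEN conjunct2]])
          (auto simp: prog_defs)
      have r2: "r2 0 = r 0" "a2 10 = a1 10"
        using r1 same_outsideD[OF 2[THEN conjunct2, THEN conjunct1]]
          same_outsideD[OF 2[THEN conjunct2, THEN conjunct2]] by (auto simp: prog_defs)
      have cl: "cleaned (a 1) (a 3) (a 9) (a2 1)"
        unfolding cleaned_def
      proof (intro conjI allI impI)
        fix v assume v: "v < n"
        have "a1 1 v \<le> k - 1" using 1 c[OF v] v by simp
        moreover have "a2 1 v = a1 1 v \<or> a2 1 v = k - 1" using 2 by blast
        ultimately show "a2 1 v \<le> k - 1" by auto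
      next
        fix u v assume "adj u v" "a2 1 u = a2 1 v"
        then show "a2 1 u = k - 1" using 2 by blast
      next
        fix w
        assume w: "w < n" "a 3 w = 0"
          and all: "\<forall>y. adj w y \<longrightarrow> a 3 y = 0 \<longrightarrow> a 1 y = a 1 w \<longrightarrow> a 1 w \<noteq> k - 1 \<longrightarrow> a 9 y < a 9 w"
        have w1: "a1 1 w = a 1 w" using 1 w by simp
        have "a1 9 y < a1 9 w" if y: "adj w y" "a1 1 y = a1 1 w" "a1 1 w \<noteq> k - 1" for y
        proof -
          have "y < n" using y by (simp add: adj_def)
          then have "a 3 y = 0" "a1 1 y = a 1 y" using 1 y by (auto split: if_splits)
          then have "a 9 y < a 9 w" using all y w1 by metis
          then show ?thesis using r1(2) by simp
        qed
        then have "a2 1 w = a1 1 w" using 2 by blast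
        then show "a2 1 w = a 1 w" using w1 by simp
      qed
      have lev: "\<forall>v<n. a2 10 v = 0" using 1 r2(2) by simp
      show "ok (check ;; Cond 38 (Const 0 1) Skip) r2 a2 (k * (50 * n + 80 * m + 80) + 50) ?Q"
      proof (rule ok_Seq[OF ok_frame[OF check_ok[OF env2 lev]], where \<sigma> = 5])
        fix r3 a3
        assume 3: "((r3 38 \<noteq> 0) = (\<forall>i<k. \<exists>v. dominates (a2 1) i v)) \<and>
          same_outside (mods check) r3 r2 \<and> same_outside (arrs check) a3 a2"
        have "r3 0 = r 0"
          using r2 same_outsideD[OF 3[THEN conjunct2, THEN conjunct1], of 0] by (simp add: prog_defs)
        then have "wp (Cond 38 (Const 0 1) Skip)
            (\<lambda>r' a'. r' 0 \<noteq> 0 \<longleftrightarrow> r 0 \<noteq> 0 \<or> (\<forall>i<k. \<exists>v. dominates (a2 1) i v)) r3 a3"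
          using 3[THEN conjunct1] by auto
        then have "ok (Cond 38 (Const 0 1) Skip) r3 a3 5
            (\<lambda>r' a'. r' 0 \<noteq> 0 \<longleftrightarrow> r 0 \<noteq> 0 \<or> (\<forall>i<k. \<exists>v. dominates (a2 1) i v))"
          by (rule ok_wp[rotated]) simp
        then show "ok (Cond 38 (Const 0 1) Skip) r3 a3 5 ?Q"
          by (rule ok_conseq) (use cl in blast, simp)
      qed simp
    qed simp
  qed (simp add: test_time_def)
  then show ?thesis
  proof (rule ok_conseq_frame)
    fix r' a'
    assume Q: "?Q r' a'" and so: "same_outside (mods test_classes) r' r" "same_outside (arrs test_classes) a' a"
    have "env r' a'" by (rule env_frame[OF env so]) (auto simp: prog_defs)
    moreover have "r' 7 = r 7" using same_outsideD[OF so(1), of 7] by (simp add: prog_defs)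
    ultimately show "env r' a' \<and> r' 7 = r 7 \<and> ?Q r' a'" using Q by blast
  qed simp
qed

text \<open>The dominator of color \<open>k - 1\<close> is not targeted: had it a smaller color
  \<open>j\<close>, it would share it with its neighbour \<open>w (k - 1) j\<close>, against the
  independence of class \<open>j\<close>. So no luck is spent on color \<open>k - 1\<close>, and for
  \<open>k = 1\<close> there is nothing to hit.\<close>

lemma yes_target:
  assumes "spgc_yes k V E"
  obtains W cw where "W \<subseteq> {..<n}" "card W \<le> k\<^sup>2" "k = 1 \<Longrightarrow> W = {}" "\<And>v. v \<in> W \<Longrightarrow> cw v < k - 1"
    "\<And>u v. adj u v \<Longrightarrow> cw u \<noteq> cw v"
    "\<And>c. \<forall>v\<in>W. c v = cw v \<Longrightarrow> \<forall>u v. adj u v \<longrightarrow> c u = c v \<longrightarrow> c u = k - 1 \<Longrightarrow>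
      \<forall>v<n. c v \<le> k - 1 \<Longrightarrow> \<forall>i<k. \<exists>v. dominates c i v"
proof -
  obtain w cw where w: "\<And>i j. i < k \<Longrightarrow> j \<le> i \<Longrightarrow> w i j < n \<and> cw (w i j) = j"
    "\<And>i j. i < k \<Longrightarrow> j < i \<Longrightarrow> adj (w i j) (w i i)" "\<And>u v. adj u v \<Longrightarrow> cw u \<noteq> cw v"
    using yes_witness[OF assms] by blast
  define W where "W = {w i j |i j. i < k \<and> j \<le> i \<and> j < k - 1}"
  have sub: "W \<subseteq> (\<lambda>(i, j). w i j) ` ({..<k} \<times> {..<k})" by (fastforce simp: W_def)
  have "card W \<le> card ((\<lambda>(i, j). w i j) ` ({..<k} \<times> {..<k}))" by (rule card_mono[OF _ sub]) simp
  also have "\<dots> \<le> card ({..<k} \<times> {..<k})" by (rule card_image_le) simp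
  finally have cardW: "card W \<le> k\<^sup>2" by (simp add: power2_eq_square)
  have dom: "\<exists>v. dominates c i v" if c: "\<forall>v\<in>W. c v = cw v"
    "\<forall>u v. adj u v \<longrightarrow> c u = c v \<longrightarrow> c u = k - 1" "\<forall>v<n. c v \<le> k - 1" and i: "i < k" for c i
  proof -
    have cj: "c (w i j) = j" if "j \<le> i" "j < k - 1" for j
      using c(1) w(1)[OF i that(1)] that i by (force simp: W_def)
    have ci: "c (w i i) = i"
    proof (cases "i < k - 1")
      case True
      then show ?thesis using cj[of i] by simp
    next
      case False
      then have ik: "i = k - 1" using i by simp
      have le: "c (w i i) \<le> k - 1" using c(3) w(1)[OF i, of i] by simp
      show ?thesis
      proof (rule ccontr)
        assume "c (w i i) \<noteq> i"
        then have lt: "c (w i i) < i" using le ik by simp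
        then have "c (w i (c (w i i))) = c (w i i)" using cj[of "c (w i i)"] ik by simp
        moreover have "adj (w i (c (w i i))) (w i i)" using w(2)[OF i lt] .
        ultimately have "c (w i i) = k - 1" using c(2) by metis
        then show False using lt ik by simp
      qed
    qed
    have "\<exists>u. adj u (w i i) \<and> c u = j" if j: "j < i" for j
      using w(2)[OF i j] cj[of j] j i by (intro exI[of _ "w i j"]) auto
    then show ?thesis unfolding dominates_def using ci w(1)[OF i, of i] by blast
  qed
  show ?thesis
  proof (rule that[of W cw])
    show "W \<subseteq> {..<n}" using w(1) by (auto simp: W_def)
    show "cw v < k - 1" if "v \<in> W" for v using that w(1) by (auto simp: W_def)
    show "k = 1 \<Longrightarrow> W = {}" by (auto simp: W_def)
  qed (use cardW w(3) dom in blast)+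
qed

section \<open>Success probability of one round\<close>

definition iteration_time :: nat where
  "iteration_time = 20 * n + 10 * (l * k) + order_time + test_time + 30"

definition success_prob :: real where
  "success_prob = 1 / (real (k * (d + 1)) ^ (2 * k\<^sup>2) * 2 ^ (l * (k - 1)))"

lemma success_prob_bounds: "0 < success_prob" "success_prob \<le> 1"
proof -
  have "1 \<le> real (k * (d + 1))" unfolding real_of_nat_ge_one_iff
    using mult_le_mono[OF k_ge1, of 1 "d + 1"] by simp
  then have "1 \<le> real (k * (d + 1)) ^ (2 * k\<^sup>2)" by (rule one_le_power)
  then have "1 * 1 \<le> real (k * (d + 1)) ^ (2 * k\<^sup>2) * 2 ^ (l * (k - 1))"
    by (intro mult_mono) auto
  then show "0 < success_prob" "success_prob \<le> 1" unfolding success_prob_def by (auto simp: field_simps)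
qed

lemma cleaned_sound:
  assumes "cleaned c s pos c'" "\<forall>i<k. \<exists>v. dominates c' i v"
  shows "spgc_yes k V E"
proof (rule accept_sound)
  fix u v assume "adj u v" "c' u = c' v"
  then have "c' u = k - 1" using assms(1) unfolding cleaned_def by blast
  then show "k - 1 \<le> c' u" by simp
qed (use assms(2) in blast)

lemma test_good:
  assumes env: "env r a" and c: "\<And>v. v < n \<Longrightarrow> a 1 v \<le> k - 1"
    and cont: "\<And>r' a'. env r' a' \<Longrightarrow> r' 7 = r 7 \<Longrightarrow> (r 0 \<noteq> 0 \<longrightarrow> r' 0 \<noteq> 0) \<Longrightarrow>
      (r' 0 \<noteq> 0 \<longrightarrow> r 0 \<noteq> 0 \<or> spgc_yes k V E) \<Longrightarrow>
      (\<forall>c'. cleaned (a 1) (a 3) (a 9) c' \<longrightarrow> (\<forall>i<k. \<exists>v. dominates c' i v)) \<longrightarrow> r' 0 \<noteq> 0 \<Longrightarrow>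
      good A T (cs, (r', a')) p"
  shows "good A (T + test_time) (test_classes # cs, (r, a)) p"
proof (rule ok_good[OF test_classes_ok[OF env c]])
  fix r' a'
  assume "env r' a' \<and> r' 7 = r 7 \<and> (\<exists>c'. cleaned (a 1) (a 3) (a 9) c' \<and>
      (r' 0 \<noteq> 0 \<longleftrightarrow> r 0 \<noteq> 0 \<or> (\<forall>i<k. \<exists>v. dominates c' i v)))"
  then obtain c' where c': "env r' a'" "r' 7 = r 7" "cleaned (a 1) (a 3) (a 9) c'"
      "r' 0 \<noteq> 0 \<longleftrightarrow> r 0 \<noteq> 0 \<or> (\<forall>i<k. \<exists>v. dominates c' i v)" by blast
  show "good A T (cs, (r', a')) p"
    by (rule cont) (use c' cleaned_sound[OF c'(3)] in blast)+
qed

text \<open>Vertices of \<open>W\<close> have to draw \<open>0\<close>, and their rivals at later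
  positions, collected in \<open>Y\<close>, have to draw something else. The demands are compatible
  because \<open>cw\<close> is proper, so no two members of \<open>W\<close> are rivals.\<close>

lemma subsample_targets:
  assumes W: "W \<subseteq> {..<n}" "\<And>v. v \<in> W \<Longrightarrow> cw v < k - 1" "\<And>u v. adj u v \<Longrightarrow> cw u \<noteq> cw v"
    and c: "\<And>v. v \<in> W \<Longrightarrow> c v = cw v"
    and pos: "inj_on pos {..<n}" "\<And>v. v < n \<Longrightarrow> card {q \<in> entries c m. mate q = v \<and> pos v < pos (inp q)} \<le> d"
  obtains X where "\<And>v. X v \<subseteq> {..d}"
    "(1 / (4 * (real d + 1))) ^ card W \<le> (\<Prod>v<n. real (card (X v)) / (real d + 1))"
    "\<And>s c'. \<forall>v<n. s v \<in> X v \<Longrightarrow> cleaned c s pos c' \<Longrightarrow> \<forall>v\<in>W. c' v = cw v"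
proof -
  define Y where "Y = (\<Union>w\<in>W. inp ` {q \<in> entries c m. mate q = w \<and> pos w < pos (inp q)})"
  have finW: "finite W" using W(1) finite_subset by blast
  have "card Y \<le> (\<Sum>w\<in>W. card (inp ` {q \<in> entries c m. mate q = w \<and> pos w < pos (inp q)}))"
    unfolding Y_def by (rule card_UN_le[OF finW])
  also have "\<dots> \<le> (\<Sum>w\<in>W. d)"
  proof (rule sum_mono)
    fix w assume w: "w \<in> W"
    have "card (inp ` {q \<in> entries c m. mate q = w \<and> pos w < pos (inp q)})
        \<le> card {q \<in> entries c m. mate q = w \<and> pos w < pos (inp q)}"
      by (rule card_image_le) (use finite_entries in simp)
    also have "\<dots> \<le> d" using pos(2) w W(1) by blast
    finally show "card (inp ` {q \<in> entries c m. mate q = w \<and> pos w < pos (inp q)}) \<le> d" .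
  qed
  finally have cardY: "card Y \<le> d * card W" by (simp add: mult.commute)
  have Yadj: "\<exists>w\<in>W. adj y w \<and> c y = c w" if y: "y \<in> Y" for y
  proof -
    obtain q where q: "q \<in> entries c m" "mate q \<in> W" "y = inp q" using y by (auto simp: Y_def)
    then have "adj y (mate q) \<and> c y = c (mate q)"
      by (elim entries_cases) (auto simp: adj_edge same_class_def)
    then show ?thesis using q by blast
  qed
  have disj: "W \<inter> Y = {}"
  proof (rule ccontr)
    assume "W \<inter> Y \<noteq> {}"
    then obtain y w where "y \<in> W" "w \<in> W" "adj y w" "c y = c w" using Yadj by blast
    then show False using W(3)[of y w] c by metis
  qed
  have Yn: "Y \<subseteq> {..<n}" using Yadj by (auto simp: adj_def)
  define X where "X v = (if v \<in> W then {0} else if v \<in> Y then {1..d} else {..d})" for v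
  let ?x = "1 / (real d + 1)" and ?y = "real d / (real d + 1)"
  have "(\<Prod>v<n. real (card (X v)) / (real d + 1))
      = (\<Prod>v<n. (if v \<in> W then ?x else 1) * (if v \<in> Y then ?y else 1))"
    by (rule prod.cong) (use disj in \<open>auto simp: X_def\<close>)
  also have "\<dots> = ?x ^ card W * ?y ^ card Y"
    by (simp only: prod.distrib prod_if_in[OF finite_lessThan W(1)] prod_if_in[OF finite_lessThan Yn])
  finally have prod: "(\<Prod>v<n. real (card (X v)) / (real d + 1)) = ?x ^ card W * ?y ^ card Y" .
  \<comment> \<open>\<open>Y\<close> has at most \<open>d\<close> members per vertex of
    \<open>W\<close>, so its factors can be grouped into blocks of \<open>d\<close>, each block
    costing at most a factor \<open>1 / 4\<close>.\<close>
  have "(1 / 4) ^ card W \<le> (?y ^ d) ^ card W"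
    by (rule power_mono[OF one_minus_inverse_power_ge[OF d_ge1]]) simp
  also have "\<dots> = ?y ^ (d * card W)" by (simp add: power_mult)
  also have "\<dots> \<le> ?y ^ card Y" by (rule power_decreasing[OF cardY]) auto
  finally have y: "(1 / 4) ^ card W \<le> ?y ^ card Y" .
  have "(1 / (4 * (real d + 1))) ^ card W = ?x ^ card W * (1 / 4) ^ card W"
    by (simp add: power_mult_distrib[symmetric] mult.commute)
  also have "\<dots> \<le> ?x ^ card W * ?y ^ card Y" by (rule mult_left_mono[OF y]) simp
  finally have low: "(1 / (4 * (real d + 1))) ^ card W \<le> (\<Prod>v<n. real (card (X v)) / (real d + 1))"
    unfolding prod .
  have keep: "\<forall>v\<in>W. c' v = cw v" if s: "\<forall>v<n. s v \<in> X v" and cl: "cleaned c s pos c'" for s c'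
  proof
    fix w assume w: "w \<in> W"
    have wn: "w < n" using w W(1) by auto
    have sw: "s w = 0" using s wn w by (auto simp: X_def)
    have "pos y < pos w" if y: "adj w y" "s y = 0" "c y = c w" "c w \<noteq> k - 1" for y
    proof (rule ccontr)
      assume "\<not> pos y < pos w"
      have yn: "y < n" using y by (simp add: adj_def)
      have yW: "y \<notin> W" using W(3)[OF y(1)] c w y(3) by metis
      have "w \<noteq> y" using w yW by blast
      then have "pos w \<noteq> pos y" using inj_onD[OF pos(1), of w y] wn yn by auto
      then have lt: "pos w < pos y" using \<open>\<not> pos y < pos w\<close> by simp
      obtain e where e: "e < m" "(eu e = w \<and> ev e = y) \<or> (eu e = y \<and> ev e = w)"
        using y(1) by (auto simp: adj_iff)
      have sc: "same_class c e" using e(2) y by (auto simp: same_class_def)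
      have "\<exists>q\<in>entries c m. mate q = w \<and> inp q = y"
      proof (cases "eu e = w \<and> ev e = y")
        case True
        then show ?thesis using e(1) sc
          by (intro bexI[of _ "6 + 2 * e"]) (auto simp: entries_def)
      next
        case False
        then have "eu e = y \<and> ev e = w" using e(2) by blast
        then show ?thesis using e(1) sc
          by (intro bexI[of _ "5 + 2 * e"]) (auto simp: entries_def)
      qed
      then have "y \<in> Y" using lt w by (auto simp: Y_def)
      then have "s y \<noteq> 0" using s yn yW by (auto simp: X_def)
      then show False using y(2) by simp
    qed
    then have "c' w = c w" using cl sw wn unfolding cleaned_def by blast
    then show "c' w = cw w" using c[OF w] by simp
  qed
  show ?thesis by (rule that[of X]) (use low keep in \<open>auto simp: X_def\<close>)
qed

text \<open>For each color the right guess deletes a side that contains no vertex of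
  \<open>W\<close> of this color. Such a side exists: two vertices of \<open>W\<close> on opposite
  sides are adjacent, so \<open>cw\<close> gives them different colors.\<close>

lemma guess_targets:
  assumes W: "W \<subseteq> {..<n}" "\<And>v. v \<in> W \<Longrightarrow> cw v < k - 1" "\<And>u v. adj u v \<Longrightarrow> cw u \<noteq> cw v"
  obtains X where "\<And>i. X i \<subseteq> {..1}"
    "(1 / 2) ^ (l * (k - 1)) \<le> (\<Prod>i<l * k. real (card (X i)) / (real 1 + 1))"
    "\<And>g c. \<forall>i<l * k. g i \<in> X i \<Longrightarrow> \<forall>v\<in>W. c v = cw v \<Longrightarrow> \<forall>v\<in>W. survivors c g v = cw v"
proof -
  define b :: "nat \<Rightarrow> nat \<Rightarrow> nat" where "b t j = (if \<exists>v\<in>W. cw v = j \<and> v \<in> set (ls t) then 1 else 0)" for t j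
  \<comment> \<open>Colors in \<open>W\<close> are below \<open>k - 1\<close>, so cells for color
    \<open>k - 1\<close> may take any value; this leaves \<open>k - 1\<close> fair coins per
    biclique.\<close>
  define X where "X i = (if i mod k < k - 1 then {b (i div k) (i mod k)} else {..1})" for i
  let ?J = "{i \<in> {..<l * k}. i mod k < k - 1}"
  have "(\<Prod>i<l * k. real (card (X i)) / (real 1 + 1)) = (\<Prod>i<l * k. if i \<in> ?J then 1 / 2 else 1)"
    by (rule prod.cong) (auto simp: X_def)
  also have "\<dots> = (1 / 2) ^ card ?J" by (rule prod_if_in) auto
  finally have prod: "(\<Prod>i<l * k. real (card (X i)) / (real 1 + 1)) = (1 / 2) ^ card ?J" .
  have "card ?J \<le> card ({..<l} \<times> {..<k - 1})"
  proof (rule card_inj_on_le[where f = "\<lambda>i. (i div k, i mod k)"])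
    show "inj_on (\<lambda>i. (i div k, i mod k)) ?J"
      by (rule inj_onI) (metis div_mult_mod_eq prod.inject)
    show "(\<lambda>i. (i div k, i mod k)) ` ?J \<subseteq> {..<l} \<times> {..<k - 1}"
      using k_ge1 by (auto simp: less_mult_imp_div_less)
  qed simp
  then have "card ?J \<le> l * (k - 1)" by (simp add: card_cartesian_product)
  then have low: "(1 / 2) ^ (l * (k - 1)) \<le> (\<Prod>i<l * k. real (card (X i)) / (real 1 + 1))"
    unfolding prod by (rule power_decreasing) auto
  have keep: "\<forall>v\<in>W. survivors c g v = cw v"
    if g: "\<forall>i<l * k. g i \<in> X i" and c: "\<forall>v\<in>W. c v = cw v" for g c
  proof
    fix v assume v: "v \<in> W"
    have "\<not> bad g t v (c v)" if t: "t < l" for t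
    proof -
      let ?i = "t * k + cw v"
      have cv: "cw v < k - 1" using W(2)[OF v] .
      then have ck: "cw v < k" by linarith
      have "?i < Suc t * k" using ck by simp
      also have "\<dots> \<le> l * k" using t by (intro mult_right_mono) auto
      finally have "g ?i \<in> X ?i" using g by blast
      then have gi: "g ?i = b t (cw v)" using ck cv by (simp add: X_def)
      show ?thesis
      proof
        assume "bad g t v (c v)"
        then have "(v \<in> set (ls t) \<and> b t (cw v) = 0) \<or> (v \<in> set (rs t) \<and> b t (cw v) = 1)"
          using gi c v by (simp add: bad_def)
        then show False
        proof
          assume "v \<in> set (ls t) \<and> b t (cw v) = 0"
          then show False using v by (auto simp: b_def split: if_splits)
        next
          assume *: "v \<in> set (rs t) \<and> b t (cw v) = 1"
          then obtain u where "u \<in> W" "cw u = cw v" "u \<in> set (ls t)"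
            by (auto simp: b_def split: if_splits)
          then show False using biclique_adj[OF t, of u v] * W(3) by blast
        qed
      qed
    qed
    then show "survivors c g v = cw v" using c v by (auto simp: survivors_def)
  qed
  show ?thesis
  proof (rule that[of X])
    show "X i \<subseteq> {..1}" for i by (auto simp: X_def b_def)
  qed (use low keep in auto)
qed

lemma color_targets:
  assumes W: "W \<subseteq> {..<n}" "\<And>v. v \<in> W \<Longrightarrow> cw v < k - 1"
  obtains X where "\<And>v. X v \<subseteq> {..k - 1}"
    "(1 / real k) ^ card W = (\<Prod>v<n. real (card (X v)) / (real (k - 1) + 1))"
    "\<And>c. \<forall>v<n. c v \<in> X v \<Longrightarrow> \<forall>v\<in>W. c v = cw v"
proof -
  define X where "X v = (if v \<in> W then {cw v} else {..k - 1})" for v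
  have k: "real (k - 1) + 1 = real k" using k_ge1 by simp
  have "(\<Prod>v<n. real (card (X v)) / (real (k - 1) + 1)) = (\<Prod>v<n. if v \<in> W then 1 / real k else 1)"
    unfolding k by (rule prod.cong) (use k_ge1 in \<open>auto simp: X_def\<close>)
  also have "\<dots> = (1 / real k) ^ card W" by (rule prod_if_in[OF finite_lessThan W(1)])
  finally show ?thesis
    by (intro that[of X]) (use W in \<open>auto simp: X_def intro: less_imp_le\<close>)
qed

text \<open>Per vertex of \<open>W\<close>, one factor \<open>1 / B\<close> pays for getting and
  keeping its color, the other for the \<open>1 / 4\<close> due to its out-neighbours. The latter
  uses \<open>4 <= B\<close>, which holds for \<open>k >= 2\<close>; for \<open>k = 1\<close> the
  set \<open>W\<close> is empty.\<close>

lemma success_prob_le: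
  assumes "card W \<le> k\<^sup>2" "k = 1 \<Longrightarrow> W = {}"
  shows "success_prob \<le> (1 / real k) ^ card W * ((1 / 2) ^ (l * (k - 1)) * (1 / (4 * (real d + 1))) ^ card W)"
proof -
  define B where "B = real (k * (d + 1))"
  have B1: "1 \<le> B" unfolding B_def real_of_nat_ge_one_iff
    using mult_le_mono[OF k_ge1, of 1 "d + 1"] by simp
  have "1 / B ^ (2 * k\<^sup>2) \<le> 1 / B ^ (2 * card W)"
    using B1 assms(1) by (intro divide_left_mono power_increasing) auto
  also have "\<dots> = (1 / B) ^ card W * (1 / B) ^ card W" by (simp add: power_one_over power_add[symmetric] mult_2)
  also have "\<dots> \<le> (1 / B) ^ card W * (1 / 4) ^ card W"
  proof (cases "k = 1")
    case True
    then show ?thesis using assms(2) by simp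
  next
    case False
    then have "2 \<le> k" using k_ge1 by simp
    then have "2 * 2 \<le> k * (d + 1)" using d_ge1 by (intro mult_mono) auto
    then have "real 4 \<le> B" unfolding B_def by (subst of_nat_le_iff) simp
    then have "4 \<le> B" by simp
    then show ?thesis by (intro mult_left_mono power_mono) (auto simp: field_simps)
  qed
  also have "\<dots> = (1 / real k) ^ card W * (1 / (4 * (real d + 1))) ^ card W"
  proof -
    have "1 / B * (1 / 4) = 1 / real k * (1 / (4 * (real d + 1)))" by (simp add: B_def field_simps)
    then show ?thesis by (simp only: power_mult_distrib[symmetric])
  qed
  finally have "1 / B ^ (2 * k\<^sup>2) \<le> (1 / real k) ^ card W * (1 / (4 * (real d + 1))) ^ card W" .
  then have "1 / B ^ (2 * k\<^sup>2) * (1 / 2) ^ (l * (k - 1)) \<le>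
      (1 / real k) ^ card W * (1 / (4 * (real d + 1))) ^ card W * (1 / 2) ^ (l * (k - 1))"
    by (rule mult_right_mono) simp
  then show ?thesis unfolding success_prob_def B_def[symmetric] by (simp add: power_one_over mult_ac)
qed

lemma env_upd:
  assumes "env r a" "same_outside {20, 21, 29} r' r" "b \<noteq> 0"
  shows "env r' (a(b := f))"
  using assms by (auto simp: env_def same_outside_def)

text \<open>The bounds \<open>p0\<close> and \<open>p1\<close> of the continuation are arbitrary so
  that rounds compose: a round lifts the bound from \<open>p0\<close> to \<open>p1\<close> with
  probability at least \<open>success_prob\<close> on yes-instances.\<close>

lemma iteration_good:
  fixes p0 p1 :: real
  assumes env: "env r a" and p: "p0 \<le> p1"
    and cont: "\<And>r' a'. env r' a' \<Longrightarrow> r' 7 = r 7 \<Longrightarrow> (r 0 \<noteq> 0 \<longrightarrow> r' 0 \<noteq> 0) \<Longrightarrow>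
      (r' 0 \<noteq> 0 \<longrightarrow> r 0 \<noteq> 0 \<or> spgc_yes k V E) \<Longrightarrow>
      good A T (cs, (r', a')) (if r' 0 \<noteq> 0 then p1 else p0)"
  shows "good A (T + iteration_time) (iteration # cs, (r, a))
    (p0 + (p1 - p0) * (if spgc_yes k V E then success_prob else 0))"
proof -
  define valid where "valid r' a' \<longleftrightarrow> env r' a' \<and> r' 0 = r 0 \<and> r' 7 = r 7 \<and> (\<forall>v<n. a' 1 v \<le> k - 1)"
    for r' a'
  have valid_upd: "valid r2 (a1(b := f))"
    if "valid r1 a1" "same_outside {20, 21, 29} r2 r1" "b \<noteq> 0" "b \<noteq> 1" for r1 r2 a1 b f
    using that env_upd[of r1 a1 r2 b f] by (auto simp: valid_def same_outside_def)
  define acc where "acc a' \<longleftrightarrow>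
      (\<forall>c'. cleaned (a' 1) (a' 3) (a' 9) c' \<longrightarrow> (\<forall>i<k. \<exists>v. dominates c' i v))" for a' :: arrays
  \<comment> \<open>The stacks \<open>C1\<close> to \<open>C4\<close> are what remains of the round
    before each phase, counted from its end, and \<open>T1\<close> to \<open>T4\<close> bound the
    steps from there.\<close>
  define T1 where "T1 = T + test_time"
  define T2 where "T2 = Suc (T1 + n * 10 + 5)"
  define T3 where "T3 = Suc (T2 + order_time)"
  define T4 where "T4 = Suc (T3 + (l * k) * 10 + 5)"
  define C1 where "C1 = test_classes # cs"
  define C2 where "C2 = (fill 3 4 2 ;; test_classes) # cs"
  define C3 where "C3 = (order_classes ;; fill 3 4 2 ;; test_classes) # cs"
  define C4 where "C4 = (fill 2 8 11 ;; order_classes ;; fill 3 4 2 ;; test_classes) # cs"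
  have C1: "good A T1 (C1, (r', a'))
      (if acc a' then p1 else p0)"
    if v: "valid r' a'" for r' a'
    unfolding T1_def C1_def
  proof (rule test_good)
    fix r2 a2
    assume 2: "env r2 a2" "r2 7 = r' 7" "r' 0 \<noteq> 0 \<longrightarrow> r2 0 \<noteq> 0"
      "r2 0 \<noteq> 0 \<longrightarrow> r' 0 \<noteq> 0 \<or> spgc_yes k V E"
      "(\<forall>c'. cleaned (a' 1) (a' 3) (a' 9) c' \<longrightarrow> (\<forall>i<k. \<exists>v. dominates c' i v)) \<longrightarrow> r2 0 \<noteq> 0"
    have "good A T (cs, (r2, a2)) (if r2 0 \<noteq> 0 then p1 else p0)"
      by (rule cont) (use 2(1-4) v in \<open>simp_all add: valid_def\<close>)
    moreover have "acc a' \<longrightarrow> r2 0 \<noteq> 0" unfolding acc_def by (rule 2(5))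
    then have "(if acc a' then p1 else p0) \<le> (if r2 0 \<noteq> 0 then p1 else p0)" using p by auto
    ultimately show "good A T (cs, (r2, a2)) (if acc a' then p1 else p0)"
      by (rule good_mono[OF _ order_refl])
  qed (use v in \<open>auto simp: valid_def\<close>)
  \<comment> \<open>The fallback \<open>p0\<close> is needed at every stage, since a missed draw
    must not spoil the bound for the remaining rounds.\<close>
  have C1_any: "good A T1 (C1, (r', a')) p0" if "valid r' a'" for r' a'
    by (rule good_mono[OF C1[OF that]]) (use p in auto)
  have C2: "good A T2 (C2, (r', a')) (p0 + (q - p0) * (\<Prod>v<n. real (card (X v)) / (real d + 1)))"
    if v: "valid r' a'" and X: "\<And>i. X i \<subseteq> {..d}" and q: "p0 \<le> q"
      and good: "\<And>r2 f. valid r2 (a'(3 := f)) \<Longrightarrow> \<forall>v<n. f v \<in> X v \<Longrightarrow> good A T1 (C1, (r2, a'(3 := f))) q"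
    for r' a' X q
    unfolding C2_def T2_def
  proof (rule good_Seq, rule fill_good[where n = 4 and b = 2 and r = r' and T = T1 and X = X,
        unfolded envD[OF v[unfolded valid_def, THEN conjunct1]]])
    fix r2 and f :: "nat \<Rightarrow> nat"
    assume "same_outside {20, 21, 29} r2 r'"
    then have v2: "valid r2 (a'(3 := f))" using valid_upd[OF v] by simp
    show "good A T1 (test_classes # cs, (r2, a'(3 := f))) (if \<forall>l<n. f l \<in> X l then q else p0)"
      using C1_any[OF v2] good[OF v2] unfolding C1_def by simp
  qed (use X q in auto)
  have C2_any: "good A T2 (C2, (r', a')) p0" if "valid r' a'" for r' a'
    using C2[OF that, of "\<lambda>_. {..d}" p0] C1_any by simp
  have C3: "good A T3 (C3, (r', a')) q"
    if v: "valid r' a'" and g: "\<forall>i<l * k. a' 2 i \<le> 1"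
      and good: "\<And>r2 a2. valid r2 a2 \<Longrightarrow> a2 1 = survivors (a' 1) (a' 2) \<Longrightarrow> inj_on (a2 9) {..<n} \<Longrightarrow>
        \<forall>v<n. card {q \<in> entries (a2 1) m. mate q = v \<and> a2 9 v < a2 9 (inp q)} \<le> d \<Longrightarrow>
        good A T2 (C2, (r2, a2)) q" for r' a' q
    unfolding C3_def T3_def
  proof (rule good_Seq, rule ok_good[OF order_classes_ok])
    show "env r' a'" "\<And>v. v < n \<Longrightarrow> a' 1 v \<le> k - 1" "\<And>i. i < l * k \<Longrightarrow> a' 2 i \<le> 1"
      using v g by (auto simp: valid_def)
    fix r2 a2
    assume 2: "env r2 a2 \<and> r2 0 = r' 0 \<and> r2 7 = r' 7 \<and> a2 1 = survivors (a' 1) (a' 2) \<and>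
      inj_on (a2 9) {..<n} \<and>
      (\<forall>v<n. card {q \<in> entries (a2 1) m. mate q = v \<and> a2 9 v < a2 9 (inp q)} \<le> d)"
    have "valid r2 a2" using 2 v by (auto simp: valid_def survivors_def)
    then show "good A T2 ((fill 3 4 2 ;; test_classes) # cs, (r2, a2)) q"
      unfolding C2_def[symmetric] using 2 by (intro good) blast+
  qed
  have C4: "good A T4 (C4, (r', a')) (p0 + (q - p0) * (\<Prod>i<l * k. real (card (X i)) / (real 1 + 1)))"
    if v: "valid r' a'" and X: "\<And>i. X i \<subseteq> {..1}" and q: "p0 \<le> q"
      and good: "\<And>r2 f. valid r2 (a'(2 := f)) \<Longrightarrow> \<forall>i<l * k. f i \<le> 1 \<Longrightarrow> \<forall>i<l * k. f i \<in> X i \<Longrightarrow>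
        good A T3 (C3, (r2, a'(2 := f))) q"
    for r' a' X q
    unfolding C4_def T4_def
  proof (rule good_Seq, rule fill_good[where n = 8 and b = 11 and r = r' and T = T3 and X = X,
        unfolded envD[OF v[unfolded valid_def, THEN conjunct1]]])
    fix r2 and f :: "nat \<Rightarrow> nat"
    assume "same_outside {20, 21, 29} r2 r'" and f: "\<forall>i<l * k. f i \<le> 1"
    then have v2: "valid r2 (a'(2 := f))" using valid_upd[OF v] by simp
    have "good A T3 (C3, (r2, a'(2 := f))) p0"
      by (rule C3[OF v2]) (use f C2_any in auto)
    then show "good A T3 ((order_classes ;; fill 3 4 2 ;; test_classes) # cs, (r2, a'(2 := f)))
        (if \<forall>i<l * k. f i \<in> X i then q else p0)"
      using good[OF v2 f] unfolding C3_def by simp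
  qed (use X q in auto)
  have C4_any: "good A T4 (C4, (r', a')) p0" if v: "valid r' a'" for r' a'
  proof -
    have "good A T4 (C4, (r', a'))
        (p0 + (p0 - p0) * (\<Prod>i<l * k. real (card {..1::nat}) / (real 1 + 1)))"
    proof (rule C4[OF v])
      fix r2 and f :: "nat \<Rightarrow> nat"
      assume v2: "valid r2 (a'(2 := f))" and f: "\<forall>i<l * k. f i \<le> 1"
      show "good A T3 (C3, (r2, a'(2 := f))) p0"
        by (rule C3[OF v2 _ C2_any]) (use f in simp_all)
    qed simp_all
    then show ?thesis by simp
  qed
  have C5: "good A (T + iteration_time) (iteration # cs, (r, a))
      (p0 + (q - p0) * (\<Prod>v<n. real (card (X v)) / (real (k - 1) + 1)))"
    if X: "\<And>i. X i \<subseteq> {..k - 1}" and q: "p0 \<le> q"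
      and good: "\<And>r2 f. valid r2 (a(1 := f)) \<Longrightarrow> \<forall>v<n. f v \<in> X v \<Longrightarrow> good A T4 (C4, (r2, a(1 := f))) q"
    for X q
  proof -
    have "good A (Suc (T4 + n * 10 + 5)) (iteration # cs, (r, a))
      (p0 + (q - p0) * (\<Prod>v<n. real (card (X v)) / (real (k - 1) + 1)))"
      unfolding iteration_def
    proof (rule good_Seq, rule fill_good[where n = 4 and b = 6 and r = r and T = T4 and X = X,
        unfolded envD[OF env]])
      fix r2 and f :: "nat \<Rightarrow> nat"
      assume so: "same_outside {20, 21, 29} r2 r" and f: "\<forall>v<n. f v \<le> k - 1"
      have v2: "valid r2 (a(1 := f))"
        using env_upd[OF env so, of 1 f] so f by (auto simp: valid_def same_outside_def)
      show "good A T4 ((fill 2 8 11 ;; order_classes ;; fill 3 4 2 ;; test_classes) # cs, (r2, a(1 := f)))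
          (if \<forall>v<n. f v \<in> X v then q else p0)"
        using C4_any[OF v2] good[OF v2] unfolding C4_def by simp
    qed (use X q in auto)
    then show ?thesis
      by (rule good_mono) (simp_all add: T1_def T2_def T3_def T4_def iteration_time_def)
  qed
  show ?thesis
  proof (cases "spgc_yes k V E")
    case False
    then show ?thesis using C5[of "\<lambda>_. {..k - 1}" p0] C4_any by simp
  next
    case True
    obtain W cw where W: "W \<subseteq> {..<n}" "card W \<le> k\<^sup>2" "k = 1 \<Longrightarrow> W = {}"
      "\<And>v. v \<in> W \<Longrightarrow> cw v < k - 1" "\<And>u v. adj u v \<Longrightarrow> cw u \<noteq> cw v"
      "\<And>c. \<forall>v\<in>W. c v = cw v \<Longrightarrow> \<forall>u v. adj u v \<longrightarrow> c u = c v \<longrightarrow> c u = k - 1 \<Longrightarrow>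
        \<forall>v<n. c v \<le> k - 1 \<Longrightarrow> \<forall>i<k. \<exists>v. dominates c i v"
      by (rule yes_target[OF True]) blast
    \<comment> \<open>Bounds are built backwards: \<open>q3\<close> holds before the subsampling and
      \<open>q4\<close> before the biclique guesses, both provided that \<open>W\<close> still has
      its target colors.\<close>
    define q3 where "q3 = p0 + (p1 - p0) * (1 / (4 * (real d + 1))) ^ card W"
    have G2: "good A T2 (C2, (r', a')) q3"
      if v: "valid r' a'" and c: "\<forall>v\<in>W. a' 1 v = cw v" and pos: "inj_on (a' 9) {..<n}"
        "\<forall>v<n. card {q \<in> entries (a' 1) m. mate q = v \<and> a' 9 v < a' 9 (inp q)} \<le> d" for r' a'
    proof -
      obtain X where X: "\<And>v. X v \<subseteq> {..d}"
        "(1 / (4 * (real d + 1))) ^ card W \<le> (\<Prod>v<n. real (card (X v)) / (real d + 1))"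
        "\<And>s c'. \<forall>v<n. s v \<in> X v \<Longrightarrow> cleaned (a' 1) s (a' 9) c' \<Longrightarrow> \<forall>v\<in>W. c' v = cw v"
        by (rule subsample_targets[of W cw "a' 1" "a' 9"]) (use W(1,4,5) c pos in blast)+
      have "good A T2 (C2, (r', a')) (p0 + (p1 - p0) * (\<Prod>v<n. real (card (X v)) / (real d + 1)))"
      proof (rule C2[OF v X(1) p])
        fix r2 f assume v2: "valid r2 (a'(3 := f))" and f: "\<forall>v<n. f v \<in> X v"
        have "\<forall>i<k. \<exists>v. dominates c' i v" if cl: "cleaned (a' 1) f (a' 9) c'" for c'
          by (rule W(6)[OF X(3)[OF f cl] cl[unfolded cleaned_def, THEN conjunct2, THEN conjunct1]
              cl[unfolded cleaned_def, THEN conjunct1]])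
        then have "acc (a'(3 := f))" by (simp add: acc_def)
        then show "good A T1 (C1, (r2, a'(3 := f))) p1" using C1[OF v2] by (simp only: if_True)
      qed
      then show ?thesis
        by (rule good_mono) (use X(2) p in \<open>auto simp: q3_def intro!: mult_left_mono\<close>)
    qed
    have q3: "p0 \<le> q3" using p by (simp add: q3_def)
    obtain X2 where X2: "\<And>i. X2 i \<subseteq> {..1}"
      "(1 / 2) ^ (l * (k - 1)) \<le> (\<Prod>i<l * k. real (card (X2 i)) / (real 1 + 1))"
      "\<And>g c. \<forall>i<l * k. g i \<in> X2 i \<Longrightarrow> \<forall>v\<in>W. c v = cw v \<Longrightarrow> \<forall>v\<in>W. survivors c g v = cw v"
      by (rule guess_targets[of W cw]) (use W(1,4,5) in blast)+
    define q4 where "q4 = p0 + (q3 - p0) * (1 / 2) ^ (l * (k - 1))"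
    have q4: "p0 \<le> q4" using q3 by (simp add: q4_def)
    have G4: "good A T4 (C4, (r', a')) q4" if v: "valid r' a'" and c: "\<forall>v\<in>W. a' 1 v = cw v" for r' a'
    proof -
      have "good A T4 (C4, (r', a')) (p0 + (q3 - p0) * (\<Prod>i<l * k. real (card (X2 i)) / (real 1 + 1)))"
      proof (rule C4[OF v X2(1) q3])
        fix r2 and f :: "nat \<Rightarrow> nat"
        assume v2: "valid r2 (a'(2 := f))" and f: "\<forall>i<l * k. f i \<le> 1" "\<forall>i<l * k. f i \<in> X2 i"
        have sv: "\<forall>v\<in>W. survivors (a' 1) f v = cw v" by (rule X2(3)[OF f(2) c])
        show "good A T3 (C3, (r2, a'(2 := f))) q3"
        proof (rule C3[OF v2])
          fix r3 a3
          assume 3: "valid r3 a3" "a3 1 = survivors ((a'(2 := f)) 1) ((a'(2 := f)) 2)"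
            "inj_on (a3 9) {..<n}"
            "\<forall>v<n. card {q \<in> entries (a3 1) m. mate q = v \<and> a3 9 v < a3 9 (inp q)} \<le> d"
          have "\<forall>v\<in>W. a3 1 v = cw v" using 3(2) sv by simp
          then show "good A T2 (C2, (r3, a3)) q3" by (rule G2[OF 3(1) _ 3(3,4)])
        qed (use f in simp)
      qed
      then show ?thesis
        by (rule good_mono) (use X2(2) q3 in \<open>auto simp: q4_def intro!: mult_left_mono\<close>)
    qed
    obtain X1 where X1: "\<And>v. X1 v \<subseteq> {..k - 1}"
      "(1 / real k) ^ card W = (\<Prod>v<n. real (card (X1 v)) / (real (k - 1) + 1))"
      "\<And>c. \<forall>v<n. c v \<in> X1 v \<Longrightarrow> \<forall>v\<in>W. c v = cw v"
      by (rule color_targets[of W cw]) (use W(1,4) in blast)+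
    have "good A (T + iteration_time) (iteration # cs, (r, a))
      (p0 + (q4 - p0) * (\<Prod>v<n. real (card (X1 v)) / (real (k - 1) + 1)))"
      by (rule C5[OF X1(1) q4]) (use X1(3) G4 in auto)
    then show ?thesis
    proof (rule good_mono)
      have "(q4 - p0) * (1 / real k) ^ card W = (p1 - p0) *
        ((1 / real k) ^ card W * ((1 / 2) ^ (l * (k - 1)) * (1 / (4 * (real d + 1))) ^ card W))"
        by (simp add: q4_def q3_def mult_ac)
      also have "\<dots> \<ge> (p1 - p0) * success_prob"
        by (rule mult_left_mono[OF success_prob_le]) (use W(2,3) p in auto)
      finally show "p0 + (p1 - p0) * (if spgc_yes k V E then success_prob else 0)
          \<le> p0 + (q4 - p0) * (\<Prod>v<n. real (card (X1 v)) / (real (k - 1) + 1))"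
        using True X1(2) by simp
    qed simp
  qed
qed

end

section \<open>The algorithm\<close>

text \<open>Without a multiplication command, each inner pass multiplies register 7 by register 13
  through repeated addition; adding the \<open>0\<close> in register 24 copies the result. There are
  \<open>k * (2 * k)\<close> such passes.\<close>

definition power_loop :: com where
  "power_loop = For 20 1 (For 21 14 (Const 22 0 ;; For 23 13 (Add 22 22 7) ;; Const 24 0 ;; Add 7 22 24))"

definition double_loop :: com where
  "double_loop = For 20 3 (For 21 6 (Add 7 7 7))"

text \<open>Registers 12 to 14 serve the round count: \<open>d + 1\<close>, an accumulator for
  \<open>k * (d + 1)\<close>, and \<open>2 * k\<close>. The \<open>2\<close> in register 7 is the
  leading factor of the count.\<close>

definition read_header :: com where
  "read_header = Const 20 0 ;; Load 1 0 20 ;; Const 20 1 ;; Load 2 0 20 ;; Const 20 2 ;; Load 3 0 20 ;;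
     Const 20 3 ;; Load 4 0 20 ;; Const 20 4 ;; Load 5 0 20 ;; Const 11 1 ;; Sub 6 1 11 ;;
     Add 9 5 5 ;; Add 9 4 9 ;; Const 8 0 ;; Add 12 2 11 ;; Const 13 0 ;; Add 14 1 1 ;; Const 7 2"

definition prepare :: com where
  "prepare = read_header ;; For 20 3 (Add 8 8 1) ;; For 20 1 (Add 13 13 12) ;; power_loop ;; double_loop"

definition main_loop :: com where
  "main_loop = While 7 (iteration ;; Const 28 1 ;; Sub 7 7 28)"

definition spgc_algorithm :: com where
  "spgc_algorithm = prepare ;; main_loop"

lemma ok_mult_loop:
  assumes "i \<noteq> n" "i \<noteq> 29" "n \<noteq> 29" "x \<noteq> i" "x \<noteq> n" "x \<noteq> 29" "y \<noteq> x" "y \<noteq> i" "y \<noteq> 29"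
  shows "ok (For i n (Add x x y)) r a (r n * 8 + 5) (\<lambda>r' a'. r' x = r x + r n * r y)"
proof (rule ok_For[where I = "\<lambda>j r' a'. r' x = r x + j * r y" and \<tau> = 1])
  fix j r' a'
  assume so: "same_outside ({i, 29} \<union> mods (Add x x y)) r' r" and I: "r' x = r x + j * r y"
  have "r' y = r y" using same_outsideD[OF so] assms by auto
  then show "ok (Add x x y) r' a' 1 (\<lambda>r' a'. r' x = r x + Suc j * r y)"
    using I by (intro ok_wp) auto
qed (use assms in auto)

lemma power_loop_ok:
  "ok power_loop r a (r 1 * (r 14 * (r 13 * 8 + 30) + 20) + 5)
    (\<lambda>r' a'. r' 7 = r 7 * r 13 ^ (r 1 * r 14))"
  unfolding power_loop_def
proof (rule ok_For[where I = "\<lambda>j r' a'. r' 7 = r 7 * r 13 ^ (j * r 14)"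
      and \<tau> = "r 14 * (r 13 * 8 + 30) + 5"])
  let ?mul = "Const 22 0 ;; For 23 13 (Add 22 22 7) ;; Const 24 0 ;; Add 7 22 24"
  fix j r1 a1
  assume so: "same_outside ({20, 29} \<union> mods (For 21 14 ?mul)) r1 r" and I: "r1 7 = r 7 * r 13 ^ (j * r 14)"
  have r1: "r1 13 = r 13" "r1 14 = r 14" using same_outsideD[OF so] by auto
  have "ok (For 21 14 ?mul) r1 a1 (r 14 * (r 13 * 8 + 30) + 5)
      ((\<lambda>i r' a'. r' 7 = r1 7 * r 13 ^ i) (r1 14))"
  proof (rule ok_For[where \<tau> = "r 13 * 8 + 20"])
    fix i r2 a2
    assume so2: "same_outside ({21, 29} \<union> mods ?mul) r2 r1" and I2: "r2 7 = r1 7 * r 13 ^ i"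
    have r2: "r2 13 = r 13" using same_outsideD[OF so2] r1 by auto
    have mul: "ok (For 23 13 (Add 22 22 7)) (r2(22 := 0)) a2 (r 13 * 8 + 5) (\<lambda>r' a'. r' 22 = r 13 * r2 7)"
      using ok_mult_loop[of 23 13 22 7 "r2(22 := 0)" a2] r2 by simp
    show "ok ?mul r2 a2 (r 13 * 8 + 20) (\<lambda>r' a'. r' 7 = r1 7 * r 13 ^ Suc i)"
    proof (rule ok_Seq_wp, unfold wp.simps, rule ok_Seq[OF mul, where \<sigma> = 5])
      fix r3 :: regs and a3 :: arrays assume "r3 22 = r 13 * r2 7"
      then show "ok (Const 24 0 ;; Add 7 22 24) r3 a3 5 (\<lambda>r' a'. r' 7 = r1 7 * r 13 ^ Suc i)"
        using I2 by (intro ok_wp) simp_all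
    qed simp_all
  qed (use r1 in \<open>auto simp: algebra_simps\<close>)
  then show "ok (For 21 14 ?mul) r1 a1 (r 14 * (r 13 * 8 + 30) + 5) (\<lambda>r' a'. r' 7 = r 7 * r 13 ^ (Suc j * r 14))"
    by (rule ok_conseq) (use I r1 in \<open>auto simp: power_add\<close>)
qed (auto simp: algebra_simps)

lemma double_loop_ok:
  "ok double_loop r a (r 3 * (r 6 * 8 + 20) + 5) (\<lambda>r' a'. r' 7 = r 7 * 2 ^ (r 3 * r 6))"
  unfolding double_loop_def
proof (rule ok_For[where I = "\<lambda>j r' a'. r' 7 = r 7 * 2 ^ (j * r 6)" and \<tau> = "r 6 * 8 + 5"])
  fix j r1 a1
  assume so: "same_outside ({20, 29} \<union> mods (For 21 6 (Add 7 7 7))) r1 r" and I: "r1 7 = r 7 * 2 ^ (j * r 6)"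
  have r1: "r1 6 = r 6" using same_outsideD[OF so] by auto
  have "ok (For 21 6 (Add 7 7 7)) r1 a1 (r 6 * 8 + 5) ((\<lambda>i r' a'. r' 7 = r1 7 * 2 ^ i) (r1 6))"
  proof (rule ok_For[where \<tau> = 1])
    fix i and r2 :: regs and a2
    assume "r2 7 = r1 7 * 2 ^ i"
    then show "ok (Add 7 7 7) r2 a2 1 (\<lambda>r' a'. r' 7 = r1 7 * 2 ^ Suc i)"
      by (intro ok_wp) auto
  qed (use r1 in auto)
  then show "ok (For 21 6 (Add 7 7 7)) r1 a1 (r 6 * 8 + 5) (\<lambda>r' a'. r' 7 = r 7 * 2 ^ (Suc j * r 6))"
    by (rule ok_conseq) (use I r1 in \<open>auto simp: power_add\<close>)
qed (auto simp: algebra_simps)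

section \<open>Number of rounds, amplification and total time\<close>

context spgc_input
begin

text \<open>This is \<open>2 / success_prob\<close>, so all rounds fail together with probability at
  most \<open>exp (- 2) <= 1 / 3\<close>.\<close>

definition rounds :: nat where
  "rounds = 2 * (k * (d + 1)) ^ (2 * k\<^sup>2) * 2 ^ (l * (k - 1))"

definition prepare_time :: nat where
  "prepare_time = 90 + l * 8 + k * 8 + k * (2 * k * (k * (d + 1) * 8 + 30) + 20) + l * ((k - 1) * 8 + 20)"

lemma prepare_ok:
  assumes a: "a 0 = inp"
  shows "ok prepare r a prepare_time (\<lambda>r' a'. env r' a' \<and> r' 0 = r 0 \<and> r' 7 = rounds)"
proof -
  have inp1: "inp 1 = d" using inp_header by (simp add: One_nat_def)
  let ?H = "\<lambda>r1 a1. a1 = a \<and> r1 1 = k \<and> r1 2 = d \<and> r1 3 = l \<and> r1 4 = n \<and> r1 5 = m \<and> r1 6 = k - 1 \<and>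
    r1 9 = n + 2 * m \<and> r1 11 = 1 \<and> r1 8 = 0 \<and> r1 12 = d + 1 \<and> r1 13 = 0 \<and> r1 14 = 2 * k \<and> r1 7 = 2"
  have 0: "ok read_header r a 60 ?H"
    by (rule ok_wp) (simp_all add: read_header_def a inp1)
  let ?Q = "\<lambda>r' a'. r' 8 = l * k \<and> r' 7 = rounds \<and> a' 0 = inp \<and>
      r' 1 = k \<and> r' 2 = d \<and> r' 3 = l \<and> r' 4 = n \<and> r' 5 = m \<and> r' 6 = k - 1 \<and> r' 9 = n + 2 * m \<and> r' 11 = 1"
  have "ok prepare r a prepare_time ?Q"
    unfolding prepare_def
  proof (rule ok_Seq[OF 0, where \<sigma> = "25 + l * 8 + k * 8 + k * (2 * k * (k * (d + 1) * 8 + 30) + 20) + l * ((k - 1) * 8 + 20)"])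
    fix r1 :: regs and a1 :: arrays assume 1: "?H r1 a1"
    have m1: "ok (For 20 3 (Add 8 8 1)) r1 a1 (l * 8 + 5) (\<lambda>r' a'. r' 8 = l * k)"
      using ok_mult_loop[of 20 3 8 1 r1 a1] 1 by simp
    show "ok (For 20 3 (Add 8 8 1) ;; For 20 1 (Add 13 13 12) ;; power_loop ;; double_loop) r1 a1
       (25 + l * 8 + k * 8 + k * (2 * k * (k * (d + 1) * 8 + 30) + 20) + l * ((k - 1) * 8 + 20))
       ?Q"
    proof (rule ok_Seq[OF ok_frame[OF m1], where \<sigma> =
        "19 + k * 8 + k * (2 * k * (k * (d + 1) * 8 + 30) + 20) + l * ((k - 1) * 8 + 20)"])
      fix r2 :: regs and a2 :: arrays
      assume "r2 8 = l * k \<and> same_outside (mods (For 20 3 (Add 8 8 1))) r2 r1 \<and>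
        same_outside (arrs (For 20 3 (Add 8 8 1))) a2 a1"
      then have 2: "r2 8 = l * k" "a2 0 = inp" "r2 1 = k" "r2 2 = d" "r2 3 = l" "r2 4 = n" "r2 5 = m"
        "r2 6 = k - 1" "r2 9 = n + 2 * m" "r2 11 = 1" "r2 12 = d + 1" "r2 13 = 0" "r2 14 = 2 * k" "r2 7 = 2"
        using 1 a by (auto simp: same_outside_def)
      have m2: "ok (For 20 1 (Add 13 13 12)) r2 a2 (k * 8 + 5) (\<lambda>r' a'. r' 13 = k * (d + 1))"
        using ok_mult_loop[of 20 1 13 12 r2 a2] 2 by simp
      show "ok (For 20 1 (Add 13 13 12) ;; power_loop ;; double_loop) r2 a2
         (19 + k * 8 + k * (2 * k * (k * (d + 1) * 8 + 30) + 20) + l * ((k - 1) * 8 + 20))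
         ?Q"
      proof (rule ok_Seq[OF ok_frame[OF m2], where \<sigma> =
          "13 + k * (2 * k * (k * (d + 1) * 8 + 30) + 20) + l * ((k - 1) * 8 + 20)"])
        fix r3 :: regs and a3 :: arrays
        assume "r3 13 = k * (d + 1) \<and> same_outside (mods (For 20 1 (Add 13 13 12))) r3 r2 \<and>
          same_outside (arrs (For 20 1 (Add 13 13 12))) a3 a2"
        then have 3: "r3 8 = l * k" "a3 0 = inp" "r3 1 = k" "r3 2 = d" "r3 3 = l" "r3 4 = n" "r3 5 = m"
          "r3 6 = k - 1" "r3 9 = n + 2 * m" "r3 11 = 1" "r3 13 = k * (d + 1)" "r3 14 = 2 * k" "r3 7 = 2"
          using 2 by (auto simp: same_outside_def)
        have m3: "ok power_loop r3 a3 (k * (2 * k * (k * (d + 1) * 8 + 30) + 20) + 5)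
            (\<lambda>r' a'. r' 7 = 2 * (k * (d + 1)) ^ (2 * k\<^sup>2))"
          using power_loop_ok[of r3 a3] unfolding 3 by (simp only: power2_eq_square mult_ac)
        show "ok (power_loop ;; double_loop) r3 a3
           (13 + k * (2 * k * (k * (d + 1) * 8 + 30) + 20) + l * ((k - 1) * 8 + 20))
           ?Q"
        proof (rule ok_Seq[OF ok_frame[OF m3], where \<sigma> = "7 + l * ((k - 1) * 8 + 20)"])
          fix r4 :: regs and a4 :: arrays
          assume "r4 7 = 2 * (k * (d + 1)) ^ (2 * k\<^sup>2) \<and> same_outside (mods power_loop) r4 r3 \<and>
            same_outside (arrs power_loop) a4 a3"
          then have 4: "r4 8 = l * k" "a4 0 = inp" "r4 1 = k" "r4 2 = d" "r4 3 = l" "r4 4 = n" "r4 5 = m"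
            "r4 6 = k - 1" "r4 9 = n + 2 * m" "r4 11 = 1" "r4 7 = 2 * (k * (d + 1)) ^ (2 * k\<^sup>2)"
            using 3 by (auto simp: same_outside_def power_loop_def)
          show "ok double_loop r4 a4 (7 + l * ((k - 1) * 8 + 20))
             ?Q"
          proof (rule ok_conseq_frame[OF double_loop_ok])
            fix r5 :: regs and a5 :: arrays
            assume 5: "r5 7 = r4 7 * 2 ^ (r4 3 * r4 6)" and so: "same_outside (mods double_loop) r5 r4"
              "same_outside (arrs double_loop) a5 a4"
            have "r5 7 = rounds" unfolding rounds_def 5 4 ..
            then show "?Q r5 a5"
              using 4 same_outsideD[OF so(1)] same_outsideD[OF so(2)] by (simp add: double_loop_def)
          qed (simp add: 4)
        qed simp
      qed simp
    qed simp
  qed (simp add: prepare_time_def)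
  then show ?thesis
  proof (rule ok_conseq_frame)
    fix r' :: regs and a' :: arrays
    assume 1: "?Q r' a'"
      and so: "same_outside (mods prepare) r' r"
    have "r' 0 = r 0"
      using same_outsideD[OF so, of 0]
      by (simp add: prepare_def read_header_def power_loop_def double_loop_def)
    then show "env r' a' \<and> r' 0 = r 0 \<and> r' 7 = rounds" using 1 by (simp add: env_def)
  qed simp
qed

lemma main_loop_step:
  fixes p0 p1 :: real
  assumes env: "env r a" and r7: "r 7 = Suc c" and p: "p0 \<le> p1"
    and cont: "\<And>r' a'. env r' a' \<Longrightarrow> r' 7 = c \<Longrightarrow> (r 0 \<noteq> 0 \<longrightarrow> r' 0 \<noteq> 0) \<Longrightarrow>
      (r' 0 \<noteq> 0 \<longrightarrow> r 0 \<noteq> 0 \<or> spgc_yes k V E) \<Longrightarrow>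
      good A T ([main_loop], (r', a')) (if r' 0 \<noteq> 0 then p1 else p0)"
  shows "good A (T + (iteration_time + 6)) ([main_loop], (r, a))
    (p0 + (p1 - p0) * (if spgc_yes k V E then success_prob else 0))"
proof -
  let ?dec = "Const 28 1 ;; Sub 7 7 28"
  have "good A (T + 4 + iteration_time) (iteration # [?dec, main_loop], (r, a))
    (p0 + (p1 - p0) * (if spgc_yes k V E then success_prob else 0))"
  proof (rule iteration_good[OF env p])
    fix r1 a1
    assume 1: "env r1 a1" "r1 7 = r 7" "r 0 \<noteq> 0 \<longrightarrow> r1 0 \<noteq> 0" "r1 0 \<noteq> 0 \<longrightarrow> r 0 \<noteq> 0 \<or> spgc_yes k V E"
    have "wp ?dec (\<lambda>r' a'. a' = a1 \<and> r' = r1(28 := 1, 7 := c)) r1 a1" using 1(2) r7 by simp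
    then have "ok ?dec r1 a1 4 (\<lambda>r' a'. a' = a1 \<and> r' = r1(28 := 1, 7 := c))"
      by (rule ok_wp[rotated]) simp
    then show "good A (T + 4) ([?dec, main_loop], (r1, a1)) (if r1 0 \<noteq> 0 then p1 else p0)"
    proof (rule ok_good)
      fix r2 a2 assume 2: "a2 = a1 \<and> r2 = r1(28 := 1, 7 := c)"
      then have "env r2 a2" using 1(1) by (simp add: env_def)
      then have "good A T ([main_loop], (r2, a2)) (if r2 0 \<noteq> 0 then p1 else p0)"
        by (rule cont) (use 1 2 in simp_all)
      then show "good A T ([main_loop], (r2, a2)) (if r1 0 \<noteq> 0 then p1 else p0)" using 2 by simp
    qed
  qed
  then have "good A (Suc (T + 4 + iteration_time)) ((iteration ;; ?dec) # [main_loop], (r, a))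
    (p0 + (p1 - p0) * (if spgc_yes k V E then success_prob else 0))"
    by (rule good_Seq)
  then have "good A (Suc (Suc (T + 4 + iteration_time))) ([main_loop], (r, a))
    (p0 + (p1 - p0) * (if spgc_yes k V E then success_prob else 0))"
    by (rule good_step[rotated]) (simp add: main_loop_def r7)
  then show ?thesis by (rule good_mono) simp_all
qed

lemma main_loop_end:
  assumes "r 7 = 0" "p \<le> (if ([], (r, a)) \<in> A then 1 else 0)"
  shows "good A 1 ([main_loop], (r, a)) p"
proof -
  have "good A (Suc 0) ([main_loop], (r, a)) p"
    by (rule good_step[OF _ good_halted[OF assms(2)]]) (simp add: main_loop_def assms(1))
  then show ?thesis by (simp add: One_nat_def)
qed

text \<open>A positive answer is never revoked, so its bound is \<open>1\<close>. Otherwise, if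
  \<open>q\<close> is the bound for the \<open>c\<close> rounds to follow, the present round
  improves it to \<open>q + (1 - q) * success_prob\<close>, which is the recursion of
  \<open>1 - (1 - success_prob) ^ c\<close>.\<close>

lemma main_loop_yes:
  assumes yes: "spgc_yes k V E"
  shows "env r a \<Longrightarrow> r 7 = c \<Longrightarrow>
    good {cfg. halted cfg \<and> fst (snd cfg) 0 \<noteq> 0} (c * (iteration_time + 6) + 1) ([main_loop], (r, a))
      (if r 0 \<noteq> 0 then 1 else 1 - (1 - success_prob) ^ c)"
proof (induction c arbitrary: r a)
  case 0
  have "good {cfg. halted cfg \<and> fst (snd cfg) 0 \<noteq> 0} 1 ([main_loop], (r, a))
      (if r 0 \<noteq> 0 then 1 else 1 - (1 - success_prob) ^ 0)"
    by (rule main_loop_end) (use 0 in \<open>auto simp: halted_def\<close>)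
  then show ?case by simp
next
  case (Suc c)
  let ?A = "{cfg::config. halted cfg \<and> fst (snd cfg) 0 \<noteq> 0}"
  let ?q = "1 - (1 - success_prob) ^ c"
  have q: "?q \<le> 1" using success_prob_bounds by simp
  have "good ?A (c * (iteration_time + 6) + 1 + (iteration_time + 6)) ([main_loop], (r, a))
      (if r 0 \<noteq> 0 then 1 else 1 - (1 - success_prob) ^ Suc c)"
  proof (cases "r 0 = 0")
    case True
    have 1: "good ?A (c * (iteration_time + 6) + 1 + (iteration_time + 6)) ([main_loop], (r, a))
        (?q + (1 - ?q) * (if spgc_yes k V E then success_prob else 0))"
      by (rule main_loop_step[OF Suc.prems q]) (rule Suc.IH)
    have 2: "?q + (1 - ?q) * (if spgc_yes k V E then success_prob else 0) = 1 - (1 - success_prob) ^ Suc c"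
      using yes by (simp add: algebra_simps)
    show ?thesis using 1 True unfolding 2 by simp
  next
    case False
    have "good ?A (c * (iteration_time + 6) + 1 + (iteration_time + 6)) ([main_loop], (r, a))
        (1 + (1 - 1) * (if spgc_yes k V E then success_prob else 0))"
    proof (rule main_loop_step[OF Suc.prems])
      fix r' a' assume "env r' a'" "r' 7 = c" "r 0 \<noteq> 0 \<longrightarrow> r' 0 \<noteq> 0"
      then show "good ?A (c * (iteration_time + 6) + 1) ([main_loop], (r', a')) (if r' 0 \<noteq> 0 then 1 else 1)"
        using Suc.IH[of r' a'] False by simp
    qed simp
    then show ?thesis using False by simp
  qed
  then show ?case by (simp add: algebra_simps)
qed

lemma main_loop_no:
  assumes no: "\<not> spgc_yes k V E"
  shows "env r a \<Longrightarrow> r 7 = c \<Longrightarrow> r 0 = 0 \<Longrightarrow>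
    good {cfg. halted cfg \<and> fst (snd cfg) 0 = 0} (c * (iteration_time + 6) + 1) ([main_loop], (r, a)) 1"
proof (induction c arbitrary: r a)
  case 0
  have "good {cfg. halted cfg \<and> fst (snd cfg) 0 = 0} 1 ([main_loop], (r, a)) 1"
    by (rule main_loop_end) (use 0 in \<open>auto simp: halted_def\<close>)
  then show ?case by simp
next
  case (Suc c)
  let ?A = "{cfg::config. halted cfg \<and> fst (snd cfg) 0 = 0}"
  \<comment> \<open>Both bounds are \<open>1\<close>: on a no-instance each round leaves the answer
    \<open>0\<close> with certainty, so there is neither gain nor loss.\<close>
  have "good ?A (c * (iteration_time + 6) + 1 + (iteration_time + 6)) ([main_loop], (r, a))
      (1 + (1 - 1) * (if spgc_yes k V E then success_prob else 0))"
  proof (rule main_loop_step[OF Suc.prems(1,2)])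
    fix r' a' assume "env r' a'" "r' 7 = c" "r' 0 \<noteq> 0 \<longrightarrow> r 0 \<noteq> 0 \<or> spgc_yes k V E"
    then show "good ?A (c * (iteration_time + 6) + 1) ([main_loop], (r', a')) (if r' 0 \<noteq> 0 then 1 else 1)"
      using Suc.IH[of r' a'] no Suc.prems(3) by simp
  qed simp
  then show ?case by (simp add: algebra_simps)
qed

lemma algorithm_good:
  assumes "\<And>r a. env r a \<Longrightarrow> r 0 = 0 \<Longrightarrow> r 7 = rounds \<Longrightarrow> good A T ([main_loop], (r, a)) p"
  shows "good A (T + prepare_time + 1) (init spgc_algorithm xs) p"
proof -
  let ?a = "\<lambda>b i. if b = 0 \<and> i < length xs then xs ! i else 0"
  have a0: "?a 0 = inp" unfolding inp_def by (simp add: fun_eq_iff)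
  have "good A (T + prepare_time) ([prepare, main_loop], (\<lambda>_. 0, ?a)) p"
    by (rule ok_good[OF prepare_ok[of ?a, OF a0]]) (use assms in auto)
  then have "good A (Suc (T + prepare_time)) ([prepare ;; main_loop], (\<lambda>_. 0, ?a)) p" by (rule good_Seq)
  then show ?thesis by (simp add: init_def spgc_algorithm_def Suc_eq_plus1)
qed

lemma rounds_prob: "1 - (1 - success_prob) ^ rounds \<ge> 2 / 3"
proof -
  have "real rounds * success_prob = 2"
  proof -
    have "real (k * (d + 1)) ^ (2 * k\<^sup>2) * 2 ^ (l * (k - 1)) \<noteq> 0" using k_ge1 by simp
    then show ?thesis unfolding rounds_def success_prob_def by (simp del: of_nat_add of_nat_Suc)
  qed
  moreover have "(1 - success_prob) ^ rounds \<le> exp (- success_prob) ^ rounds"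
    using success_prob_bounds exp_ge_add_one_self[of "- success_prob"] by (intro power_mono) auto
  moreover have "exp (- success_prob) ^ rounds = exp (- (real rounds * success_prob))"
    by (simp add: exp_of_nat_mult[symmetric])
  moreover have "exp (- 2) \<le> (1 / 3 :: real)"
  proof -
    have "(3::real) \<le> exp 2" using exp_ge_add_one_self[of "2::real"] by simp
    then have "inverse (exp 2) \<le> inverse (3::real)" by (intro le_imp_inverse_le) auto
    then show ?thesis by (simp add: exp_minus)
  qed
  ultimately show ?thesis by simp
qed

text \<open>A biclique has a nonempty side. The time bound relies on this, as it would be
  \<open>0\<close> for \<open>m + n = 0\<close>.\<close>

lemma n_ge1: "1 \<le> n"
proof -
  have l: "0 < l" using l_ge1 by linarith
  have "As ! 0 \<in> set As" using l length_As by simp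
  then have "fst (As ! 0) \<noteq> {}" using inst by (auto simp: spgc_instance_def biclique_in_def)
  then have "ls 0 \<noteq> []" using As_nth[OF l] by (metis fst_conv image_empty list.set(1))
  then show ?thesis using biclique_lists(5)[OF l] by (cases "ls 0") auto
qed

text \<open>A round costs a constant times \<open>k * l * (m + n)\<close>. The factor
  \<open>k\<close> is absorbed by the last \<open>k\<close> in the exponent of
  \<open>k * (d + 1)\<close>, and \<open>l\<close> by the \<open>2 ^ l\<close> between
  \<open>2 ^ (l * (k - 1))\<close> and \<open>2 ^ (l * k)\<close>. The rounds account for 2400 of
  the constant, the preparation for 300.\<close>

lemma total_time:
  "rounds * (iteration_time + 6) + 1 + prepare_time + 1 \<le>
    3000 * ((k * (d + 1)) ^ (2 * k\<^sup>2 + k) * 2 ^ (l * k) * (m + n))"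
proof -
  let ?B = "k * (d + 1)" and ?s = "m + n"
  have k1: "1 \<le> k" and l1: "1 \<le> l" and s1: "1 \<le> ?s" using k_ge1 l_ge1 n_ge1 by auto
  have kB: "k \<le> ?B" and B1: "1 \<le> ?B" using mult_le_mono[OF k1, of 1 "d + 1"] by auto
  have kk: "k \<le> ?B ^ k" using kB self_le_power[OF B1, of k] k1 by linarith
  have ll: "l \<le> 2 ^ l" using less_exp[of l] by simp
  have b: "x \<le> x * y" if "1 \<le> y" for x y :: nat using that by (cases y) auto
  have b': "x \<le> y * x" if "1 \<le> y" for x y :: nat using b[OF that, of x] by (simp only: mult.commute)
  \<comment> \<open>\<open>M\<close> dominates every term in the cost of a round, since
    \<open>k\<close>, \<open>l\<close> and \<open>m + n\<close> are all at least
    \<open>1\<close>.\<close>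
  define M where "M = k * l * ?s"
  have ks: "k * ?s \<le> M" unfolding M_def using b[OF l1, of "k * ?s"] by (simp add: mult_ac)
  have ls: "l * ?s \<le> M" unfolding M_def using b[OF k1, of "l * ?s"] by (simp add: mult_ac)
  have lk: "l * k \<le> M" unfolding M_def using b[OF s1, of "l * k"] by (simp add: mult_ac)
  have s: "?s \<le> M" using ks b'[OF k1, of ?s] by linarith
  have one: "1 \<le> M" using s s1 by linarith
  have k: "k \<le> M" using lk b'[OF l1, of k] by linarith
  have l: "l \<le> M" using lk b[OF k1, of l] by linarith
  have "l * (80 * n + 120) \<le> 80 * M + 120 * M"
    using ls l by (simp add: algebra_simps)
  moreover have "k * (50 * n + 80 * m + 80) \<le> 80 * M + 80 * M"
    using ks k by (simp add: algebra_simps)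
  ultimately have it: "iteration_time + 6 \<le> 1200 * M"
    unfolding iteration_time_def order_time_def test_time_def using s lk one by simp
  have pow: "2 ^ (l * (k - 1)) * 2 ^ l = (2::nat) ^ (l * k)"
  proof -
    have "l * (k - 1) + l = l * k" using k1 by (cases k) auto
    then show ?thesis by (simp only: power_add[symmetric])
  qed
  have "rounds * (iteration_time + 6) \<le> rounds * (1200 * M)" by (rule mult_le_mono2[OF it])
  also have "\<dots> = 2400 * (?B ^ (2 * k\<^sup>2) * 2 ^ (l * (k - 1)) * (k * l * ?s))"
    unfolding rounds_def M_def by (simp only: mult_ac)
  also have "\<dots> \<le> 2400 * (?B ^ (2 * k\<^sup>2) * 2 ^ (l * (k - 1)) * (?B ^ k * 2 ^ l * ?s))"
    by (intro mult_le_mono le_refl kk ll)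
  also have "\<dots> = 2400 * (?B ^ (2 * k\<^sup>2 + k) * (2 ^ (l * (k - 1)) * 2 ^ l) * ?s)"
    by (simp only: power_add mult_ac)
  finally have loop: "rounds * (iteration_time + 6) \<le> 2400 * (?B ^ (2 * k\<^sup>2 + k) * 2 ^ (l * k) * ?s)"
    unfolding pow .
  \<comment> \<open>Computing the round count by repeated addition dominates the preparation.
    \<open>D\<close> is at most the third power of \<open>?B\<close>, and
    \<open>3 <= 2 * k^2 + k\<close>.\<close>
  define D where "D = k * k * ?B"
  have kD: "k \<le> k * k" "k * k \<le> D" unfolding D_def by (rule b[OF k1], rule b[OF B1])
  then have D1: "1 \<le> D" using k1 by linarith
  have "k * (2 * k * (?B * 8 + 30) + 20) = 16 * D + 60 * (k * k) + 20 * k"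
    unfolding D_def by (simp add: algebra_simps)
  then have "k * (2 * k * (?B * 8 + 30) + 20) \<le> 16 * D + 60 * D + 20 * D"
    using kD by linarith
  moreover have "l * ((k - 1) * 8 + 20) \<le> l * (28 * D)"
  proof (intro mult_le_mono le_refl)
    have "k - 1 \<le> D" using kD by linarith
    then show "(k - 1) * 8 + 20 \<le> 28 * D" using D1 by linarith
  qed
  moreover have "D \<le> l * D" by (rule b'[OF l1])
  moreover have "l \<le> l * D" by (rule b[OF D1])
  moreover have "k \<le> D" using kD by linarith
  ultimately have st: "prepare_time + 2 \<le> 300 * (l * D)"
    unfolding prepare_time_def using D1 by linarith
  have "D \<le> ?B ^ 3" unfolding D_def power3_eq_cube by (intro mult_le_mono kB le_refl)
  also have "\<dots> \<le> ?B ^ (2 * k\<^sup>2 + k)"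
  proof (rule power_increasing[OF _ B1])
    have "k \<le> k\<^sup>2" unfolding power2_eq_square using b[OF k1, of k] .
    then show "3 \<le> 2 * k\<^sup>2 + k" using k1 by linarith
  qed
  finally have DB: "D \<le> ?B ^ (2 * k\<^sup>2 + k)" .
  have "l \<le> l * k" by (rule b[OF k1])
  then have "(2::nat) ^ l \<le> 2 ^ (l * k)" by (intro power_increasing) auto
  then have lk2: "l \<le> 2 ^ (l * k)" using ll by linarith
  have "l * D \<le> 2 ^ (l * k) * ?B ^ (2 * k\<^sup>2 + k)" by (intro mult_le_mono lk2 DB)
  also have "\<dots> \<le> 2 ^ (l * k) * ?B ^ (2 * k\<^sup>2 + k) * ?s" by (rule b[OF s1])
  finally have "l * D \<le> ?B ^ (2 * k\<^sup>2 + k) * 2 ^ (l * k) * ?s" by (simp add: mult_ac)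
  then show ?thesis using loop st by linarith
qed

end

theorem theorem13:
  shows "\<exists>(P :: com) (C :: nat).
    \<forall>(k :: nat) (d :: nat) (V :: nat set) (E :: nat set set)
      (As :: (nat set \<times> nat set) list) (xs :: nat list) (T :: nat).
      spgc_instance k d V E As \<longrightarrow>
      encodes xs k d V E As \<longrightarrow>
      T = C * ((k * (d + 1)) ^ (2 * k\<^sup>2 + k) * 2 ^ (length As * k) * (card E + card V)) \<longrightarrow>
      halts_within P xs T \<and>
      (\<not> spgc_yes k V E \<longrightarrow> prob_no P xs T = 1) \<and>
      (spgc_yes k V E \<longrightarrow> prob_yes P xs T \<ge> 2 / 3)"
proof (intro exI allI impI)
  fix k d :: nat and V :: "nat set" and E :: "nat set set" and As :: "(nat set \<times> nat set) list"
    and xs :: "nat list" and T :: nat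
  assume inst: "spgc_instance k d V E As" and enc: "encodes xs k d V E As"
    and T: "T = 3000 * ((k * (d + 1)) ^ (2 * k\<^sup>2 + k) * 2 ^ (length As * k) * (card E + card V))"
  obtain vs es bcs where "spgc_input k d V E As vs es bcs xs"
    using enc inst unfolding encodes_def spgc_input_def by blast
  then interpret spgc_input k d V E As vs es bcs xs .
  have T': "rounds * (iteration_time + 6) + 1 + prepare_time + 1 \<le> T"
    using total_time unfolding T card_V card_E length_As .
  show "halts_within spgc_algorithm xs T \<and>
      (\<not> spgc_yes k V E \<longrightarrow> prob_no spgc_algorithm xs T = 1) \<and>
      (spgc_yes k V E \<longrightarrow> prob_yes spgc_algorithm xs T \<ge> 2 / 3)"
  proof (cases "spgc_yes k V E")
    case True
    have "good {cfg. halted cfg \<and> fst (snd cfg) 0 \<noteq> 0} (rounds * (iteration_time + 6) + 1 + prepare_time + 1)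
        (init spgc_algorithm xs) (1 - (1 - success_prob) ^ rounds)"
    proof (rule algorithm_good)
      fix r a assume r: "env r a" "r 0 = 0" "r 7 = rounds"
      show "good {cfg. halted cfg \<and> fst (snd cfg) 0 \<noteq> 0} (rounds * (iteration_time + 6) + 1)
          ([main_loop], (r, a)) (1 - (1 - success_prob) ^ rounds)"
        using main_loop_yes[OF True r(1,3)] r(2) by simp
    qed
    then have "good {cfg. halted cfg \<and> fst (snd cfg) 0 \<noteq> 0} T (init spgc_algorithm xs) (2 / 3)"
      by (rule good_mono[OF _ T' rounds_prob])
    then show ?thesis using True by (simp add: good_def halts_within_def prob_yes_def)
  next
    case False
    have "good {cfg. halted cfg \<and> fst (snd cfg) 0 = 0} (rounds * (iteration_time + 6) + 1 + prepare_time + 1)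
        (init spgc_algorithm xs) 1"
      by (rule algorithm_good) (use main_loop_no[OF False] in auto)
    then have g: "good {cfg. halted cfg \<and> fst (snd cfg) 0 = 0} T (init spgc_algorithm xs) 1"
      by (rule good_mono[OF _ T' order_refl])
    then have "prob_no spgc_algorithm xs T \<ge> 1" by (simp add: good_def prob_no_def)
    moreover have "prob_no spgc_algorithm xs T \<le> 1" unfolding prob_no_def by simp
    ultimately show ?thesis using g False by (simp add: good_def halts_within_def)
  qed
qed

end
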